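(* Let $\varphi$ be a function of $\ell$. Suppose that for every weight vector $w\in(0,\infty)^\ell$ there is a deterministic online algorithm for the soft allocation problem in dimension $\ell$ with weights $w$ that is $\varphi(\ell)$-competitive. Then there is an $O(\varphi(\ell))$-competitive randomized algorithm for weighted interleaved myopic paging (WIMP) with $\ell$ weight classes (the constant in $O(\cdot)$ being absolute).
   Context: Soft allocation problem in dimension $\ell$ with weights $w\in(0,\infty)^\ell$: an algorithm maintains a point $x(t)\in\Delta^{\ell-1}=\{x\in[0,1]^\ell:\sum_i x_i=1\}$. At each time $t=1,2,\dots$ a direction $r_t\in\{1,\dots,\ell\}$ and a non-increasing function $f_t:[0,1]\to\mathbb{R}_{\ge0}\cup\{\infty\}$ are revealed; the algorithm moves from $x(t-1)$ to $x(t)$ (online: knowing only data revealed so far), paying $\sum_i w_i|x_i(t)-x_i(t-1)|+f_t(x_{r_t}(t))$; the goal is to minimize total cost. Weighted paging: pages with weights $w_p>0$, cache of size $k$, request sequence $\sigma_1,\sigma_2,\dots$; after time $t$ the cache must contain $\sigma_t$; loading page $p$ costs $w_p$. There are $\ell$ weight classes if weights take $\ell$ distinct values $w_1,\dots,w_\ell$. WIMP: when serving the request at time $t$, the algorithm knows $\sigma_1,\dots,\sigma_t$ and, for each pair of pages $p,p'$ of the same weight class, which of the two is requested earlier after time $t$, and nothing else about the future (in particular nothing about how requests of different classes interleave). Competitive ratio $\rho$ (for either problem): cost (expected cost for randomized algorithms) at most $\rho\cdot\mathrm{OPT}+b$ for a constant $b$ independent of the request sequence. *)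

theory Defs
  imports "HOL-Analysis.Analysis" "HOL-Library.Extended_Nat"
begin

definition sa_simplex :: "nat \<Rightarrow> (nat \<Rightarrow> real) set" where
  "sa_simplex l = {x. (\<forall>i<l. 0 \<le> x i \<and> x i \<le> 1) \<and> (\<Sum>i<l. x i) = 1 \<and> (\<forall>i\<ge>l. x i = 0)}"

type_synonym sa_request = "nat \<times> (real \<Rightarrow> ereal)"

definition valid_sa_request :: "nat \<Rightarrow> sa_request \<Rightarrow> bool" where
  "valid_sa_request l q \<longleftrightarrow> fst q < l \<and> (\<forall>y\<in>{0..1}. 0 \<le> snd q y) \<and>
     (\<forall>y z. 0 \<le> y \<longrightarrow> y \<le> z \<longrightarrow> z \<le> 1 \<longrightarrow> snd q z \<le> snd q y)"

definition sa_cost :: "nat \<Rightarrow> (nat \<Rightarrow> real) \<Rightarrow> sa_request list \<Rightarrow> (nat \<Rightarrow> nat \<Rightarrow> real) \<Rightarrow> ereal" where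
  "sa_cost l w rs x = (\<Sum>t<length rs.
      ereal (\<Sum>i<l. w i * \<bar>x (Suc t) i - x t i\<bar>) + snd (rs!t) (x (Suc t) (fst (rs!t))))"

definition sa_opt :: "nat \<Rightarrow> (nat \<Rightarrow> real) \<Rightarrow> sa_request list \<Rightarrow> (nat \<Rightarrow> real) \<Rightarrow> ereal" where
  "sa_opt l w rs x0 = Inf {sa_cost l w rs y | y. y 0 = x0 \<and> (\<forall>t\<le>length rs. y t \<in> sa_simplex l)}"

text \<open>Deterministic online algorithm: the point after time t is a function of the first t requests.\<close>
type_synonym sa_alg = "sa_request list \<Rightarrow> nat \<Rightarrow> real"

definition sa_competitive :: "nat \<Rightarrow> (nat \<Rightarrow> real) \<Rightarrow> sa_alg \<Rightarrow> real \<Rightarrow> bool" where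
  "sa_competitive l w A \<rho> \<longleftrightarrow>
     (\<forall>rs. list_all (valid_sa_request l) rs \<longrightarrow> A rs \<in> sa_simplex l) \<and>
     (\<exists>b::real. \<forall>rs. list_all (valid_sa_request l) rs \<longrightarrow>
        sa_cost l w rs (\<lambda>t. A (take t rs)) \<le> ereal \<rho> * sa_opt l w rs (A []) + ereal b)"

text \<open>Pages are natural numbers; sigma!(s-1) is the request at time s.
  next_req sigma t p: first time s > t at which p is requested (infinity if never).\<close>
definition next_req :: "nat list \<Rightarrow> nat \<Rightarrow> nat \<Rightarrow> enat" where
  "next_req \<sigma> t p = (if \<exists>s. t < s \<and> s \<le> length \<sigma> \<and> \<sigma>!(s-1) = p
      then enat (LEAST s. t < s \<and> s \<le> length \<sigma> \<and> \<sigma>!(s-1) = p) else \<infinity>)"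

type_synonym wimp_info = "nat list \<times> (nat \<Rightarrow> nat \<Rightarrow> bool)"

definition wimp_view :: "(nat \<Rightarrow> real) \<Rightarrow> nat list \<Rightarrow> nat \<Rightarrow> wimp_info" where
  "wimp_view wt \<sigma> t = (take t \<sigma>, \<lambda>p q. wt p = wt q \<and> next_req \<sigma> t p < next_req \<sigma> t q)"

type_synonym wimp_alg = "wimp_info \<Rightarrow> nat set"

definition wimp_caches :: "wimp_alg \<Rightarrow> (nat \<Rightarrow> real) \<Rightarrow> nat list \<Rightarrow> nat \<Rightarrow> nat set" where
  "wimp_caches D wt \<sigma> t = (if t = 0 then {} else D (wimp_view wt \<sigma> t))"

definition feasible_caches :: "nat \<Rightarrow> nat list \<Rightarrow> (nat \<Rightarrow> nat set) \<Rightarrow> bool" where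
  "feasible_caches k \<sigma> C \<longleftrightarrow> C 0 = {} \<and>
     (\<forall>t. 1 \<le> t \<and> t \<le> length \<sigma> \<longrightarrow> finite (C t) \<and> card (C t) \<le> k \<and> \<sigma>!(t-1) \<in> C t)"

definition paging_cost :: "(nat \<Rightarrow> real) \<Rightarrow> nat list \<Rightarrow> (nat \<Rightarrow> nat set) \<Rightarrow> ennreal" where
  "paging_cost wt \<sigma> C = (\<Sum>t<length \<sigma>. \<Sum>p\<in>C (Suc t) - C t. ennreal (wt p))"

definition paging_opt :: "(nat \<Rightarrow> real) \<Rightarrow> nat \<Rightarrow> nat list \<Rightarrow> ennreal" where
  "paging_opt wt k \<sigma> = Inf {paging_cost wt \<sigma> C | C. feasible_caches k \<sigma> C}"

text \<open>Randomized WIMP algorithm: a family of deterministic WIMP algorithms indexed by a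
  random seed omega uniformly distributed on [0,1] (oblivious adversary).\<close>
definition rand_wimp_competitive :: "(nat \<Rightarrow> real) \<Rightarrow> nat \<Rightarrow> (real \<Rightarrow> wimp_alg) \<Rightarrow> real \<Rightarrow> bool" where
  "rand_wimp_competitive wt k A \<rho> \<longleftrightarrow>
     (\<forall>\<omega>\<in>{0..1}. \<forall>\<sigma>. feasible_caches k \<sigma> (wimp_caches (A \<omega>) wt \<sigma>)) \<and>
     (\<forall>\<sigma>. (\<lambda>\<omega>. indicator {0..1} \<omega> * paging_cost wt \<sigma> (wimp_caches (A \<omega>) wt \<sigma>))
            \<in> borel_measurable lborel) \<and>
     (\<exists>b::real. \<forall>\<sigma>.
        (\<integral>\<^sup>+\<omega>. indicator {0..1} \<omega> * paging_cost wt \<sigma> (wimp_caches (A \<omega>) wt \<sigma>) \<partial>lborel)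
          \<le> ennreal \<rho> * paging_opt wt k \<sigma> + ennreal b)"

end

theory Submission
  imports Defs
begin

text \<open>Within one weight class, Belady's rule can be simulated from the order of next requests, and the caches
  of all sizes are the prefixes of a single priority stack. Whether a request is a hit thus depends only on
  whether its class owns at least as many slots as the stack position of the page, so the distribution of
  the \<open>k\<close> slots among the classes is a soft allocation problem whose cost functions are step functions.
  A cache sequence of cost \<open>c\<close> yields an allocation of cost \<open>O(c)\<close>, by a potential argument for Belady's rule
  with varying cache size. Conversely, a fractional allocation is rounded online: after rounding the weights
  to powers of 5, one maintains a random integer allocation with the fractional one as its mean, such that
  every coordinate and every total over the classes of weight at least a given threshold is rounded to a
  neighbouring integer. If the totals are repaired from the heaviest weight to the lightest, by exchanging slots
  between outcomes with too large and too small total, the expected movement stays within a constant factor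
  of the fractional one.\<close>

section \<open>Simple random variables on the unit interval\<close>

text \<open>The obstacle is that a change of the fractional allocation in a heavy class may upset
  totals that should be corrected at light weights only. Keeping the total of every heavy prefix
  within one unit across all outcomes removes it: two outcomes whose totals up to some level lie on
  opposite sides of the target must then differ within that level, so slots of that one weight
  suffice for the exchange, and the damage is passed on to lighter levels only, where it is
  geometrically cheaper. Any base above 3 makes this series of repairs converge; 5 gives the
  constants 4 and 11. The total over all classes is the integer \<open>k\<close>, so the last prefix
  constraint forces every outcome to use exactly \<open>k\<close> slots. All randomness comes from
  one uniform seed: a variable with finitely many values leaves the seed undetermined on its fibres,
  and each later step subdivides them. The ratio loses a factor 45 = 9 * 5 when offline caches
  become allocations (9 for movement and faults, 5 for rounding the weights) and a factor 11 in the
  online rounding, whence 495.\<close>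

definition unit_space :: "real measure" where
  "unit_space = restrict_space lborel {0..1}"

lemma space_unit_space [simp]: "space unit_space = {0..1}"
  by (simp add: unit_space_def space_restrict_space)

lemma sets_unit_space: "A \<in> sets unit_space \<longleftrightarrow> A \<subseteq> {0..1} \<and> A \<in> sets borel"
  by (simp add: unit_space_def sets_restrict_space_iff)

lemma measure_unit_space: "A \<subseteq> {0..1} \<Longrightarrow> measure unit_space A = measure lborel A"
  by (simp add: unit_space_def measure_restrict_space)

lemma emeasure_unit_space: "A \<subseteq> {0..1} \<Longrightarrow> emeasure unit_space A = emeasure lborel A"
  by (simp add: unit_space_def emeasure_restrict_space)

interpretation unit_space: finite_measure unit_space
  by standard (simp add: emeasure_unit_space)

lemma measure_unit_space_UNIV [simp]: "measure unit_space {0..1} = 1"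
  by (simp add: measure_unit_space)

abbreviation simple_rv :: "(real \<Rightarrow> 'a) \<Rightarrow> bool" where
  "simple_rv X \<equiv> simple_function unit_space X"

text \<open>Conditionally on \<open>L\<close>, \<open>T z\<close> plays the event that a uniform
  threshold is below \<open>z\<close>, drawn from what the seed leaves open inside \<open>L\<close>.
  \<open>T 0\<close> is empty and not merely null, so that rounding an integer moves it at no seed
  at all.\<close>

definition nested_family :: "real set \<Rightarrow> (real \<Rightarrow> real set) \<Rightarrow> bool" where
  "nested_family L T \<longleftrightarrow> (\<forall>z. T z \<in> sets unit_space \<and> T z \<subseteq> L) \<and> T 0 = {} \<and>
     (\<forall>z. 0 \<le> z \<longrightarrow> z \<le> 1 \<longrightarrow> measure unit_space (T z) = z * measure unit_space L) \<and>
     (\<forall>y z. 0 \<le> y \<longrightarrow> y \<le> z \<longrightarrow> z \<le> 1 \<longrightarrow> T y \<subseteq> T z)"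

lemma nested_family_exists:
  assumes L: "L \<in> sets unit_space"
  shows "\<exists>T. nested_family L T"
proof (cases "measure unit_space L = 0")
  case True
  then have "nested_family L (\<lambda>_. {})" by (simp add: nested_family_def)
  then show ?thesis by blast
next
  case False
  define \<mu> where "\<mu> = measure unit_space L"
  have \<mu>: "\<mu> > 0" using False by (simp add: \<mu>_def zero_less_measure_iff)
  have L01: "L \<subseteq> {0..1}" using L by (simp add: sets_unit_space)
  \<comment> \<open>The part of \<open>L\<close> left of \<open>t\<close> grows continuously in
    measure, so the intermediate value theorem finds a cut for every fraction
    \<open>z\<close>.\<close>
  define F where "F t = measure unit_space (L \<inter> {0..t})" for t
  have cut: "L \<inter> {0..t} \<in> sets unit_space" for t
    using L by (auto simp: sets_unit_space)
  have mono: "F s \<le> F t" if "s \<le> t" for s t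
    unfolding F_def using that cut by (intro unit_space.finite_measure_mono) auto
  have lip: "F t \<le> F s + (t - s)" if "s \<le> t" "0 \<le> s" "t \<le> 1" for s t
  proof -
    have sub: "{s..t} \<in> sets unit_space" using that by (auto simp: sets_unit_space)
    have "F t \<le> measure unit_space ((L \<inter> {0..s}) \<union> {s..t})"
      unfolding F_def using cut sub that by (intro unit_space.finite_measure_mono) auto
    also have "\<dots> \<le> F s + measure unit_space {s..t}"
      unfolding F_def using cut sub by (intro measure_Un_le) auto
    also have "measure unit_space {s..t} = t - s"
      using that by (subst measure_unit_space) auto
    finally show ?thesis .
  qed
  have "1-lipschitz_on {0..1} F"
  proof (rule lipschitz_onI)
    fix x y :: real assume "x \<in> {0..1}" "y \<in> {0..1}"
    then show "dist (F x) (F y) \<le> 1 * dist x y"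
      using lip[of x y] lip[of y x] mono[of x y] mono[of y x]
      by (cases "x \<le> y") (auto simp: dist_real_def)
  qed simp
  then have cont: "continuous_on {0..1} F"
    by (rule lipschitz_on_continuous_on)
  have F0: "F 0 = 0"
  proof -
    have "F 0 \<le> measure unit_space {0}"
      unfolding F_def by (intro unit_space.finite_measure_mono) (auto simp: sets_unit_space)
    also have "\<dots> = 0" by (subst measure_unit_space) auto
    finally show ?thesis by (simp add: F_def measure_le_0_iff)
  qed
  have F1: "F 1 = \<mu>" using L01 by (simp add: F_def \<mu>_def Int_absorb2)
  have "\<exists>t. 0 \<le> t \<and> t \<le> 1 \<and> F t = z * \<mu>" if "0 \<le> z" "z \<le> 1" for z
    using IVT'[of F 0 "z * \<mu>" 1] cont that \<mu> F0 F1
    by (auto simp: mult_le_cancel_right1)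
  then obtain t where t: "\<And>z. 0 \<le> z \<Longrightarrow> z \<le> 1 \<Longrightarrow> 0 \<le> t z \<and> t z \<le> 1 \<and> F (t z) = z * \<mu>"
    by metis
  \<comment> \<open>The cut for \<open>z = 0\<close> could leave a null set behind, hence the
    separate value. For \<open>y < z\<close> the cut points, though chosen independently, are
    ordered because strictly larger measure forces the later cut.\<close>
  define T where "T z = (if z = 0 then {} else L \<inter> {0..t z})" for z
  have "nested_family L T"
    unfolding nested_family_def
  proof (intro conjI allI impI)
    show "T z \<in> sets unit_space" "T z \<subseteq> L" for z
      using cut by (auto simp: T_def)
    show "T 0 = {}" by (simp add: T_def)
    show "measure unit_space (T z) = z * measure unit_space L" if "0 \<le> z" "z \<le> 1" for z
      using t[OF that] by (simp add: T_def F_def \<mu>_def)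
    show "T y \<subseteq> T z" if "0 \<le> y" "y \<le> z" "z \<le> 1" for y z
    proof (cases "y = z")
      case False
      then have "y * \<mu> < z * \<mu>" using that \<mu> by simp
      then have "F (t y) < F (t z)" using t[of y] t[of z] that by simp
      then have "t y \<le> t z" using mono[of "t z" "t y"] by linarith
      then show ?thesis using that by (auto simp: T_def)
    qed simp
  qed
  then show ?thesis by blast
qed

abbreviation expect :: "(real \<Rightarrow> real) \<Rightarrow> real" where
  "expect f \<equiv> integral\<^sup>L unit_space f"

lemma simple_integrable:
  fixes f :: "real \<Rightarrow> real"
  shows "simple_rv f \<Longrightarrow> integrable unit_space f"
  by (intro integrable_simple_function) auto

lemma expect_compose:
  fixes X :: "real \<Rightarrow> 'a" and g :: "'a \<Rightarrow> real"
  assumes "simple_rv X"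
  shows "expect (\<lambda>u. g (X u)) =
    (\<Sum>a\<in>X ` {0..1}. g a * measure unit_space (X -` {a} \<inter> {0..1}))"
proof -
  let ?S = "X ` {0..1}"
  have fin: "finite ?S" and m: "\<And>a. a \<in> ?S \<Longrightarrow> X -` {a} \<inter> {0..1} \<in> sets unit_space"
    using assms by (auto simp: simple_function_def)
  have "expect (\<lambda>u. g (X u)) =
    expect (\<lambda>u. \<Sum>a\<in>?S. g a * indicator (X -` {a} \<inter> {0..1}) u)"
  proof (rule Bochner_Integration.integral_cong)
    fix u assume "u \<in> space unit_space"
    then have u: "u \<in> {0..1}" by simp
    have "(\<Sum>a\<in>?S. g a * indicator (X -` {a} \<inter> {0..1}) u) = (\<Sum>a\<in>?S. if a = X u then g a else 0)"
      using u by (intro sum.cong) (auto simp: indicator_def)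
    then show "g (X u) = (\<Sum>a\<in>?S. g a * indicator (X -` {a} \<inter> {0..1}) u)"
      using u fin by (simp add: sum.delta')
  qed simp
  also have "\<dots> = (\<Sum>a\<in>?S. expect (\<lambda>u. g a * indicator (X -` {a} \<inter> {0..1}) u))"
    using m by (intro Bochner_Integration.integral_sum) (auto intro!: integrable_mult_right integrable_real_indicator simp: less_top[symmetric])
  also have "\<dots> = (\<Sum>a\<in>?S. g a * measure unit_space (X -` {a} \<inter> {0..1}))"
    using m by (intro sum.cong) auto
  finally show ?thesis .
qed

section \<open>Dependent rounding of a vector by one shared threshold\<close>

lemma simple_vector:
  fixes Y :: "real \<Rightarrow> nat \<Rightarrow> int"
  assumes "\<And>i. i < l \<Longrightarrow> simple_function M (\<lambda>u. Y u i)" "\<And>u i. l \<le> i \<Longrightarrow> Y u i = 0"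
  shows "simple_function M Y"
  using assms
proof (induction l arbitrary: Y)
  case 0
  then have "Y = (\<lambda>_ _. 0)" by auto
  then show ?case by simp
next
  case (Suc l)
  let ?Z = "\<lambda>u. (Y u)(l := 0)"
  have "simple_function M ?Z"
  proof (rule Suc.IH)
    show "simple_function M (\<lambda>u. ?Z u i)" if "i < l" for i using Suc.prems(1)[of i] that by simp
  qed (use Suc.prems(2) in \<open>auto simp: Suc_le_eq\<close>)
  from simple_function_compose2[OF this Suc.prems(1)[of l], of "\<lambda>z y. z(l := y)"]
  show ?case by simp
qed

text \<open>If one threshold decides both roundings, the number with the larger fractional part is
  rounded up whenever the other is. The two errors therefore cannot add up, and the difference is
  itself a rounding of \<open>t - s\<close>. Here \<open>a\<close> and \<open>b\<close> are the
  indicators of rounding up.\<close>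

lemma threshold_difference:
  fixes s t :: real and x y :: int
  assumes "x = \<lfloor>s\<rfloor> + a" "y = \<lfloor>t\<rfloor> + b" "a \<in> {0, 1}" "b \<in> {0, 1}"
    and "frac s \<le> frac t \<Longrightarrow> a \<le> b" "frac t \<le> frac s \<Longrightarrow> b \<le> a"
  shows "\<lfloor>t - s\<rfloor> \<le> y - x" "y - x \<le> \<lceil>t - s\<rceil>"
proof -
  have st: "s = \<lfloor>s\<rfloor> + frac s" "t = \<lfloor>t\<rfloor> + frac t" by (simp_all add: frac_def)
  have "frac s < 1" "frac t < 1" "0 \<le> frac s" "0 \<le> frac t" by (simp_all add: frac_lt_1)
  have ab: "a = 0 \<or> a = 1" "b = 0 \<or> b = 1" using assms(3,4) by auto
  have yx: "real_of_int (y - x) = of_int \<lfloor>t\<rfloor> - of_int \<lfloor>s\<rfloor> + of_int b - of_int a" using assms(1,2) by simp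
  have "t - s < of_int (y - x) + 1 \<and> of_int (y - x) - 1 < t - s"
  proof (cases "a = b")
    case True
    then show ?thesis using yx st \<open>frac s < 1\<close> \<open>frac t < 1\<close> \<open>0 \<le> frac s\<close> \<open>0 \<le> frac t\<close> by linarith
  next
    case False
    then consider "a = 0" "b = 1" "frac s < frac t" | "a = 1" "b = 0" "frac t < frac s"
      using ab assms(5,6) by linarith
    then show ?thesis
    proof cases
      case 1
      then have "real_of_int (y - x) = of_int \<lfloor>t\<rfloor> - of_int \<lfloor>s\<rfloor> + 1" using yx by simp
      with 1(3) show ?thesis using st \<open>frac s < 1\<close> \<open>frac t < 1\<close> \<open>0 \<le> frac s\<close> \<open>0 \<le> frac t\<close> by linarith
    next
      case 2
      then have "real_of_int (y - x) = of_int \<lfloor>t\<rfloor> - of_int \<lfloor>s\<rfloor> - 1" using yx by simp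
      with 2(3) show ?thesis using st \<open>frac s < 1\<close> \<open>frac t < 1\<close> \<open>0 \<le> frac s\<close> \<open>0 \<le> frac t\<close> by linarith
    qed
  qed
  then show "\<lfloor>t - s\<rfloor> \<le> y - x" "y - x \<le> \<lceil>t - s\<rceil>" by linarith+
qed

text \<open>Systematic sampling: the partial sums of \<open>v (X u)\<close>, not its entries, are
  rounded with a common threshold, and \<open>Y\<close> is their difference; this controls prefixes
  and single coordinates together. The factor \<open>h (X u)\<close> expresses that the conditional
  expectation of \<open>Y\<close> given \<open>X\<close> is \<open>v (X u)\<close>.\<close>

lemma randomized_rounding:
  fixes X :: "real \<Rightarrow> nat \<Rightarrow> int" and v :: "(nat \<Rightarrow> int) \<Rightarrow> nat \<Rightarrow> real"
  assumes X: "simple_rv X"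
  obtains Y :: "real \<Rightarrow> nat \<Rightarrow> int" where "simple_rv Y"
    "\<And>u q. u \<in> {0..1} \<Longrightarrow> q \<le> l \<Longrightarrow> \<lfloor>\<Sum>i<q. v (X u) i\<rfloor> \<le> (\<Sum>i<q. Y u i)"
    "\<And>u q. u \<in> {0..1} \<Longrightarrow> q \<le> l \<Longrightarrow> (\<Sum>i<q. Y u i) \<le> \<lceil>\<Sum>i<q. v (X u) i\<rceil>"
    "\<And>u i. u \<in> {0..1} \<Longrightarrow> i < l \<Longrightarrow> \<lfloor>v (X u) i\<rfloor> \<le> Y u i"
    "\<And>u i. u \<in> {0..1} \<Longrightarrow> i < l \<Longrightarrow> Y u i \<le> \<lceil>v (X u) i\<rceil>"
    "\<And>h i. i < l \<Longrightarrow> expect (\<lambda>u. h (X u) * of_int (Y u i)) = expect (\<lambda>u. h (X u) * v (X u) i)"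
proof -
  define L where "L a = X -` {a} \<inter> {0..1}" for a
  let ?S = "X ` {0..1}"
  have fin: "finite ?S" and Lm: "\<And>a. a \<in> ?S \<Longrightarrow> L a \<in> sets unit_space"
    using X by (auto simp: simple_function_def L_def)
  \<comment> \<open>The threshold is drawn afresh inside each fibre of \<open>X\<close>, so it is
    independent of the outcome \<open>X u\<close> without any further source of randomness.\<close>
  define T where "T a = (SOME T. nested_family (L a) T)" for a
  have "nested_family (L a) (T a)" if "a \<in> ?S" for a
    unfolding T_def using nested_family_exists[OF Lm[OF that]] by (rule someI_ex)
  then have T: "\<And>a z. a \<in> ?S \<Longrightarrow> T a z \<in> sets unit_space" "\<And>a z. a \<in> ?S \<Longrightarrow> T a z \<subseteq> L a"
    "\<And>a. a \<in> ?S \<Longrightarrow> T a 0 = {}"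
    "\<And>a z. a \<in> ?S \<Longrightarrow> 0 \<le> z \<Longrightarrow> z \<le> 1 \<Longrightarrow> measure unit_space (T a z) = z * measure unit_space (L a)"
    "\<And>a y z. a \<in> ?S \<Longrightarrow> 0 \<le> y \<Longrightarrow> y \<le> z \<Longrightarrow> z \<le> 1 \<Longrightarrow> T a y \<subseteq> T a z"
    unfolding nested_family_def by blast+
  have TX: "X u = a" if "a \<in> ?S" "u \<in> T a z" for a u z
    using T(2)[OF that(1)] that(2) by (fastforce simp: L_def)
  have TX01: "u \<in> {0..1}" if "a \<in> ?S" "u \<in> T a z" for a u z
    using T(2)[OF that(1), of z] that(2) unfolding L_def by blast
  define s where "s q a = (\<Sum>i<q. v a i)" for q a
  define B :: "nat \<Rightarrow> real \<Rightarrow> int"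
    where "B q u = (if u \<in> T (X u) (frac (s q (X u))) then 1 else 0)" for q u
  define N where "N q u = \<lfloor>s q (X u)\<rfloor> + B q u" for q u
  define Y where "Y u i = (if i < l then N (Suc i) u - N i u else 0)" for u i
  have B_eq: "real_of_int (B q u) = (\<Sum>a\<in>?S. indicator (T a (frac (s q a))) u)"
    if "u \<in> {0..1}" for q u
  proof -
    have "(\<Sum>a\<in>?S. indicator (T a (frac (s q a))) u) = (\<Sum>a\<in>?S. if a = X u then real_of_int (B q u) else 0)"
    proof (intro sum.cong refl)
      fix a assume a: "a \<in> ?S"
      show "indicator (T a (frac (s q a))) u = (if a = X u then real_of_int (B q u) else 0)"
      proof (cases "a = X u")
        case True
        then show ?thesis by (simp add: B_def indicator_def)
      next
        case False
        then have "u \<notin> T a (frac (s q a))" using TX[OF a] by blast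
        then show ?thesis using False by simp
      qed
    qed
    then show ?thesis using that fin by (simp add: sum.delta)
  qed
  have B_sets: "{u \<in> {0..1}. B q u = 1} \<in> sets unit_space" for q
  proof -
    have "{u \<in> {0..1}. B q u = 1} = (\<Union>a\<in>?S. T a (frac (s q a)))"
    proof (intro set_eqI iffI)
      fix u assume "u \<in> {u \<in> {0..1}. B q u = 1}"
      then have "u \<in> {0..1}" "u \<in> T (X u) (frac (s q (X u)))" by (auto simp: B_def split: if_splits)
      then show "u \<in> (\<Union>a\<in>?S. T a (frac (s q a)))" by blast
    next
      fix u assume "u \<in> (\<Union>a\<in>?S. T a (frac (s q a)))"
      then obtain a where a: "a \<in> ?S" "u \<in> T a (frac (s q a))" by blast
      then show "u \<in> {u \<in> {0..1}. B q u = 1}"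
        using TX[OF a] TX01[OF a] by (auto simp: B_def)
    qed
    moreover have "(\<Union>a\<in>?S. T a (frac (s q a))) \<in> sets unit_space"
      using fin T(1) by (intro sets.finite_UN)
    ultimately show ?thesis by simp
  qed
  have B_simple: "simple_rv (B q)" for q
  proof -
    have "simple_rv (indicator {u \<in> {0..1}. B q u = 1} :: real \<Rightarrow> real)"
      using B_sets by (intro simple_function_indicator) auto
    from simple_function_compose1[OF this, of floor]
    have "simple_rv (\<lambda>x. \<lfloor>indicat_real {u \<in> {0..1}. B q u = 1} x\<rfloor>)" .
    moreover have "\<lfloor>indicat_real {u \<in> {0..1}. B q u = 1} x\<rfloor> = B q x" if "x \<in> {0..1}" for x
      using that by (auto simp: B_def)
    ultimately show ?thesis
      by (subst simple_function_cong[where g="\<lambda>x. \<lfloor>indicat_real {u \<in> {0..1}. B q u = 1} x\<rfloor>"]) auto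
  qed
  have N_simple: "simple_rv (N q)" for q
    unfolding N_def using simple_function_compose2[OF X B_simple[of q], of "\<lambda>x b. \<lfloor>s q x\<rfloor> + b"] .
  have Y_simple: "simple_rv Y"
  proof (rule simple_vector)
    show "simple_rv (\<lambda>u. Y u i)" if "i < l" for i
      using simple_function_compose2[OF N_simple[of "Suc i"] N_simple[of i], of "(-)"] that
      by (simp add: Y_def)
    show "Y u i = 0" if "l \<le> i" for u i using that by (simp add: Y_def)
  qed
  have N0: "N 0 u = 0" if "u \<in> {0..1}" for u
    using T(3) that by (simp add: N_def B_def s_def)
  have Y_sum: "(\<Sum>i<q. Y u i) = N q u" if "q \<le> l" "u \<in> {0..1}" for q u
  proof -
    have "(\<Sum>i<q. Y u i) = (\<Sum>i<q. N (Suc i) u - N i u)"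
      using that by (intro sum.cong) (auto simp: Y_def)
    then show ?thesis
      using N0[OF that(2)] sum_lessThan_telescope[of "\<lambda>q. N q u" q] by simp
  qed
  \<comment> \<open>Within the fibre of \<open>a\<close> the probability of rounding up is the
    fractional part, so floor plus indicator has mean \<open>s q a\<close>.\<close>
  have E_N: "expect (\<lambda>u. h (X u) * of_int (N q u)) = expect (\<lambda>u. h (X u) * s q (X u))" for h q
  proof -
    have "expect (\<lambda>u. h (X u) * of_int (B q u)) =
      expect (\<lambda>u. \<Sum>a\<in>?S. h a * indicator (T a (frac (s q a))) u)"
    proof (rule Bochner_Integration.integral_cong)
      fix u assume "u \<in> space unit_space"
      then have u: "u \<in> {0..1}" by simp
      have "h (X u) * of_int (B q u) = (\<Sum>a\<in>?S. h (X u) * indicator (T a (frac (s q a))) u)"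
        by (simp add: B_eq[OF u] sum_distrib_left)
      also have "\<dots> = (\<Sum>a\<in>?S. h a * indicator (T a (frac (s q a))) u)"
      proof (intro sum.cong refl)
        fix a assume a: "a \<in> ?S"
        show "h (X u) * indicator (T a (frac (s q a))) u = h a * indicator (T a (frac (s q a))) u"
          using TX[OF a, of u] by (cases "u \<in> T a (frac (s q a))") auto
      qed
      finally show "h (X u) * of_int (B q u) = (\<Sum>a\<in>?S. h a * indicator (T a (frac (s q a))) u)" .
    qed simp
    also have "\<dots> = (\<Sum>a\<in>?S. expect (\<lambda>u. h a * indicator (T a (frac (s q a))) u))"
      using T(1) by (intro Bochner_Integration.integral_sum)
        (auto intro!: integrable_mult_right integrable_real_indicator simp: less_top[symmetric])
    also have "\<dots> = (\<Sum>a\<in>?S. h a * frac (s q a) * measure unit_space (X -` {a} \<inter> {0..1}))"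
    proof (intro sum.cong refl)
      fix a assume a: "a \<in> ?S"
      then have "T a z \<inter> space unit_space = T a z" for z using T(1)[OF a, of z] by (auto simp: sets_unit_space)
      then show "expect (\<lambda>u. h a * indicator (T a (frac (s q a))) u) =
          h a * frac (s q a) * measure unit_space (X -` {a} \<inter> {0..1})"
        using T(4)[OF a, of "frac (s q a)"] by (simp add: frac_lt_1 less_imp_le L_def)
    qed
    also have "\<dots> = expect (\<lambda>u. h (X u) * frac (s q (X u)))"
      using expect_compose[OF X, of "\<lambda>a. h a * frac (s q a)"] by simp
    finally have *: "expect (\<lambda>u. h (X u) * of_int (B q u)) = expect (\<lambda>u. h (X u) * frac (s q (X u)))" .
    have i1: "integrable unit_space (\<lambda>u. h (X u) * of_int (B q u))"
      by (intro simple_integrable simple_function_compose2[OF X B_simple[of q], of "\<lambda>x b. h x * of_int b"])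
    have i2: "integrable unit_space (\<lambda>u. g (X u))" for g :: "_ \<Rightarrow> real"
      by (intro simple_integrable simple_function_compose1[OF X])
    have "expect (\<lambda>u. h (X u) * of_int (N q u)) =
      expect (\<lambda>u. h (X u) * of_int \<lfloor>s q (X u)\<rfloor> + h (X u) * of_int (B q u))"
      by (simp add: N_def algebra_simps)
    also have "\<dots> = expect (\<lambda>u. h (X u) * of_int \<lfloor>s q (X u)\<rfloor>) + expect (\<lambda>u. h (X u) * frac (s q (X u)))"
      using Bochner_Integration.integral_add[OF i2[of "\<lambda>x. h x * of_int \<lfloor>s q x\<rfloor>"] i1] * by simp
    also have "\<dots> = expect (\<lambda>u. h (X u) * of_int \<lfloor>s q (X u)\<rfloor> + h (X u) * frac (s q (X u)))"
      using Bochner_Integration.integral_add[OF i2[of "\<lambda>x. h x * of_int \<lfloor>s q x\<rfloor>"] i2[of "\<lambda>x. h x * frac (s q x)"]]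
      by simp
    also have "\<dots> = expect (\<lambda>u. h (X u) * s q (X u))"
      by (simp add: frac_def algebra_simps)
    finally show ?thesis .
  qed
  have B01: "B q u \<in> {0, 1}" for q u by (simp add: B_def)
  have B_mono: "B q u \<le> B r u" if "u \<in> {0..1}" "frac (s q (X u)) \<le> frac (s r (X u))" for q r u
    using T(5)[of "X u" "frac (s q (X u))" "frac (s r (X u))"] that
    by (auto simp: B_def frac_lt_1 less_imp_le)
  have B0: "B 0 u = 0" if "u \<in> {0..1}" for u using T(3) that by (simp add: B_def s_def)
  \<comment> \<open>Consecutive prefixes yield the coordinates; comparison with the empty prefix
    yields the prefix sums.\<close>
  have diff: "\<lfloor>s r (X u) - s q (X u)\<rfloor> \<le> N r u - N q u" "N r u - N q u \<le> \<lceil>s r (X u) - s q (X u)\<rceil>"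
    if "u \<in> {0..1}" for q r u
    by (rule threshold_difference[OF N_def N_def B01 B01 B_mono[OF that] B_mono[OF that]]; assumption)+
  show ?thesis
  proof (rule that[OF Y_simple])
    show "\<lfloor>\<Sum>i<q. v (X u) i\<rfloor> \<le> (\<Sum>i<q. Y u i)" "(\<Sum>i<q. Y u i) \<le> \<lceil>\<Sum>i<q. v (X u) i\<rceil>"
      if "u \<in> {0..1}" "q \<le> l" for u q
      using diff[OF that(1), of q 0] N0[OF that(1)] Y_sum[OF that(2,1)] by (simp_all add: s_def)
    show "\<lfloor>v (X u) i\<rfloor> \<le> Y u i" "Y u i \<le> \<lceil>v (X u) i\<rceil>" if "u \<in> {0..1}" "i < l" for u i
      using diff[OF that(1), of "Suc i" i] that(2) by (simp_all add: s_def Y_def)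
    show "expect (\<lambda>u. h (X u) * of_int (Y u i)) = expect (\<lambda>u. h (X u) * v (X u) i)"
      if "i < l" for h i
    proof -
      have i1: "integrable unit_space (\<lambda>u. h (X u) * of_int (N q u))" for q
        by (intro simple_integrable simple_function_compose2[OF X N_simple[of q], of "\<lambda>x b. h x * of_int b"])
      have i2: "integrable unit_space (\<lambda>u. g (X u))" for g :: "_ \<Rightarrow> real"
        by (intro simple_integrable simple_function_compose1[OF X])
      have "expect (\<lambda>u. h (X u) * of_int (Y u i)) =
         expect (\<lambda>u. h (X u) * of_int (N (Suc i) u) - h (X u) * of_int (N i u))"
        using that by (simp add: Y_def algebra_simps)
      also have "\<dots> = expect (\<lambda>u. h (X u) * s (Suc i) (X u)) - expect (\<lambda>u. h (X u) * s i (X u))"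
        using Bochner_Integration.integral_diff[OF i1 i1] E_N by simp
      also have "\<dots> = expect (\<lambda>u. h (X u) * s (Suc i) (X u) - h (X u) * s i (X u))"
        using Bochner_Integration.integral_diff[OF i2[of "\<lambda>x. h x * s (Suc i) x"] i2[of "\<lambda>x. h x * s i x"]] by simp
      also have "\<dots> = expect (\<lambda>u. h (X u) * v (X u) i)"
        by (simp add: s_def algebra_simps)
      finally show ?thesis .
    qed
  qed
qed

section \<open>Exchanging slots between outcomes\<close>

abbreviation prob_eq :: "(real \<Rightarrow> 'a) \<Rightarrow> 'a \<Rightarrow> real" where
  "prob_eq X a \<equiv> measure unit_space (X -` {a} \<inter> {0..1})"

text \<open>Only atoms of positive probability count. Almost-sure constraints thereby become
  constraints on a finite set of vectors with positive weights, the form that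
  \<open>exchange\<close> handles.\<close>

lemma AE_simple_iff:
  assumes X: "simple_rv X"
  shows "(AE u in unit_space. Q (X u)) \<longleftrightarrow> (\<forall>a\<in>X ` {0..1}. 0 < prob_eq X a \<longrightarrow> Q a)"
proof -
  have fin: "finite (X ` {0..1})"
    and m: "\<And>a. a \<in> X ` {0..1} \<Longrightarrow> X -` {a} \<inter> {0..1} \<in> sets unit_space"
    using X by (auto simp: simple_function_def)
  have one: "(AE u in unit_space. X u \<noteq> a) \<longleftrightarrow> prob_eq X a = 0" if "a \<in> X ` {0..1}" for a
  proof -
    have "{u \<in> space unit_space. \<not> X u \<noteq> a} = X -` {a} \<inter> {0..1}" by auto
    then show ?thesis
      using m[OF that] by (subst AE_iff_measurable) (auto simp: unit_space.emeasure_eq_measure)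
  qed
  show ?thesis
  proof
    assume Q: "AE u in unit_space. Q (X u)"
    show "\<forall>a\<in>X ` {0..1}. 0 < prob_eq X a \<longrightarrow> Q a"
    proof (intro ballI impI, rule ccontr)
      fix a assume a: "a \<in> X ` {0..1}" "0 < prob_eq X a" "\<not> Q a"
      from Q have "AE u in unit_space. X u \<noteq> a" by eventually_elim (use a in auto)
      then show False using one a by simp
    qed
  next
    assume Q: "\<forall>a\<in>X ` {0..1}. 0 < prob_eq X a \<longrightarrow> Q a"
    have "AE u in unit_space. \<forall>a\<in>X ` {0..1}. \<not> Q a \<longrightarrow> X u \<noteq> a"
    proof (rule AE_finite_allI[OF fin])
      fix a assume a: "a \<in> X ` {0..1}"
      show "AE u in unit_space. \<not> Q a \<longrightarrow> X u \<noteq> a"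
      proof (cases "Q a")
        case False
        then have "prob_eq X a = 0" using Q a by (metis measure_nonneg order_le_less)
        then show ?thesis using one[OF a] by auto
      qed simp
    qed
    then show "AE u in unit_space. Q (X u)"
      using AE_space by eventually_elim auto
  qed
qed

lemma expect_compose_support:
  fixes g :: "'a \<Rightarrow> real"
  assumes "simple_rv X"
  shows "expect (\<lambda>u. g (X u)) = (\<Sum>a | a \<in> X ` {0..1} \<and> 0 < prob_eq X a. prob_eq X a * g a)"
proof -
  have "finite (X ` {0..1})" using assms by (auto simp: simple_function_def)
  then have "(\<Sum>a | a \<in> X ` {0..1} \<and> 0 < prob_eq X a. prob_eq X a * g a) = (\<Sum>a\<in>X ` {0..1}. g a * prob_eq X a)"
    by (intro sum.mono_neutral_cong_left) (auto simp: mult.commute zero_less_measure_iff)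
  then show ?thesis by (simp add: expect_compose[OF assms])
qed

text \<open>A finite transport: an outcome \<open>a\<close> with excess over \<open>c\<close> sends
  slots to the outcomes \<open>b\<close> with deficit, in proportion to the deficits, and draws them
  from coordinates where \<open>a\<close> exceeds \<open>b\<close>, in proportion to
  \<open>a i - b i\<close>. Means are kept because every unit leaves one outcome for another. A
  coordinate moves by at most a weighted average of its distances to other outcomes, hence inside
  the box. \<open>R\<close> is the total of the heavier prefix, already balanced; since it varies by
  at most one, the block \<open>G\<close> contains enough difference to be exchanged.\<close>

lemma exchange:
  fixes S :: "(nat \<Rightarrow> int) set" and p :: "(nat \<Rightarrow> int) \<Rightarrow> real" and R :: "(nat \<Rightarrow> int) \<Rightarrow> int"
  assumes fin: "finite S" "finite G"
    and box: "\<And>a i. a \<in> S \<Longrightarrow> i \<in> G \<Longrightarrow> lo i \<le> a i \<and> a i \<le> hi i"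
    and R: "\<And>a b. a \<in> S \<Longrightarrow> b \<in> S \<Longrightarrow> R a \<le> R b + 1"
    and pos: "\<And>a. a \<in> S \<Longrightarrow> 0 < p a"
    and P: "\<And>a. P a = R a + (\<Sum>i\<in>G. a i)"
    and mean: "(\<Sum>a\<in>S. p a * of_int (P a - c)) \<le> 0"
  obtains v :: "(nat \<Rightarrow> int) \<Rightarrow> nat \<Rightarrow> real" where
    "\<And>a i. a \<in> S \<Longrightarrow> i \<in> G \<Longrightarrow> of_int (lo i) \<le> v a i \<and> v a i \<le> of_int (hi i)"
    "\<And>a i. i \<notin> G \<Longrightarrow> v a i = of_int (a i)"
    "\<And>i. (\<Sum>a\<in>S. p a * v a i) = (\<Sum>a\<in>S. p a * of_int (a i))"
    "\<And>a. a \<in> S \<Longrightarrow> of_int (R a) + (\<Sum>i\<in>G. v a i) \<le> of_int c"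
    "\<And>a. a \<in> S \<Longrightarrow> of_int (min (P a) c) \<le> of_int (R a) + (\<Sum>i\<in>G. v a i)"
    "(\<Sum>a\<in>S. p a * (\<Sum>i\<in>G. \<bar>v a i - of_int (a i)\<bar>)) \<le> 2 * (\<Sum>a\<in>S. p a * of_int (max 0 (P a - c)))"
proof -
  have p: "0 \<le> p a" if "a \<in> S" for a using pos[OF that] by simp
  define d where "d a = real_of_int (max 0 (P a - c))" for a
  define e where "e a = real_of_int (max 0 (c - P a))" for a
  define D where "D = (\<Sum>a\<in>S. p a * d a)"
  define E where "E = (\<Sum>a\<in>S. p a * e a)"
  define t where "t i a b = real_of_int (max 0 (a i - b i))" for i and a b :: "nat \<Rightarrow> int"
  define s where "s a b = (\<Sum>i\<in>G. t i a b)" for a b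
  \<comment> \<open>The flow in coordinate \<open>i\<close> from \<open>a\<close> to
    \<open>b\<close>, per unit of probability at both ends: the amount \<open>d a * e b / E\<close>
    is shared according to the surpluses \<open>t i a b\<close>.\<close>
  define \<kappa> where "\<kappa> i a b = d a * e b / E * (t i a b / s a b)" for i a b
  define out where "out a i = (\<Sum>b\<in>S. p b * \<kappa> i a b)" for a i
  define inn where "inn a i = (\<Sum>b\<in>S. p b * \<kappa> i b a)" for a i
  define v where "v a i = (if i \<in> G then of_int (a i) - out a i + inn a i else of_int (a i))" for a i
  have nonneg: "0 \<le> d a" "0 \<le> e a" "0 \<le> t i a b" "0 \<le> s a b" for a b i
    by (auto simp: d_def e_def t_def s_def intro!: sum_nonneg)
  have D0: "0 \<le> D" and E0: "0 \<le> E" using nonneg p by (auto simp: D_def E_def intro!: sum_nonneg mult_nonneg_nonneg)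
  have de: "d a - e a = of_int (P a - c)" for a by (auto simp: d_def e_def)
  have DE: "D \<le> E"
  proof -
    have "D - E = (\<Sum>a\<in>S. p a * of_int (P a - c))"
      unfolding D_def E_def sum_subtractf[symmetric] de[symmetric] by (simp add: algebra_simps)
    then show ?thesis using mean by simp
  qed
  \<comment> \<open>Excess and deficit are integers, so both are at least 1 when nonzero; then
    \<open>d a + e b - 1\<close>, a lower bound for the surplus available in \<open>G\<close>,
    dominates each of them.\<close>
  have s_ge: "d a \<le> s a b \<and> e b \<le> s a b \<and> 0 < s a b" if ab: "a \<in> S" "b \<in> S" and "d a \<noteq> 0" "e b \<noteq> 0" for a b
  proof -
    have de1: "P a - c \<ge> 1" "c - P b \<ge> 1" using that(3,4) by (auto simp: d_def e_def)
    have "P a - P b - 1 \<le> (\<Sum>i\<in>G. a i - b i)" using R[OF ab] P[of a] P[of b] by (simp add: sum_subtractf)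
    also have "\<dots> \<le> (\<Sum>i\<in>G. max 0 (a i - b i))" by (intro sum_mono) auto
    finally have "real_of_int (P a - P b - 1) \<le> s a b"
      unfolding s_def t_def of_int_sum[symmetric] of_int_le_iff by simp
    moreover have "d a = real_of_int (P a - c)" "e b = real_of_int (c - P b)" using de1 by (auto simp: d_def e_def)
    ultimately show ?thesis using de1 by simp
  qed
  have \<kappa>0: "0 \<le> \<kappa> i a b" for i a b using nonneg E0 by (simp add: \<kappa>_def)
  have \<kappa>_sum: "(\<Sum>i\<in>G. \<kappa> i a b) = d a * e b / E" if "a \<in> S" "b \<in> S" for a b
  proof (cases "d a = 0 \<or> e b = 0")
    case False
    then have "0 < s a b" using s_ge[OF that] by auto
    then show ?thesis
      unfolding \<kappa>_def by (simp add: sum_distrib_left[symmetric] sum_divide_distrib[symmetric] s_def[symmetric])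
  qed (auto simp: \<kappa>_def)
  \<comment> \<open>The flow is at most a fraction \<open>e b / E\<close>, and at most a fraction
    \<open>d a / E\<close>, of the gap \<open>t i a b\<close>. Averaged over the partner outcomes
    these fractions add up to at most 1.\<close>
  have \<kappa>_le: "\<kappa> i a b \<le> e b / E * t i a b \<and> \<kappa> i a b \<le> d a / E * t i a b" if "a \<in> S" "b \<in> S" for i a b
  proof (cases "d a = 0 \<or> e b = 0")
    case True
    then show ?thesis using nonneg E0 by (auto simp: \<kappa>_def)
  next
    case False
    then have s: "d a \<le> s a b" "e b \<le> s a b" "0 < s a b" using s_ge[OF that] by auto
    have "\<kappa> i a b = e b / E * t i a b * (d a / s a b)" "\<kappa> i a b = d a / E * t i a b * (e b / s a b)"
      by (simp_all add: \<kappa>_def)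
    moreover have "d a / s a b \<le> 1" "e b / s a b \<le> 1" using s by simp_all
    ultimately show ?thesis
      using nonneg E0 by (metis divide_nonneg_nonneg mult_left_le mult_nonneg_nonneg)
  qed
  have t_box: "t i a b \<le> of_int (a i - lo i)" "t i b a \<le> of_int (hi i - a i)" if "a \<in> S" "b \<in> S" "i \<in> G" for a b i
    using box[OF that(1,3)] box[OF that(2,3)] by (auto simp: t_def)
  have out_le: "out a i \<le> of_int (a i - lo i)" if a: "a \<in> S" and i: "i \<in> G" for a i
  proof -
    have "out a i \<le> (\<Sum>b\<in>S. p b * (e b / E * of_int (a i - lo i)))"
      unfolding out_def
    proof (intro sum_mono mult_left_mono p)
      fix b assume b: "b \<in> S"
      have "e b / E * t i a b \<le> e b / E * of_int (a i - lo i)"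
        using t_box(1)[OF a b i] nonneg E0 by (intro mult_left_mono) auto
      then show "\<kappa> i a b \<le> e b / E * of_int (a i - lo i)" using \<kappa>_le[OF a b, of i] by simp
    qed
    also have "\<dots> = (\<Sum>b\<in>S. p b * e b) / E * of_int (a i - lo i)"
      unfolding sum_distrib_right sum_divide_distrib by (intro sum.cong) auto
    also have "\<dots> = E / E * of_int (a i - lo i)" by (simp add: E_def)
    also have "\<dots> \<le> of_int (a i - lo i)" using box[OF a i] by auto
    finally show ?thesis .
  qed
  have inn_le: "inn a i \<le> of_int (hi i - a i)" if a: "a \<in> S" and i: "i \<in> G" for a i
  proof -
    have "inn a i \<le> (\<Sum>b\<in>S. p b * (d b / E * of_int (hi i - a i)))"
      unfolding inn_def
    proof (intro sum_mono mult_left_mono p)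
      fix b assume b: "b \<in> S"
      have "d b / E * t i b a \<le> d b / E * of_int (hi i - a i)"
        using t_box(2)[OF a b i] nonneg E0 by (intro mult_left_mono) auto
      then show "\<kappa> i b a \<le> d b / E * of_int (hi i - a i)" using \<kappa>_le[OF b a, of i] by simp
    qed
    also have "\<dots> = (\<Sum>b\<in>S. p b * d b) / E * of_int (hi i - a i)"
      unfolding sum_distrib_right sum_divide_distrib by (intro sum.cong) auto
    also have "\<dots> = D / E * of_int (hi i - a i)" by (simp add: D_def)
    also have "\<dots> \<le> 1 * of_int (hi i - a i)"
      using box[OF a i] DE D0 by (intro mult_right_mono) (auto simp: divide_le_eq_1)
    finally show ?thesis by simp
  qed
  have out0: "0 \<le> out a i" and inn0: "0 \<le> inn a i" for a i
    using p \<kappa>0 by (auto simp: out_def inn_def intro!: sum_nonneg mult_nonneg_nonneg)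
  have out_sum: "(\<Sum>i\<in>G. out a i) = d a * (E / E)" if "a \<in> S" for a
  proof -
    have "(\<Sum>i\<in>G. out a i) = (\<Sum>b\<in>S. p b * (\<Sum>i\<in>G. \<kappa> i a b))"
      unfolding out_def by (subst sum.swap) (simp add: sum_distrib_left)
    also have "\<dots> = (\<Sum>b\<in>S. p b * (d a * e b / E))" using \<kappa>_sum[OF that] by simp
    also have "\<dots> = d a * ((\<Sum>b\<in>S. p b * e b) / E)"
      unfolding sum_distrib_left sum_divide_distrib by (intro sum.cong) auto
    also have "\<dots> = d a * (E / E)" by (simp add: E_def)
    finally show ?thesis .
  qed
  have inn_sum: "(\<Sum>i\<in>G. inn a i) = e a * (D / E)" if "a \<in> S" for a
  proof -
    have "(\<Sum>i\<in>G. inn a i) = (\<Sum>b\<in>S. p b * (\<Sum>i\<in>G. \<kappa> i b a))"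
      unfolding inn_def by (subst sum.swap) (simp add: sum_distrib_left)
    also have "\<dots> = (\<Sum>b\<in>S. p b * (d b * e a / E))" using \<kappa>_sum[OF _ that] by simp
    also have "\<dots> = e a * ((\<Sum>b\<in>S. p b * d b) / E)"
      unfolding sum_distrib_left sum_divide_distrib by (intro sum.cong) auto
    also have "\<dots> = e a * (D / E)" by (simp add: D_def)
    finally show ?thesis .
  qed
  \<comment> \<open>\<open>E / E\<close> is 1 or, if \<open>E = 0\<close>, it is 0 by the convention
    on division; in that case \<open>D = 0\<close> too, and positivity of the weights makes every
    \<open>d a\<close> vanish.\<close>
  have v_sum: "of_int (R a) + (\<Sum>i\<in>G. v a i) = of_int (P a) - d a * (E / E) + e a * (D / E)" if "a \<in> S" for a
    using out_sum[OF that] inn_sum[OF that] P[of a]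
    by (simp add: v_def sum.distrib sum_subtractf)
  have zero: "d a = 0" if "E = 0" "a \<in> S" for a
  proof -
    have "D = 0" using DE D0 that by simp
    then have "p a * d a = 0"
      unfolding D_def using fin nonneg p that by (subst (asm) sum_nonneg_eq_0_iff) (auto intro!: mult_nonneg_nonneg)
    then show ?thesis using pos[OF that(2)] by simp
  qed
  have v_sum_eq: "of_int (P a) - d a * (E / E) + e a * (D / E) = of_int (P a) - d a + e a * (D / E)" if "a \<in> S" for a
    using zero[OF _ that] by (cases "E = 0") auto
  have DE1: "0 \<le> D / E" "D / E \<le> 1" using DE D0 E0 by (auto simp: divide_le_eq_1)
  have eDE: "e a * (D / E) \<le> e a" "0 \<le> e a * (D / E)" for a
    using DE1 nonneg(2)[of a] mult_left_mono[of "D / E" 1 "e a"] mult_nonneg_nonneg[of "e a" "D / E"] by simp_all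
  show ?thesis
  proof (rule that[of v])
    show "of_int (lo i) \<le> v a i \<and> v a i \<le> of_int (hi i)" if "a \<in> S" "i \<in> G" for a i
      using out_le[OF that] inn_le[OF that] out0[of a i] inn0[of a i] that(2) by (simp add: v_def)
    show "v a i = of_int (a i)" if "i \<notin> G" for a i using that by (simp add: v_def)
    show "(\<Sum>a\<in>S. p a * v a i) = (\<Sum>a\<in>S. p a * of_int (a i))" for i
    proof (cases "i \<in> G")
      case True
      have "(\<Sum>a\<in>S. p a * out a i) = (\<Sum>a\<in>S. \<Sum>b\<in>S. p a * (p b * \<kappa> i a b))"
        by (simp add: out_def sum_distrib_left)
      also have "\<dots> = (\<Sum>b\<in>S. \<Sum>a\<in>S. p a * (p b * \<kappa> i a b))" by (rule sum.swap)
      also have "\<dots> = (\<Sum>a\<in>S. p a * inn a i)"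
        by (simp add: inn_def sum_distrib_left mult.left_commute)
      finally show ?thesis using True
        by (simp add: v_def distrib_left right_diff_distrib sum.distrib sum_subtractf)
    qed (simp add: v_def)
    show "of_int (R a) + (\<Sum>i\<in>G. v a i) \<le> of_int c" if "a \<in> S" for a
      unfolding v_sum[OF that] v_sum_eq[OF that] using eDE[of a] by (auto simp: d_def e_def)
    show "of_int (min (P a) c) \<le> of_int (R a) + (\<Sum>i\<in>G. v a i)" if "a \<in> S" for a
      unfolding v_sum[OF that] v_sum_eq[OF that] using eDE[of a] by (auto simp: d_def e_def)
    \<comment> \<open>Each unit of expected excess is counted once where it leaves and once where it
      arrives, hence the factor 2.\<close>
    have "(\<Sum>a\<in>S. p a * (\<Sum>i\<in>G. \<bar>v a i - of_int (a i)\<bar>)) \<le> (\<Sum>a\<in>S. p a * (\<Sum>i\<in>G. out a i + inn a i))"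
      using out0 inn0 p by (intro sum_mono mult_left_mono) (auto simp: v_def intro: order_trans[OF abs_triangle_ineq4])
    also have "\<dots> = (\<Sum>a\<in>S. p a * d a * (E / E) + p a * e a * (D / E))"
      by (intro sum.cong) (simp_all add: sum.distrib out_sum inn_sum algebra_simps)
    also have "\<dots> = D * (E / E) + E * (D / E)"
      by (simp only: sum.distrib sum_distrib_right[symmetric] D_def[symmetric] E_def[symmetric])
    also have "\<dots> \<le> 2 * D" using D0 by auto
    finally show "(\<Sum>a\<in>S. p a * (\<Sum>i\<in>G. \<bar>v a i - of_int (a i)\<bar>)) \<le> 2 * (\<Sum>a\<in>S. p a * of_int (max 0 (P a - c)))"
      by (simp add: D_def d_def)
  qed
qed

text \<open>As \<open>X u i\<close> is an integer, rounding \<open>v (X u) i\<close> to a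
  neighbouring integer cannot cross it. The sign of the move is thus a function of \<open>X\<close>,
  and the conditional mean removes the rounding error exactly.\<close>

lemma expect_abs_rounding:
  fixes X Y :: "real \<Rightarrow> nat \<Rightarrow> int"
  assumes X: "simple_rv X" and Y: "simple_rv Y"
    and fl: "\<And>u. u \<in> {0..1} \<Longrightarrow> \<lfloor>v (X u) i\<rfloor> \<le> Y u i" "\<And>u. u \<in> {0..1} \<Longrightarrow> Y u i \<le> \<lceil>v (X u) i\<rceil>"
    and E: "\<And>h. expect (\<lambda>u. h (X u) * of_int (Y u i)) = expect (\<lambda>u. h (X u) * v (X u) i)"
  shows "expect (\<lambda>u. of_int \<bar>Y u i - X u i\<bar>) = expect (\<lambda>u. \<bar>v (X u) i - of_int (X u i)\<bar>)"
proof -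
  let ?h = "\<lambda>a::nat \<Rightarrow> int. sgn (v a i - of_int (a i))"
  have i1: "integrable unit_space (\<lambda>u. ?h (X u) * of_int (Y u i))"
    by (intro simple_integrable simple_function_compose2[OF X Y, of "\<lambda>x y. ?h x * of_int (y i)"])
  have i2: "integrable unit_space (\<lambda>u. g (X u))" for g :: "_ \<Rightarrow> real"
    by (intro simple_integrable simple_function_compose1[OF X])
  have "expect (\<lambda>u. of_int \<bar>Y u i - X u i\<bar>) =
      expect (\<lambda>u. ?h (X u) * of_int (Y u i) - ?h (X u) * of_int (X u i))"
  proof (rule Bochner_Integration.integral_cong)
    fix u assume "u \<in> space unit_space"
    then have u: "\<lfloor>v (X u) i\<rfloor> \<le> Y u i" "Y u i \<le> \<lceil>v (X u) i\<rceil>" using fl by simp_all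
    consider "v (X u) i = of_int (X u i)" | "v (X u) i < of_int (X u i)" | "of_int (X u i) < v (X u) i"
      by linarith
    then show "real_of_int \<bar>Y u i - X u i\<bar> = ?h (X u) * of_int (Y u i) - ?h (X u) * of_int (X u i)"
    proof cases
      case 1
      then show ?thesis using u by simp
    next
      case 2
      then have "\<lceil>v (X u) i\<rceil> \<le> X u i" by linarith
      then show ?thesis using u 2 by (simp add: sgn_if)
    next
      case 3
      then have "X u i \<le> \<lfloor>v (X u) i\<rfloor>" by linarith
      then show ?thesis using u 3 by (simp add: sgn_if)
    qed
  qed simp
  also have "\<dots> = expect (\<lambda>u. ?h (X u) * v (X u) i) - expect (\<lambda>u. ?h (X u) * of_int (X u i))"
    using Bochner_Integration.integral_diff[OF i1 i2[of "\<lambda>x. ?h x * of_int (x i)"]] E[of ?h] by simp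
  also have "\<dots> = expect (\<lambda>u. ?h (X u) * v (X u) i - ?h (X u) * of_int (X u i))"
    using Bochner_Integration.integral_diff[OF i2[of "\<lambda>x. ?h x * v x i"] i2[of "\<lambda>x. ?h x * of_int (x i)"]] by simp
  also have "\<dots> = expect (\<lambda>u. \<bar>v (X u) i - of_int (X u i)\<bar>)"
    by (intro Bochner_Integration.integral_cong refl) (simp add: abs_sgn algebra_simps)
  finally show ?thesis .
qed

text \<open>An exchange on the atoms of \<open>X\<close>, followed by rounding. Coordinates outside
  the block stay integral in the exchange, so rounding does not touch them, and the bound
  \<open>c\<close> survives because it is an integer. That no total falls below the smaller of
  \<open>c\<close> and its old value is what allows combination with the opposite repair.\<close>

lemma lower_prefix_upper:
  fixes X :: "real \<Rightarrow> nat \<Rightarrow> int"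
  assumes X: "simple_rv X" and q: "q' \<le> q" "q \<le> l"
    and box: "AE u in unit_space. \<forall>i<l. lo i \<le> X u i \<and> X u i \<le> hi i"
    and pre: "AE u in unit_space. f \<le> (\<Sum>i<q'. X u i) \<and> (\<Sum>i<q'. X u i) \<le> f + 1"
    and mean: "expect (\<lambda>u. of_int (\<Sum>i<q. X u i)) \<le> of_int c"
  obtains Y :: "real \<Rightarrow> nat \<Rightarrow> int" where "simple_rv Y"
    "AE u in unit_space. \<forall>i<l. lo i \<le> Y u i \<and> Y u i \<le> hi i"
    "\<And>i. i < l \<Longrightarrow> expect (\<lambda>u. of_int (Y u i)) = expect (\<lambda>u. of_int (X u i))"
    "AE u in unit_space. (\<Sum>i<q. Y u i) \<le> c"
    "AE u in unit_space. min (\<Sum>i<q. X u i) c \<le> (\<Sum>i<q. Y u i)"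
    "AE u in unit_space. \<forall>i<l. i \<notin> {q'..<q} \<longrightarrow> Y u i = X u i"
    "(\<Sum>i\<in>{q'..<q}. expect (\<lambda>u. of_int \<bar>Y u i - X u i\<bar>)) \<le> 2 * expect (\<lambda>u. of_int (max 0 ((\<Sum>i<q. X u i) - c)))"
proof -
  define S where "S = {a. a \<in> X ` {0..1} \<and> 0 < prob_eq X a}"
  let ?p = "prob_eq X"
  let ?R = "\<lambda>a::nat \<Rightarrow> int. \<Sum>i<q'. a i"
  let ?P = "\<lambda>a::nat \<Rightarrow> int. \<Sum>i<q. a i"
  let ?G = "{q'..<q}"
  have EX: "expect (\<lambda>u. g (X u)) = (\<Sum>a\<in>S. ?p a * g a)" for g :: "_ \<Rightarrow> real"
    unfolding S_def by (rule expect_compose_support[OF X])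
  have finS: "finite S" using X by (auto simp: S_def simple_function_def)
  have AES: "(AE u in unit_space. Q (X u)) \<longleftrightarrow> (\<forall>a\<in>S. Q a)" for Q
    unfolding AE_simple_iff[OF X] S_def by auto
  have split: "{..<q} = {..<q'} \<union> ?G" using q by auto
  have Psplit: "?P a = ?R a + (\<Sum>i\<in>?G. a i)" for a :: "nat \<Rightarrow> int"
    unfolding split by (rule sum.union_disjoint) auto
  have PsplitR: "(\<Sum>i<q. g i) = (\<Sum>i<q'. g i) + (\<Sum>i\<in>?G. g i)" for g :: "nat \<Rightarrow> real"
    unfolding split by (rule sum.union_disjoint) auto
  have boxS: "\<forall>i<l. lo i \<le> a i \<and> a i \<le> hi i" if "a \<in> S" for a
    using box that unfolding AES[of "\<lambda>a. \<forall>i<l. lo i \<le> a i \<and> a i \<le> hi i"] by blast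
  have preS: "f \<le> ?R a \<and> ?R a \<le> f + 1" if "a \<in> S" for a
    using pre that unfolding AES[of "\<lambda>a. f \<le> ?R a \<and> ?R a \<le> f + 1"] by blast
  have total: "(\<Sum>a\<in>S. ?p a) = 1" using EX[of "\<lambda>_. 1"] by simp
  have meanS: "(\<Sum>a\<in>S. ?p a * of_int (?P a - c)) \<le> 0"
    using mean EX[of "\<lambda>a. of_int (?P a)"] total
    by (simp add: right_diff_distrib sum_subtractf sum_distrib_right[symmetric])
  obtain v :: "(nat \<Rightarrow> int) \<Rightarrow> nat \<Rightarrow> real" where v:
    "\<And>a i. a \<in> S \<Longrightarrow> i \<in> ?G \<Longrightarrow> of_int (lo i) \<le> v a i \<and> v a i \<le> of_int (hi i)"
    "\<And>a i. i \<notin> ?G \<Longrightarrow> v a i = of_int (a i)"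
    "\<And>i. (\<Sum>a\<in>S. ?p a * v a i) = (\<Sum>a\<in>S. ?p a * of_int (a i))"
    "\<And>a. a \<in> S \<Longrightarrow> of_int (?R a) + (\<Sum>i\<in>?G. v a i) \<le> of_int c"
    "\<And>a. a \<in> S \<Longrightarrow> of_int (min (?P a) c) \<le> of_int (?R a) + (\<Sum>i\<in>?G. v a i)"
    "(\<Sum>a\<in>S. ?p a * (\<Sum>i\<in>?G. \<bar>v a i - of_int (a i)\<bar>)) \<le> 2 * (\<Sum>a\<in>S. ?p a * of_int (max 0 (?P a - c)))"
  proof (rule exchange[where S = S and G = ?G and p = ?p and lo = lo and hi = hi and R = ?R and P = ?P and c = c])
    show "lo i \<le> a i \<and> a i \<le> hi i" if "a \<in> S" "i \<in> ?G" for a i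
      using boxS[OF that(1)] that(2) q by auto
    show "?R a \<le> ?R b + 1" if "a \<in> S" "b \<in> S" for a b
      using preS[OF that(1)] preS[OF that(2)] by linarith
    show "0 < ?p a" if "a \<in> S" for a using that by (simp add: S_def)
  qed (use finS Psplit meanS in auto)
  obtain Y :: "real \<Rightarrow> nat \<Rightarrow> int" where Y: "simple_rv Y"
    "\<And>u q. u \<in> {0..1} \<Longrightarrow> q \<le> l \<Longrightarrow> \<lfloor>\<Sum>i<q. v (X u) i\<rfloor> \<le> (\<Sum>i<q. Y u i)"
    "\<And>u q. u \<in> {0..1} \<Longrightarrow> q \<le> l \<Longrightarrow> (\<Sum>i<q. Y u i) \<le> \<lceil>\<Sum>i<q. v (X u) i\<rceil>"
    "\<And>u i. u \<in> {0..1} \<Longrightarrow> i < l \<Longrightarrow> \<lfloor>v (X u) i\<rfloor> \<le> Y u i"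
    "\<And>u i. u \<in> {0..1} \<Longrightarrow> i < l \<Longrightarrow> Y u i \<le> \<lceil>v (X u) i\<rceil>"
    "\<And>h i. i < l \<Longrightarrow> expect (\<lambda>u. h (X u) * of_int (Y u i)) = expect (\<lambda>u. h (X u) * v (X u) i)"
    using randomized_rounding[OF X, of l v] by blast
  have AE_S: "AE u in unit_space. X u \<in> S" using AES[of "\<lambda>a. a \<in> S"] by simp
  have vP: "(\<Sum>i<q. v a i) = of_int (?R a) + (\<Sum>i\<in>?G. v a i)" for a
    using v(2) by (simp add: PsplitR)
  show ?thesis
  proof (rule that[OF Y(1)])
    show "AE u in unit_space. \<forall>i<l. lo i \<le> Y u i \<and> Y u i \<le> hi i"
      using AE_S AE_space
    proof eventually_elim
      case (elim u)
      then have u: "u \<in> {0..1}" by simp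
      show ?case
      proof (intro allI impI)
        fix i assume i: "i < l"
        have "of_int (lo i) \<le> v (X u) i \<and> v (X u) i \<le> of_int (hi i)"
          using v(1)[OF elim(1), of i] v(2)[of i "X u"] boxS[OF elim(1)] i by (cases "i \<in> ?G") auto
        then have "lo i \<le> \<lfloor>v (X u) i\<rfloor>" "\<lceil>v (X u) i\<rceil> \<le> hi i" by linarith+
        then show "lo i \<le> Y u i \<and> Y u i \<le> hi i" using Y(4,5)[OF u i] by linarith
      qed
    qed
    show "expect (\<lambda>u. of_int (Y u i)) = expect (\<lambda>u. of_int (X u i))" if "i < l" for i
      using Y(6)[OF that, of "\<lambda>_. 1"] v(3)[of i] EX[of "\<lambda>a. v a i"] EX[of "\<lambda>a. of_int (a i)"] by simp
    show "AE u in unit_space. (\<Sum>i<q. Y u i) \<le> c"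
      using AE_S AE_space
    proof eventually_elim
      case (elim u)
      then have "\<lceil>\<Sum>i<q. v (X u) i\<rceil> \<le> c" using v(4)[OF elim(1)] vP by (simp add: ceiling_le_iff)
      then show ?case using Y(3)[of u q] elim q by simp
    qed
    show "AE u in unit_space. min (\<Sum>i<q. X u i) c \<le> (\<Sum>i<q. Y u i)"
      using AE_S AE_space
    proof eventually_elim
      case (elim u)
      then have "min (\<Sum>i<q. X u i) c \<le> \<lfloor>\<Sum>i<q. v (X u) i\<rfloor>"
        using v(5)[OF elim(1)] vP[of "X u"] by (metis le_floor_iff)
      then show ?case using Y(2)[of u q] elim q by simp
    qed
    show "AE u in unit_space. \<forall>i<l. i \<notin> ?G \<longrightarrow> Y u i = X u i"
      using AE_space
    proof eventually_elim
      case (elim u)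
      show ?case
      proof (intro allI impI)
        fix i assume "i < l" "i \<notin> ?G"
        then show "Y u i = X u i" using Y(4,5)[of u i] elim v(2)[of i "X u"] by simp
      qed
    qed
    have "(\<Sum>i\<in>?G. expect (\<lambda>u. of_int \<bar>Y u i - X u i\<bar>)) =
        (\<Sum>i\<in>?G. expect (\<lambda>u. \<bar>v (X u) i - of_int (X u i)\<bar>))"
    proof (intro sum.cong refl)
      fix i assume "i \<in> ?G"
      then have "i < l" using q by simp
      then show "expect (\<lambda>u. of_int \<bar>Y u i - X u i\<bar>) = expect (\<lambda>u. \<bar>v (X u) i - of_int (X u i)\<bar>)"
        using Y by (intro expect_abs_rounding X) auto
    qed
    also have "\<dots> = (\<Sum>a\<in>S. ?p a * (\<Sum>i\<in>?G. \<bar>v a i - of_int (a i)\<bar>))"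
      unfolding EX[of "\<lambda>a. \<bar>v a _ - of_int (a _)\<bar>"] by (subst sum.swap) (simp add: sum_distrib_left)
    also have "\<dots> \<le> 2 * (\<Sum>a\<in>S. ?p a * of_int (max 0 (?P a - c)))" by (rule v(6))
    also have "\<dots> = 2 * expect (\<lambda>u. of_int (max 0 ((\<Sum>i<q. X u i) - c)))"
      using EX[of "\<lambda>a. of_int (max 0 (?P a - c))"] by simp
    finally show "(\<Sum>i\<in>?G. expect (\<lambda>u. of_int \<bar>Y u i - X u i\<bar>)) \<le> \<dots>" .
  qed
qed

text \<open>Mirror image of lowering, applied to the negated allocation; its prefix lies between
  \<open>- f - 1\<close> and \<open>- f\<close>, again a window of width one.\<close>

lemma raise_prefix_lower:
  fixes X :: "real \<Rightarrow> nat \<Rightarrow> int"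
  assumes X: "simple_rv X" and q: "q' \<le> q" "q \<le> l"
    and box: "AE u in unit_space. \<forall>i<l. lo i \<le> X u i \<and> X u i \<le> hi i"
    and pre: "AE u in unit_space. f \<le> (\<Sum>i<q'. X u i) \<and> (\<Sum>i<q'. X u i) \<le> f + 1"
    and mean: "of_int c \<le> expect (\<lambda>u. of_int (\<Sum>i<q. X u i))"
  obtains Y :: "real \<Rightarrow> nat \<Rightarrow> int" where "simple_rv Y"
    "AE u in unit_space. \<forall>i<l. lo i \<le> Y u i \<and> Y u i \<le> hi i"
    "\<And>i. i < l \<Longrightarrow> expect (\<lambda>u. of_int (Y u i)) = expect (\<lambda>u. of_int (X u i))"
    "AE u in unit_space. c \<le> (\<Sum>i<q. Y u i)"
    "AE u in unit_space. (\<Sum>i<q. Y u i) \<le> max (\<Sum>i<q. X u i) c"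
    "AE u in unit_space. \<forall>i<l. i \<notin> {q'..<q} \<longrightarrow> Y u i = X u i"
    "(\<Sum>i\<in>{q'..<q}. expect (\<lambda>u. of_int \<bar>Y u i - X u i\<bar>)) \<le> 2 * expect (\<lambda>u. of_int (max 0 (c - (\<Sum>i<q. X u i))))"
proof -
  let ?X = "\<lambda>u i. - X u i"
  have X': "simple_rv ?X"
    using simple_function_compose1[OF X, of "\<lambda>x i. - x i"] .
  have box': "AE u in unit_space. \<forall>i<l. - hi i \<le> ?X u i \<and> ?X u i \<le> - lo i"
    using box by eventually_elim auto
  have pre': "AE u in unit_space. - f - 1 \<le> (\<Sum>i<q'. ?X u i) \<and> (\<Sum>i<q'. ?X u i) \<le> - f - 1 + 1"
    using pre by eventually_elim (auto simp: sum_negf)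
  have mean': "expect (\<lambda>u. of_int (\<Sum>i<q. ?X u i)) \<le> of_int (- c)"
    using mean by (simp add: sum_negf)
  obtain Y :: "real \<Rightarrow> nat \<Rightarrow> int" where Y: "simple_rv Y"
    "AE u in unit_space. \<forall>i<l. - hi i \<le> Y u i \<and> Y u i \<le> - lo i"
    "\<And>i. i < l \<Longrightarrow> expect (\<lambda>u. of_int (Y u i)) = expect (\<lambda>u. of_int (?X u i))"
    "AE u in unit_space. (\<Sum>i<q. Y u i) \<le> - c"
    "AE u in unit_space. min (\<Sum>i<q. ?X u i) (- c) \<le> (\<Sum>i<q. Y u i)"
    "AE u in unit_space. \<forall>i<l. i \<notin> {q'..<q} \<longrightarrow> Y u i = ?X u i"
    "(\<Sum>i\<in>{q'..<q}. expect (\<lambda>u. of_int \<bar>Y u i - ?X u i\<bar>)) \<le> 2 * expect (\<lambda>u. of_int (max 0 ((\<Sum>i<q. ?X u i) - - c)))"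
    using lower_prefix_upper[OF X' q box' pre' mean'] by blast
  let ?Y = "\<lambda>u i. - Y u i"
  show ?thesis
  proof (rule that[of ?Y])
    show "simple_rv ?Y"
      using simple_function_compose1[OF Y(1), of "\<lambda>x i. - x i"] .
    show "AE u in unit_space. \<forall>i<l. lo i \<le> ?Y u i \<and> ?Y u i \<le> hi i"
      using Y(2) by eventually_elim auto
    show "expect (\<lambda>u. of_int (?Y u i)) = expect (\<lambda>u. of_int (X u i))" if "i < l" for i
      using Y(3)[OF that] by simp
    show "AE u in unit_space. c \<le> (\<Sum>i<q. ?Y u i)"
      using Y(4) by eventually_elim (simp add: sum_negf)
    show "AE u in unit_space. (\<Sum>i<q. ?Y u i) \<le> max (\<Sum>i<q. X u i) c"
      using Y(5) by eventually_elim (auto simp add: sum_negf)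
    show "AE u in unit_space. \<forall>i<l. i \<notin> {q'..<q} \<longrightarrow> ?Y u i = X u i"
      using Y(6) by eventually_elim auto
    have "(\<Sum>i\<in>{q'..<q}. expect (\<lambda>u. of_int \<bar>?Y u i - X u i\<bar>)) =
      (\<Sum>i\<in>{q'..<q}. expect (\<lambda>u. of_int \<bar>Y u i - ?X u i\<bar>))"
      by (intro sum.cong Bochner_Integration.integral_cong refl) simp
    also have "\<dots> \<le> 2 * expect (\<lambda>u. of_int (max 0 ((\<Sum>i<q. ?X u i) - - c)))" by (rule Y(7))
    also have "(\<lambda>u. (\<Sum>i<q. ?X u i) - - c) = (\<lambda>u. c - (\<Sum>i<q. X u i))" by (simp add: sum_negf)
    finally show "(\<Sum>i\<in>{q'..<q}. expect (\<lambda>u. of_int \<bar>?Y u i - X u i\<bar>)) \<le>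
      2 * expect (\<lambda>u. of_int (max 0 (c - (\<Sum>i<q. X u i))))" .
  qed
qed

section \<open>Repairing a prefix total from both sides\<close>

lemma integrable_compose2:
  fixes g :: "'a \<Rightarrow> 'b \<Rightarrow> real"
  assumes "simple_rv X" "simple_rv Y"
  shows "integrable unit_space (\<lambda>u. g (X u) (Y u))"
  by (intro simple_integrable simple_function_compose2[OF assms])

lemma integrable_compose1:
  fixes g :: "'a \<Rightarrow> real"
  assumes "simple_rv X"
  shows "integrable unit_space (\<lambda>u. g (X u))"
  by (intro simple_integrable simple_function_compose1[OF assms])

lemma expect_dist_triangle:
  fixes X Y Z :: "real \<Rightarrow> nat \<Rightarrow> int"
  assumes X: "simple_rv X" and Y: "simple_rv Y" and Z: "simple_rv Z"
  shows "expect (\<lambda>u. of_int \<bar>Z u i - X u i\<bar>) \<le>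
    expect (\<lambda>u. of_int \<bar>Z u i - Y u i\<bar>) + expect (\<lambda>u. of_int \<bar>Y u i - X u i\<bar>)"
proof -
  have i: "integrable unit_space (\<lambda>u. real_of_int \<bar>P u i - Q u i\<bar>)"
    if "simple_rv P" "simple_rv Q" for P Q :: "real \<Rightarrow> nat \<Rightarrow> int"
    by (rule integrable_compose2[OF that, of "\<lambda>x y. real_of_int \<bar>x i - y i\<bar>"])
  show ?thesis
    unfolding Bochner_Integration.integral_add[OF i[OF Z Y] i[OF Y X], symmetric]
    by (intro integral_mono i X Y Z Bochner_Integration.integrable_add) linarith
qed

definition violation :: "int \<Rightarrow> int \<Rightarrow> int \<Rightarrow> real" where
  "violation f c x = of_int (max 0 (x - c)) + of_int (max 0 (f - x))"

lemma violation_nonneg: "0 \<le> violation f c x" by (simp add: violation_def)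

lemma violation_lipschitz: "violation f c y \<le> violation f c x + of_int \<bar>y - x\<bar>" if "f \<le> c"
  using that unfolding violation_def of_int_add[symmetric] of_int_le_iff by linarith

text \<open>The excess above the ceiling is removed before the shortfall below the floor. The first
  repair creates no new shortfall and the second stays below the ceiling, so the costs add up to
  twice the original violation.\<close>

lemma restore_prefix:
  fixes X :: "real \<Rightarrow> nat \<Rightarrow> int"
  assumes X: "simple_rv X" and q: "q' \<le> q" "q \<le> l"
    and box: "AE u in unit_space. \<forall>i<l. lo i \<le> X u i \<and> X u i \<le> hi i"
    and pre: "AE u in unit_space. f \<le> (\<Sum>i<q'. X u i) \<and> (\<Sum>i<q'. X u i) \<le> f + 1"
    and mean: "expect (\<lambda>u. of_int (\<Sum>i<q. X u i)) = M"
  obtains Y :: "real \<Rightarrow> nat \<Rightarrow> int" where "simple_rv Y"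
    "AE u in unit_space. \<forall>i<l. lo i \<le> Y u i \<and> Y u i \<le> hi i"
    "\<And>i. i < l \<Longrightarrow> expect (\<lambda>u. of_int (Y u i)) = expect (\<lambda>u. of_int (X u i))"
    "AE u in unit_space. \<lfloor>M\<rfloor> \<le> (\<Sum>i<q. Y u i) \<and> (\<Sum>i<q. Y u i) \<le> \<lceil>M\<rceil>"
    "AE u in unit_space. \<forall>i<l. i \<notin> {q'..<q} \<longrightarrow> Y u i = X u i"
    "(\<Sum>i\<in>{q'..<q}. expect (\<lambda>u. of_int \<bar>Y u i - X u i\<bar>)) \<le> 2 * expect (\<lambda>u. violation \<lfloor>M\<rfloor> \<lceil>M\<rceil> (\<Sum>i<q. X u i))"
proof -
  have mean_c: "expect (\<lambda>u. of_int (\<Sum>i<q. X u i)) \<le> of_int \<lceil>M\<rceil>" using mean by (simp add: le_of_int_ceiling)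
  obtain Y :: "real \<Rightarrow> nat \<Rightarrow> int" where Y: "simple_rv Y"
    "AE u in unit_space. \<forall>i<l. lo i \<le> Y u i \<and> Y u i \<le> hi i"
    "\<And>i. i < l \<Longrightarrow> expect (\<lambda>u. of_int (Y u i)) = expect (\<lambda>u. of_int (X u i))"
    "AE u in unit_space. (\<Sum>i<q. Y u i) \<le> \<lceil>M\<rceil>"
    "AE u in unit_space. min (\<Sum>i<q. X u i) \<lceil>M\<rceil> \<le> (\<Sum>i<q. Y u i)"
    "AE u in unit_space. \<forall>i<l. i \<notin> {q'..<q} \<longrightarrow> Y u i = X u i"
    "(\<Sum>i\<in>{q'..<q}. expect (\<lambda>u. of_int \<bar>Y u i - X u i\<bar>)) \<le> 2 * expect (\<lambda>u. of_int (max 0 ((\<Sum>i<q. X u i) - \<lceil>M\<rceil>)))"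
    using lower_prefix_upper[OF X q box pre mean_c] by blast
  have preY: "AE u in unit_space. f \<le> (\<Sum>i<q'. Y u i) \<and> (\<Sum>i<q'. Y u i) \<le> f + 1"
    using pre Y(6)
  proof eventually_elim
    case (elim u)
    have "(\<Sum>i<q'. Y u i) = (\<Sum>i<q'. X u i)" using elim(2) q by (intro sum.cong) auto
    then show ?case using elim(1) by simp
  qed
  have meanY: "expect (\<lambda>u. of_int (\<Sum>i<q. Y u i)) = M"
  proof -
    have "expect (\<lambda>u. of_int (\<Sum>i<q. Y u i)) = (\<Sum>i<q. expect (\<lambda>u. of_int (Y u i)))"
      by (simp add: integrable_compose1[OF Y(1), of "\<lambda>y. of_int (y _)"])
    also have "\<dots> = (\<Sum>i<q. expect (\<lambda>u. of_int (X u i)))" using Y(3) q by (intro sum.cong) auto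
    also have "\<dots> = M"
      using mean by (simp add: integrable_compose1[OF X, of "\<lambda>y. of_int (y _)"])
    finally show ?thesis .
  qed
  have meanY_f: "of_int \<lfloor>M\<rfloor> \<le> expect (\<lambda>u. of_int (\<Sum>i<q. Y u i))" using meanY by simp
  obtain Z :: "real \<Rightarrow> nat \<Rightarrow> int" where Z: "simple_rv Z"
    "AE u in unit_space. \<forall>i<l. lo i \<le> Z u i \<and> Z u i \<le> hi i"
    "\<And>i. i < l \<Longrightarrow> expect (\<lambda>u. of_int (Z u i)) = expect (\<lambda>u. of_int (Y u i))"
    "AE u in unit_space. \<lfloor>M\<rfloor> \<le> (\<Sum>i<q. Z u i)"
    "AE u in unit_space. (\<Sum>i<q. Z u i) \<le> max (\<Sum>i<q. Y u i) \<lfloor>M\<rfloor>"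
    "AE u in unit_space. \<forall>i<l. i \<notin> {q'..<q} \<longrightarrow> Z u i = Y u i"
    "(\<Sum>i\<in>{q'..<q}. expect (\<lambda>u. of_int \<bar>Z u i - Y u i\<bar>)) \<le> 2 * expect (\<lambda>u. of_int (max 0 (\<lfloor>M\<rfloor> - (\<Sum>i<q. Y u i))))"
    using raise_prefix_lower[OF Y(1) q Y(2) preY meanY_f] by blast
  have fc: "\<lfloor>M\<rfloor> \<le> \<lceil>M\<rceil>" by linarith
  show ?thesis
  proof (rule that[OF Z(1) Z(2)])
    show "expect (\<lambda>u. of_int (Z u i)) = expect (\<lambda>u. of_int (X u i))" if "i < l" for i
      using Y(3) Z(3) that by simp
    show "AE u in unit_space. \<lfloor>M\<rfloor> \<le> (\<Sum>i<q. Z u i) \<and> (\<Sum>i<q. Z u i) \<le> \<lceil>M\<rceil>"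
      using Z(4) Z(5) Y(4) by eventually_elim (use fc in linarith)
    show "AE u in unit_space. \<forall>i<l. i \<notin> {q'..<q} \<longrightarrow> Z u i = X u i"
      using Z(6) Y(6) by eventually_elim auto
    have "(\<Sum>i\<in>{q'..<q}. expect (\<lambda>u. of_int \<bar>Z u i - X u i\<bar>)) \<le>
       (\<Sum>i\<in>{q'..<q}. expect (\<lambda>u. of_int \<bar>Z u i - Y u i\<bar>) + expect (\<lambda>u. of_int \<bar>Y u i - X u i\<bar>))"
      by (intro sum_mono expect_dist_triangle X Y(1) Z(1))
    also have "\<dots> \<le> 2 * expect (\<lambda>u. of_int (max 0 (\<lfloor>M\<rfloor> - (\<Sum>i<q. Y u i)))) +
        2 * expect (\<lambda>u. of_int (max 0 ((\<Sum>i<q. X u i) - \<lceil>M\<rceil>)))"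
      unfolding sum.distrib by (intro add_mono Z(7) Y(7))
    also have "expect (\<lambda>u. of_int (max 0 (\<lfloor>M\<rfloor> - (\<Sum>i<q. Y u i)))) \<le>
        expect (\<lambda>u. of_int (max 0 (\<lfloor>M\<rfloor> - (\<Sum>i<q. X u i))))"
    proof (rule integral_mono_AE)
      show "integrable unit_space (\<lambda>u. real_of_int (max 0 (\<lfloor>M\<rfloor> - (\<Sum>i<q. Y u i))))"
        by (rule integrable_compose1[OF Y(1)])
      show "integrable unit_space (\<lambda>u. real_of_int (max 0 (\<lfloor>M\<rfloor> - (\<Sum>i<q. X u i))))"
        by (rule integrable_compose1[OF X])
      show "AE u in unit_space. real_of_int (max 0 (\<lfloor>M\<rfloor> - (\<Sum>i<q. Y u i))) \<le> real_of_int (max 0 (\<lfloor>M\<rfloor> - (\<Sum>i<q. X u i)))"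
        using Y(5) by eventually_elim (unfold of_int_le_iff, use fc in linarith)
    qed
    finally show "(\<Sum>i\<in>{q'..<q}. expect (\<lambda>u. of_int \<bar>Z u i - X u i\<bar>)) \<le>
        2 * expect (\<lambda>u. violation \<lfloor>M\<rfloor> \<lceil>M\<rceil> (\<Sum>i<q. X u i))"
      unfolding violation_def
      by (subst Bochner_Integration.integral_add[OF integrable_compose1[OF X] integrable_compose1[OF X]]) simp
  qed
qed

text \<open>When all outcomes move in the same direction, the expected movement equals the change of
  the mean. A constant map achieves this when \<open>m'\<close> lies beyond the floor or ceiling of
  \<open>m\<close>; in between, the outcomes are contracted towards the endpoint on the side of
  \<open>m'\<close>.\<close>

lemma affine_shift:
  fixes m m' :: real
  obtains \<alpha> \<beta> :: real where "\<alpha> + \<beta> * m = m'"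
    "\<And>a::int. \<lfloor>m\<rfloor> \<le> a \<Longrightarrow> a \<le> \<lceil>m\<rceil> \<Longrightarrow> \<lfloor>m'\<rfloor> \<le> \<alpha> + \<beta> * a \<and> \<alpha> + \<beta> * a \<le> \<lceil>m'\<rceil>"
    "(\<forall>a::int. \<lfloor>m\<rfloor> \<le> a \<and> a \<le> \<lceil>m\<rceil> \<longrightarrow> a \<le> \<alpha> + \<beta> * a) \<or>
     (\<forall>a::int. \<lfloor>m\<rfloor> \<le> a \<and> a \<le> \<lceil>m\<rceil> \<longrightarrow> \<alpha> + \<beta> * a \<le> a)"
proof -
  consider "m' = m" | "m' \<ge> \<lceil>m\<rceil>" | "m' \<le> \<lfloor>m\<rfloor>" | "m < m'" "m' < \<lceil>m\<rceil>" | "m' < m" "\<lfloor>m\<rfloor> < m'"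
    by linarith
  then show ?thesis
  proof cases
    case 1
    then show ?thesis by (intro that[of 0 1]) auto
  next
    case 2
    then have "real_of_int a \<le> m'" if "a \<le> \<lceil>m\<rceil>" for a using that by linarith
    then show ?thesis by (intro that[of m' 0] disjI1 allI impI) auto
  next
    case 3
    then have "m' \<le> real_of_int a" if "\<lfloor>m\<rfloor> \<le> a" for a using that by linarith
    then show ?thesis by (intro that[of m' 0] disjI2 allI impI) auto
  next
    case 4
    \<comment> \<open>The weight of the endpoint for which the mean \<open>m\<close> is carried
      exactly to \<open>m'\<close>.\<close>
    define \<theta> where "\<theta> = (m' - m) / (\<lceil>m\<rceil> - m)"
    have gap: "0 < \<lceil>m\<rceil> - m" "0 < m' - m" "m' - m \<le> \<lceil>m\<rceil> - m" using 4 by linarith+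
    have \<theta>: "0 \<le> \<theta>" "\<theta> \<le> 1" "\<theta> * (\<lceil>m\<rceil> - m) = m' - m"
      unfolding \<theta>_def using gap by (simp_all only: divide_le_eq_1 zero_le_divide_iff) auto
    have "real_of_int \<lceil>m\<rceil> \<le> real_of_int \<lfloor>m\<rfloor> + 1"
      using ceiling_diff_floor_le_1[of m] by linarith
    then have fl: "\<lfloor>m'\<rfloor> = \<lfloor>m\<rfloor>" "\<lceil>m'\<rceil> = \<lceil>m\<rceil>"
      unfolding floor_eq_iff ceiling_eq_iff using 4 of_int_floor_le[of m] le_of_int_ceiling[of m] by (intro conjI; linarith)+
    have up: "a \<le> \<theta> * \<lceil>m\<rceil> + (1 - \<theta>) * a \<and> \<theta> * \<lceil>m\<rceil> + (1 - \<theta>) * a \<le> \<lceil>m\<rceil>" if "a \<le> \<lceil>m\<rceil>" for a :: int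
    proof -
      have "real_of_int a \<le> \<lceil>m\<rceil>" using that by simp
      then have "0 \<le> \<theta> * (\<lceil>m\<rceil> - a)" "0 \<le> (1 - \<theta>) * (\<lceil>m\<rceil> - a)" using \<theta> by simp_all
      then show ?thesis by (simp add: algebra_simps)
    qed
    show ?thesis
    proof (rule that[of "\<theta> * \<lceil>m\<rceil>" "1 - \<theta>"])
      show "\<theta> * \<lceil>m\<rceil> + (1 - \<theta>) * m = m'" using \<theta>(3) by (simp add: algebra_simps)
      show "\<lfloor>m'\<rfloor> \<le> \<theta> * \<lceil>m\<rceil> + (1 - \<theta>) * a \<and> \<theta> * \<lceil>m\<rceil> + (1 - \<theta>) * a \<le> \<lceil>m'\<rceil>"
        if "\<lfloor>m\<rfloor> \<le> a" "a \<le> \<lceil>m\<rceil>" for a :: int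
        using up[OF that(2)] that(1) unfolding fl by linarith
    qed (use up in blast)
  next
    case 5
    define \<theta> where "\<theta> = (m - m') / (m - \<lfloor>m\<rfloor>)"
    have gap: "0 < m - \<lfloor>m\<rfloor>" "0 < m - m'" "m - m' \<le> m - \<lfloor>m\<rfloor>" using 5 by linarith+
    have \<theta>: "0 \<le> \<theta>" "\<theta> \<le> 1" "\<theta> * (m - \<lfloor>m\<rfloor>) = m - m'"
      unfolding \<theta>_def using gap by (simp_all only: divide_le_eq_1 zero_le_divide_iff) auto
    have "real_of_int \<lceil>m\<rceil> \<le> real_of_int \<lfloor>m\<rfloor> + 1"
      using ceiling_diff_floor_le_1[of m] by linarith
    then have fl: "\<lfloor>m'\<rfloor> = \<lfloor>m\<rfloor>" "\<lceil>m'\<rceil> = \<lceil>m\<rceil>"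
      unfolding floor_eq_iff ceiling_eq_iff using 5 of_int_floor_le[of m] le_of_int_ceiling[of m] by (intro conjI; linarith)+
    have up: "\<theta> * \<lfloor>m\<rfloor> + (1 - \<theta>) * a \<le> a \<and> \<lfloor>m\<rfloor> \<le> \<theta> * \<lfloor>m\<rfloor> + (1 - \<theta>) * a" if "\<lfloor>m\<rfloor> \<le> a" for a :: int
    proof -
      have "\<lfloor>m\<rfloor> \<le> real_of_int a" using that by simp
      then have "0 \<le> \<theta> * (a - \<lfloor>m\<rfloor>)" "0 \<le> (1 - \<theta>) * (a - \<lfloor>m\<rfloor>)" using \<theta> by simp_all
      then show ?thesis by (simp add: algebra_simps)
    qed
    show ?thesis
    proof (rule that[of "\<theta> * \<lfloor>m\<rfloor>" "1 - \<theta>"])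
      show "\<theta> * \<lfloor>m\<rfloor> + (1 - \<theta>) * m = m'" using \<theta>(3) by (simp add: algebra_simps)
      show "\<lfloor>m'\<rfloor> \<le> \<theta> * \<lfloor>m\<rfloor> + (1 - \<theta>) * a \<and> \<theta> * \<lfloor>m\<rfloor> + (1 - \<theta>) * a \<le> \<lceil>m'\<rceil>"
        if "\<lfloor>m\<rfloor> \<le> a" "a \<le> \<lceil>m\<rceil>" for a :: int
        using up[OF that(1)] that(2) unfolding fl by linarith
    qed (use up in blast)
  qed
qed

text \<open>For intervals from floor to ceiling, either the new one contains the old one or they
  meet at most in an endpoint. In the latter case all outcomes lie on one side of the new interval,
  and the expected violation is the distance of the mean \<open>M\<close> from it.\<close>

lemma expect_violation_le:
  fixes X :: "real \<Rightarrow> int"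
  assumes X: "simple_rv X"
    and range: "\<And>u. u \<in> {0..1} \<Longrightarrow> \<lfloor>M\<rfloor> \<le> X u \<and> X u \<le> \<lceil>M\<rceil>"
    and mean: "expect (\<lambda>u. of_int (X u)) = M"
  shows "expect (\<lambda>u. violation \<lfloor>M'\<rfloor> \<lceil>M'\<rceil> (X u)) \<le> \<bar>M' - M\<bar>"
proof -
  have iX: "integrable unit_space (\<lambda>u. real_of_int (X u))" by (rule integrable_compose1[OF X])
  consider "\<lceil>M'\<rceil> \<le> \<lfloor>M\<rfloor>" | "\<lceil>M\<rceil> \<le> \<lfloor>M'\<rfloor>" | "\<lfloor>M'\<rfloor> \<le> \<lfloor>M\<rfloor>" "\<lceil>M\<rceil> \<le> \<lceil>M'\<rceil>" by linarith
  then show ?thesis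
  proof cases
    case 1
    have "expect (\<lambda>u. violation \<lfloor>M'\<rfloor> \<lceil>M'\<rceil> (X u)) = expect (\<lambda>u. of_int (X u) - of_int \<lceil>M'\<rceil>)"
    proof (rule Bochner_Integration.integral_cong)
      fix u assume "u \<in> space unit_space"
      then have "\<lfloor>M\<rfloor> \<le> X u \<and> X u \<le> \<lceil>M\<rceil>" using range by simp
      then have "\<lfloor>M'\<rfloor> \<le> X u" "\<lceil>M'\<rceil> \<le> X u" using 1 by linarith+
      then show "violation \<lfloor>M'\<rfloor> \<lceil>M'\<rceil> (X u) = of_int (X u) - of_int \<lceil>M'\<rceil>" by (simp add: violation_def)
    qed simp
    also have "\<dots> = M - of_int \<lceil>M'\<rceil>" using iX mean by simp
    also have "\<dots> \<le> \<bar>M' - M\<bar>" by linarith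
    finally show ?thesis .
  next
    case 2
    have "expect (\<lambda>u. violation \<lfloor>M'\<rfloor> \<lceil>M'\<rceil> (X u)) = expect (\<lambda>u. of_int \<lfloor>M'\<rfloor> - of_int (X u))"
    proof (rule Bochner_Integration.integral_cong)
      fix u assume "u \<in> space unit_space"
      then have "\<lfloor>M\<rfloor> \<le> X u \<and> X u \<le> \<lceil>M\<rceil>" using range by simp
      then have "X u \<le> \<lfloor>M'\<rfloor>" "X u \<le> \<lceil>M'\<rceil>" using 2 by linarith+
      then show "violation \<lfloor>M'\<rfloor> \<lceil>M'\<rceil> (X u) = of_int \<lfloor>M'\<rfloor> - of_int (X u)" by (simp add: violation_def)
    qed simp
    also have "\<dots> = of_int \<lfloor>M'\<rfloor> - M" using iX mean by simp
    also have "\<dots> \<le> \<bar>M' - M\<bar>" by linarith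
    finally show ?thesis .
  next
    case 3
    have "expect (\<lambda>u. violation \<lfloor>M'\<rfloor> \<lceil>M'\<rceil> (X u)) = expect (\<lambda>u. 0)"
    proof (rule Bochner_Integration.integral_cong)
      fix u assume "u \<in> space unit_space"
      then have "\<lfloor>M\<rfloor> \<le> X u \<and> X u \<le> \<lceil>M\<rceil>" using range by simp
      then have "\<lfloor>M'\<rfloor> \<le> X u" "X u \<le> \<lceil>M'\<rceil>" using 3 by linarith+
      then show "violation \<lfloor>M'\<rfloor> \<lceil>M'\<rceil> (X u) = 0" by (simp add: violation_def)
    qed simp
    then show ?thesis by simp
  qed
qed

section \<open>Online rounding of fractional allocations\<close>

text \<open>Several classes may share a level, since distinct weights may round to the same power.
  Monotonicity of \<open>lev\<close> makes the classes down to a given level an initial segment of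
  the indices, so that heavy totals are prefix sums.\<close>

locale level_weights =
  fixes l r :: nat and lev :: "nat \<Rightarrow> nat" and s0 :: real
  assumes lev_mono: "i \<le> j \<Longrightarrow> j < l \<Longrightarrow> lev i \<le> lev j"
    and lev_less: "i < l \<Longrightarrow> lev i < r"
    and s0_pos: "0 < s0"
begin

text \<open>Base 5 leaves all levels after \<open>j\<close> together at most a quarter of
  \<open>lw j\<close>, the amount that the repair of level \<open>j\<close> can afford to
  disturb.\<close>

definition lw :: "nat \<Rightarrow> real" where "lw h = s0 / 5 ^ h"

definition cut :: "nat \<Rightarrow> nat" where "cut h = (LEAST n. l \<le> n \<or> h \<le> lev n)"

text \<open>For \<open>h = r\<close> the prefix is the whole vector, so an integral total is met
  exactly.\<close>

definition balanced :: "(nat \<Rightarrow> real) \<Rightarrow> (nat \<Rightarrow> int) \<Rightarrow> bool" where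
  "balanced m x \<longleftrightarrow> (\<forall>i<l. \<lfloor>m i\<rfloor> \<le> x i \<and> x i \<le> \<lceil>m i\<rceil>) \<and>
     (\<forall>h\<le>r. \<lfloor>\<Sum>i<cut h. m i\<rfloor> \<le> (\<Sum>i<cut h. x i) \<and> (\<Sum>i<cut h. x i) \<le> \<lceil>\<Sum>i<cut h. m i\<rceil>)"

lemma lw_pos: "0 < lw h" using s0_pos by (simp add: lw_def)

lemma less_cut_iff: "i < cut h \<longleftrightarrow> i < l \<and> lev i < h"
proof
  assume "i < cut h"
  then have "\<not> (l \<le> i \<or> h \<le> lev i)" unfolding cut_def by (rule not_less_Least)
  then show "i < l \<and> lev i < h" by simp
next
  assume i: "i < l \<and> lev i < h"
  have "l \<le> cut h \<or> h \<le> lev (cut h)" unfolding cut_def by (rule LeastI[of _ l]) simp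
  then show "i < cut h" using i lev_mono[of "cut h" i] by (cases "i < cut h") auto
qed

lemma cut_le: "cut h \<le> l"
  using less_cut_iff[of l h] by (intro leI) blast

lemma cut_mono: "h \<le> h' \<Longrightarrow> cut h \<le> cut h'"
  using less_cut_iff[of "cut h'" h] less_cut_iff[of "cut h'" h'] by (intro leI) auto

lemma cut_0: "cut 0 = 0" using less_cut_iff[of 0 0] by simp

lemma cut_r: "cut r = l"
  using cut_le[of r] less_cut_iff[of "cut r" r] lev_less[of "cut r"] by fastforce

lemma block_iff: "i \<in> {cut h..<cut (Suc h)} \<longleftrightarrow> i < l \<and> lev i = h"
  using less_cut_iff[of i h] less_cut_iff[of i "Suc h"] by auto

lemma lw_tail: "(\<Sum>h\<in>{j..<n}. lw h) \<le> lw j * (5 / 4)"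
proof (cases "j \<le> n")
  case True
  have "(\<Sum>h\<in>{j..<n}. lw h) = (lw j - lw n) * (5 / 4)"
    using True
  proof (induction n rule: dec_induct)
    case (step n)
    then show ?case by (simp add: lw_def)
  qed simp
  then show ?thesis using lw_pos[of n] by simp
qed (use lw_pos[of j] in simp)

abbreviation viol :: "(nat \<Rightarrow> real) \<Rightarrow> nat \<Rightarrow> (nat \<Rightarrow> int) \<Rightarrow> real" where
  "viol m h x \<equiv> violation \<lfloor>\<Sum>i<cut (Suc h). m i\<rfloor> \<lceil>\<Sum>i<cut (Suc h). m i\<rceil> (\<Sum>i<cut (Suc h). x i)"

lemma expect_viol_lipschitz:
  assumes X: "simple_rv X" and Y: "simple_rv Y"
  shows "expect (\<lambda>u. viol m h (Y u)) \<le> expect (\<lambda>u. viol m h (X u)) +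
    (\<Sum>i<cut (Suc h). expect (\<lambda>u. of_int \<bar>Y u i - X u i\<bar>))"
proof -
  let ?q = "cut (Suc h)"
  have i: "integrable unit_space (\<lambda>u. real_of_int \<bar>Y u i - X u i\<bar>)" for i
    by (rule integrable_compose2[OF Y X])
  have "expect (\<lambda>u. viol m h (Y u)) \<le> expect (\<lambda>u. viol m h (X u) + (\<Sum>i<?q. of_int \<bar>Y u i - X u i\<bar>))"
  proof (rule integral_mono)
    show "integrable unit_space (\<lambda>u. viol m h (Y u))" by (rule integrable_compose1[OF Y])
    show "integrable unit_space (\<lambda>u. viol m h (X u) + (\<Sum>i<?q. of_int \<bar>Y u i - X u i\<bar>))"
      by (rule integrable_compose2[OF X Y])
    fix u
    have "\<bar>(\<Sum>i<?q. Y u i) - (\<Sum>i<?q. X u i)\<bar> \<le> (\<Sum>i<?q. \<bar>Y u i - X u i\<bar>)"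
      unfolding sum_subtractf[symmetric] by (rule sum_abs)
    then have "real_of_int \<bar>(\<Sum>i<?q. Y u i) - (\<Sum>i<?q. X u i)\<bar> \<le> (\<Sum>i<?q. real_of_int \<bar>Y u i - X u i\<bar>)"
      unfolding of_int_sum[symmetric] of_int_le_iff .
    moreover have "\<lfloor>\<Sum>i<?q. m i\<rfloor> \<le> \<lceil>\<Sum>i<?q. m i\<rceil>" by linarith
    ultimately show "viol m h (Y u) \<le> viol m h (X u) + (\<Sum>i<?q. of_int \<bar>Y u i - X u i\<bar>)"
      using violation_lipschitz by (meson add_left_mono order_trans)
  qed
  also have "\<dots> = expect (\<lambda>u. viol m h (X u)) + expect (\<lambda>u. \<Sum>i<?q. of_int \<bar>Y u i - X u i\<bar>)"
    using i by (intro Bochner_Integration.integral_add integrable_compose1[OF X] Bochner_Integration.integrable_sum)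
  also have "expect (\<lambda>u. \<Sum>i<?q. of_int \<bar>Y u i - X u i\<bar>) = (\<Sum>i<?q. expect (\<lambda>u. of_int \<bar>Y u i - X u i\<bar>))"
    using i by (intro Bochner_Integration.integral_sum)
  finally show ?thesis .
qed

text \<open>The geometric decay of the weights makes \<open>4 * \<Sum>h. lw h * E (viol m h)\<close> a potential that pays
  for restoring the prefix constraints from the heaviest level down: repairing level \<open>j\<close> costs at most
  \<open>2 * lw j * E (viol m j)\<close> and increases each later violation by at most \<open>2 * E (viol m j)\<close>.\<close>

lemma restore_levels:
  assumes X: "simple_rv X"
    and box: "AE u in unit_space. \<forall>i<l. \<lfloor>m i\<rfloor> \<le> X u i \<and> X u i \<le> \<lceil>m i\<rceil>"
    and mean: "\<And>i. i < l \<Longrightarrow> expect (\<lambda>u. of_int (X u i)) = m i"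
    and "j \<le> r"
  shows "\<exists>Y. simple_rv Y \<and>
    (AE u in unit_space. \<forall>i<l. \<lfloor>m i\<rfloor> \<le> Y u i \<and> Y u i \<le> \<lceil>m i\<rceil>) \<and>
    (\<forall>i<l. expect (\<lambda>u. of_int (Y u i)) = m i) \<and>
    (AE u in unit_space. \<forall>h\<le>j. \<lfloor>\<Sum>i<cut h. m i\<rfloor> \<le> (\<Sum>i<cut h. Y u i) \<and> (\<Sum>i<cut h. Y u i) \<le> \<lceil>\<Sum>i<cut h. m i\<rceil>) \<and>
    (\<Sum>i<l. lw (lev i) * expect (\<lambda>u. of_int \<bar>Y u i - X u i\<bar>)) + 4 * (\<Sum>h\<in>{j..<r}. lw h * expect (\<lambda>u. viol m h (Y u)))
      \<le> 4 * (\<Sum>h<r. lw h * expect (\<lambda>u. viol m h (X u)))"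
  using \<open>j \<le> r\<close>
proof (induction j)
  case 0
  show ?case
  proof (intro exI[of _ X] conjI allI impI X box mean)
    show "AE u in unit_space. \<forall>h\<le>0. \<lfloor>\<Sum>i<cut h. m i\<rfloor> \<le> (\<Sum>i<cut h. X u i) \<and> (\<Sum>i<cut h. X u i) \<le> \<lceil>\<Sum>i<cut h. m i\<rceil>"
      by (simp add: cut_0)
  qed (simp_all add: lessThan_atLeast0)
next
  case (Suc j)
  from Suc.IH[OF Suc_leD[OF Suc.prems]] obtain Y where Y: "simple_rv Y"
    "AE u in unit_space. \<forall>i<l. \<lfloor>m i\<rfloor> \<le> Y u i \<and> Y u i \<le> \<lceil>m i\<rceil>"
    "\<And>i. i < l \<Longrightarrow> expect (\<lambda>u. of_int (Y u i)) = m i"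
    "AE u in unit_space. \<forall>h\<le>j. \<lfloor>\<Sum>i<cut h. m i\<rfloor> \<le> (\<Sum>i<cut h. Y u i) \<and> (\<Sum>i<cut h. Y u i) \<le> \<lceil>\<Sum>i<cut h. m i\<rceil>"
    "(\<Sum>i<l. lw (lev i) * expect (\<lambda>u. of_int \<bar>Y u i - X u i\<bar>)) + 4 * (\<Sum>h\<in>{j..<r}. lw h * expect (\<lambda>u. viol m h (Y u)))
      \<le> 4 * (\<Sum>h<r. lw h * expect (\<lambda>u. viol m h (X u)))"
    by blast
  have q: "cut j \<le> cut (Suc j)" "cut (Suc j) \<le> l" using cut_mono cut_le by auto
  have pre: "AE u in unit_space. \<lfloor>\<Sum>i<cut j. m i\<rfloor> \<le> (\<Sum>i<cut j. Y u i) \<and> (\<Sum>i<cut j. Y u i) \<le> \<lfloor>\<Sum>i<cut j. m i\<rfloor> + 1"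
    using Y(4)
  proof eventually_elim
    case (elim u)
    then have "\<lfloor>\<Sum>i<cut j. m i\<rfloor> \<le> (\<Sum>i<cut j. Y u i) \<and> (\<Sum>i<cut j. Y u i) \<le> \<lceil>\<Sum>i<cut j. m i\<rceil>" by blast
    then show ?case using ceiling_diff_floor_le_1[of "\<Sum>i<cut j. m i"] by linarith
  qed
  have meanP: "expect (\<lambda>u. of_int (\<Sum>i<cut (Suc j). Y u i)) = (\<Sum>i<cut (Suc j). m i)"
  proof -
    have "expect (\<lambda>u. of_int (\<Sum>i<cut (Suc j). Y u i)) = (\<Sum>i<cut (Suc j). expect (\<lambda>u. of_int (Y u i)))"
      by (simp add: integrable_compose1[OF Y(1), of "\<lambda>y. of_int (y _)"])
    then show ?thesis using Y(3) q by simp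
  qed
  obtain Z where Z: "simple_rv Z"
    "AE u in unit_space. \<forall>i<l. \<lfloor>m i\<rfloor> \<le> Z u i \<and> Z u i \<le> \<lceil>m i\<rceil>"
    "\<And>i. i < l \<Longrightarrow> expect (\<lambda>u. of_int (Z u i)) = expect (\<lambda>u. of_int (Y u i))"
    "AE u in unit_space. \<lfloor>\<Sum>i<cut (Suc j). m i\<rfloor> \<le> (\<Sum>i<cut (Suc j). Z u i) \<and> (\<Sum>i<cut (Suc j). Z u i) \<le> \<lceil>\<Sum>i<cut (Suc j). m i\<rceil>"
    "AE u in unit_space. \<forall>i<l. i \<notin> {cut j..<cut (Suc j)} \<longrightarrow> Z u i = Y u i"
    "(\<Sum>i\<in>{cut j..<cut (Suc j)}. expect (\<lambda>u. of_int \<bar>Z u i - Y u i\<bar>)) \<le> 2 * expect (\<lambda>u. viol m j (Y u))"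
    using restore_prefix[OF Y(1) q Y(2) pre meanP] by blast
  define V where "V = expect (\<lambda>u. viol m j (Y u))"
  define \<delta> where "\<delta> i = expect (\<lambda>u. of_int \<bar>Z u i - Y u i\<bar>)" for i
  have V0: "0 \<le> V" unfolding V_def by (intro Bochner_Integration.integral_nonneg violation_nonneg)
  have \<delta>0: "0 \<le> \<delta> i" for i unfolding \<delta>_def by (intro Bochner_Integration.integral_nonneg) simp
  have block: "(\<Sum>i\<in>{cut j..<cut (Suc j)}. \<delta> i) \<le> 2 * V" using Z(6) by (simp add: \<delta>_def V_def)
  have \<delta>_out: "\<delta> i = 0" if "i < l" "i \<notin> {cut j..<cut (Suc j)}" for i
  proof -
    have "AE u in unit_space. real_of_int \<bar>Z u i - Y u i\<bar> = 0"
      using Z(5) by eventually_elim (use that in auto)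
    then show ?thesis
      unfolding \<delta>_def by (intro integral_eq_zero_AE)
  qed
  have move: "(\<Sum>i<l. lw (lev i) * expect (\<lambda>u. of_int \<bar>Z u i - X u i\<bar>)) \<le>
     (\<Sum>i<l. lw (lev i) * expect (\<lambda>u. of_int \<bar>Y u i - X u i\<bar>)) + 2 * lw j * V"
  proof -
    have tri: "expect (\<lambda>u. of_int \<bar>Z u i - X u i\<bar>) \<le> expect (\<lambda>u. of_int \<bar>Y u i - X u i\<bar>) + \<delta> i" for i
      using expect_dist_triangle[OF X Y(1) Z(1), of i] by (simp add: \<delta>_def)
    have "(\<Sum>i<l. lw (lev i) * \<delta> i) = (\<Sum>i\<in>{cut j..<cut (Suc j)}. lw j * \<delta> i)"
    proof (rule sum.mono_neutral_cong_right)
      show "\<forall>i\<in>{..<l} - {cut j..<cut (Suc j)}. lw (lev i) * \<delta> i = 0" using \<delta>_out by auto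
      show "lw (lev i) * \<delta> i = lw j * \<delta> i" if "i \<in> {cut j..<cut (Suc j)}" for i
        using that block_iff by simp
    qed (use q in auto)
    also have "\<dots> \<le> lw j * (2 * V)"
      unfolding sum_distrib_left[symmetric] using block lw_pos[of j] by (intro mult_left_mono) auto
    finally have "(\<Sum>i<l. lw (lev i) * \<delta> i) \<le> 2 * lw j * V" by simp
    moreover have "(\<Sum>i<l. lw (lev i) * expect (\<lambda>u. of_int \<bar>Z u i - X u i\<bar>)) \<le>
      (\<Sum>i<l. lw (lev i) * (expect (\<lambda>u. of_int \<bar>Y u i - X u i\<bar>) + \<delta> i))"
      using tri lw_pos[THEN less_imp_le] by (intro sum_mono mult_left_mono)
    ultimately show ?thesis by (simp add: distrib_left sum.distrib)
  qed
  have later: "expect (\<lambda>u. viol m h (Z u)) \<le> expect (\<lambda>u. viol m h (Y u)) + 2 * V" for h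
  proof -
    have "(\<Sum>i<cut (Suc h). \<delta> i) \<le> (\<Sum>i<l. \<delta> i)"
      using cut_le \<delta>0 by (intro sum_mono2) auto
    also have "\<dots> = (\<Sum>i\<in>{cut j..<cut (Suc j)}. \<delta> i)"
      using \<delta>_out q by (intro sum.mono_neutral_right) auto
    also have "\<dots> \<le> 2 * V" by (rule block)
    finally show ?thesis
      using expect_viol_lipschitz[OF Y(1) Z(1), of m h] by (simp add: \<delta>_def)
  qed
  \<comment> \<open>The lighter levels have total weight at most
    \<open>lw (Suc j) * (5 / 4)\<close>, a quarter of \<open>lw j\<close>, and each suffers at most
    \<open>2 * V\<close> more violation.\<close>
  have pot: "(\<Sum>h\<in>{Suc j..<r}. lw h * expect (\<lambda>u. viol m h (Z u))) \<le>
      (\<Sum>h\<in>{Suc j..<r}. lw h * expect (\<lambda>u. viol m h (Y u))) + lw j * V / 2"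
  proof -
    have "(\<Sum>h\<in>{Suc j..<r}. lw h * expect (\<lambda>u. viol m h (Z u))) \<le>
      (\<Sum>h\<in>{Suc j..<r}. lw h * (expect (\<lambda>u. viol m h (Y u)) + 2 * V))"
      using later lw_pos[THEN less_imp_le] by (intro sum_mono mult_left_mono)
    also have "\<dots> = (\<Sum>h\<in>{Suc j..<r}. lw h * expect (\<lambda>u. viol m h (Y u))) + (\<Sum>h\<in>{Suc j..<r}. lw h) * (2 * V)"
      by (simp only: distrib_left sum.distrib sum_distrib_right)
    also have "(\<Sum>h\<in>{Suc j..<r}. lw h) * (2 * V) \<le> (lw (Suc j) * (5 / 4)) * (2 * V)"
      using lw_tail V0 by (intro mult_right_mono) auto
    also have "\<dots> = lw j * V / 2" by (simp add: lw_def mult_ac)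
    finally show ?thesis by simp
  qed
  have split: "(\<Sum>h\<in>{j..<r}. lw h * expect (\<lambda>u. viol m h (Y u))) =
     lw j * V + (\<Sum>h\<in>{Suc j..<r}. lw h * expect (\<lambda>u. viol m h (Y u)))"
    using Suc.prems by (simp add: sum.atLeast_Suc_lessThan V_def)
  show ?case
  proof (intro exI[of _ Z] conjI allI impI Z(1,2))
    show "expect (\<lambda>u. of_int (Z u i)) = m i" if "i < l" for i using Z(3) Y(3) that by simp
    show "AE u in unit_space. \<forall>h\<le>Suc j. \<lfloor>\<Sum>i<cut h. m i\<rfloor> \<le> (\<Sum>i<cut h. Z u i) \<and> (\<Sum>i<cut h. Z u i) \<le> \<lceil>\<Sum>i<cut h. m i\<rceil>"
      using Y(4) Z(4) Z(5)
    proof eventually_elim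
      case (elim u)
      have "(\<Sum>i<cut h. Z u i) = (\<Sum>i<cut h. Y u i)" if "h \<le> j" for h
        using elim(3) cut_mono[OF that] cut_le[of h] by (intro sum.cong) auto
      then show ?case using elim(1,2) by (auto simp: le_Suc_eq)
    qed
    show "(\<Sum>i<l. lw (lev i) * expect (\<lambda>u. of_int \<bar>Z u i - X u i\<bar>)) +
        4 * (\<Sum>h\<in>{Suc j..<r}. lw h * expect (\<lambda>u. viol m h (Z u)))
      \<le> 4 * (\<Sum>h<r. lw h * expect (\<lambda>u. viol m h (X u)))"
    proof -
      \<comment> \<open>Movement \<open>2 * lw j * V\<close> plus four times the potential increase
        \<open>lw j * V / 2\<close> is exactly the share \<open>4 * lw j * V\<close> that level
        \<open>j\<close> releases.\<close>
      have "a + 4 * p \<le> R" if "a \<le> b + 2 * lw j * V" "p \<le> q + lw j * V / 2" "b + 4 * s \<le> R" "s = lw j * V + q"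
        for a b p q s R :: real
        using that by argo
      from this[OF move pot Y(5) split] show ?thesis .
    qed
  qed
qed

text \<open>The coordinates are moved first, each at an expected cost of exactly the change of its
  mean; only then are the prefix totals repaired. A change in class \<open>i\<close> disturbs the
  totals of all levels from \<open>lev i\<close> on, which the geometric weights sum up to a
  constant. The constant 11 is 1 for the move plus 4 times 5 / 2 for the repair.\<close>

lemma rounding_step:
  assumes X: "simple_rv X"
    and bal: "\<And>u. u \<in> {0..1} \<Longrightarrow> balanced m (X u)"
    and mean: "\<And>i. i < l \<Longrightarrow> expect (\<lambda>u. of_int (X u i)) = m i"
  obtains Y :: "real \<Rightarrow> nat \<Rightarrow> int" where "simple_rv Y"
    "\<And>u. u \<in> {0..1} \<Longrightarrow> balanced m' (Y u)"
    "\<And>i. i < l \<Longrightarrow> expect (\<lambda>u. of_int (Y u i)) = m' i"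
    "(\<Sum>i<l. lw (lev i) * expect (\<lambda>u. of_int \<bar>Y u i - X u i\<bar>)) \<le> 11 * (\<Sum>i<l. lw (lev i) * \<bar>m' i - m i\<bar>)"
proof -
  define shift where "shift i p \<longleftrightarrow> fst p + snd p * m i = m' i \<and>
    (\<forall>a::int. \<lfloor>m i\<rfloor> \<le> a \<and> a \<le> \<lceil>m i\<rceil> \<longrightarrow> \<lfloor>m' i\<rfloor> \<le> fst p + snd p * a \<and> fst p + snd p * a \<le> \<lceil>m' i\<rceil>) \<and>
    ((\<forall>a::int. \<lfloor>m i\<rfloor> \<le> a \<and> a \<le> \<lceil>m i\<rceil> \<longrightarrow> a \<le> fst p + snd p * a) \<or>
     (\<forall>a::int. \<lfloor>m i\<rfloor> \<le> a \<and> a \<le> \<lceil>m i\<rceil> \<longrightarrow> fst p + snd p * a \<le> a))" for i and p :: "real \<times> real"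
  have "\<exists>p. shift i p" for i
  proof (rule affine_shift[of "m i" "m' i"])
    fix \<alpha> \<beta> :: real
    assume "\<alpha> + \<beta> * m i = m' i"
      "\<And>a::int. \<lfloor>m i\<rfloor> \<le> a \<Longrightarrow> a \<le> \<lceil>m i\<rceil> \<Longrightarrow> \<lfloor>m' i\<rfloor> \<le> \<alpha> + \<beta> * a \<and> \<alpha> + \<beta> * a \<le> \<lceil>m' i\<rceil>"
      "(\<forall>a::int. \<lfloor>m i\<rfloor> \<le> a \<and> a \<le> \<lceil>m i\<rceil> \<longrightarrow> a \<le> \<alpha> + \<beta> * a) \<or>
       (\<forall>a::int. \<lfloor>m i\<rfloor> \<le> a \<and> a \<le> \<lceil>m i\<rceil> \<longrightarrow> \<alpha> + \<beta> * a \<le> a)"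
    then have "shift i (\<alpha>, \<beta>)" unfolding shift_def fst_conv snd_conv by blast
    then show ?thesis by blast
  qed
  then obtain p where p: "\<And>i. shift i (p i)" using choice[of shift] by blast
  define \<alpha> where "\<alpha> i = fst (p i)" for i
  define \<beta> where "\<beta> i = snd (p i)" for i
  have ab: "\<And>i. \<alpha> i + \<beta> i * m i = m' i"
    "\<And>i (a::int). \<lfloor>m i\<rfloor> \<le> a \<Longrightarrow> a \<le> \<lceil>m i\<rceil> \<Longrightarrow> \<lfloor>m' i\<rfloor> \<le> \<alpha> i + \<beta> i * a \<and> \<alpha> i + \<beta> i * a \<le> \<lceil>m' i\<rceil>"
    "\<And>i. (\<forall>a::int. \<lfloor>m i\<rfloor> \<le> a \<and> a \<le> \<lceil>m i\<rceil> \<longrightarrow> a \<le> \<alpha> i + \<beta> i * a) \<or>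
     (\<forall>a::int. \<lfloor>m i\<rfloor> \<le> a \<and> a \<le> \<lceil>m i\<rceil> \<longrightarrow> \<alpha> i + \<beta> i * a \<le> a)"
    using p unfolding shift_def \<alpha>_def \<beta>_def by blast+
  define v where "v a i = \<alpha> i + \<beta> i * real_of_int (a i)" for a :: "nat \<Rightarrow> int" and i
  obtain Y :: "real \<Rightarrow> nat \<Rightarrow> int" where Y: "simple_rv Y"
    "\<And>u q. u \<in> {0..1} \<Longrightarrow> q \<le> l \<Longrightarrow> \<lfloor>\<Sum>i<q. v (X u) i\<rfloor> \<le> (\<Sum>i<q. Y u i)"
    "\<And>u q. u \<in> {0..1} \<Longrightarrow> q \<le> l \<Longrightarrow> (\<Sum>i<q. Y u i) \<le> \<lceil>\<Sum>i<q. v (X u) i\<rceil>"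
    "\<And>u i. u \<in> {0..1} \<Longrightarrow> i < l \<Longrightarrow> \<lfloor>v (X u) i\<rfloor> \<le> Y u i"
    "\<And>u i. u \<in> {0..1} \<Longrightarrow> i < l \<Longrightarrow> Y u i \<le> \<lceil>v (X u) i\<rceil>"
    "\<And>h i. i < l \<Longrightarrow> expect (\<lambda>u. h (X u) * of_int (Y u i)) = expect (\<lambda>u. h (X u) * v (X u) i)"
    using randomized_rounding[OF X, of l v] by blast
  have iX: "integrable unit_space (\<lambda>u. g (X u))" for g :: "_ \<Rightarrow> real" by (rule integrable_compose1[OF X])
  have box: "\<lfloor>m i\<rfloor> \<le> X u i" "X u i \<le> \<lceil>m i\<rceil>" if "u \<in> {0..1}" "i < l" for u i
    using bal[OF that(1)] that(2) by (auto simp: balanced_def)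
  have Ev: "expect (\<lambda>u. v (X u) i) = m' i" if "i < l" for i
    using mean[OF that] ab(1)[of i] iX[of "\<lambda>a. of_int (a i)"] by (simp add: v_def)
  have EY: "expect (\<lambda>u. of_int (Y u i)) = m' i" if "i < l" for i
    using Y(6)[OF that, of "\<lambda>_. 1"] Ev[OF that] by simp
  have boxY: "AE u in unit_space. \<forall>i<l. \<lfloor>m' i\<rfloor> \<le> Y u i \<and> Y u i \<le> \<lceil>m' i\<rceil>"
    using AE_space
  proof eventually_elim
    case (elim u)
    show ?case
    proof (intro allI impI)
      fix i assume i: "i < l"
      then have "\<lfloor>m' i\<rfloor> \<le> v (X u) i \<and> v (X u) i \<le> \<lceil>m' i\<rceil>"
        using ab(2)[of i "X u i"] box[of u i] elim by (simp add: v_def)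
      then have "\<lfloor>m' i\<rfloor> \<le> \<lfloor>v (X u) i\<rfloor>" "\<lceil>v (X u) i\<rceil> \<le> \<lceil>m' i\<rceil>" by linarith+
      then show "\<lfloor>m' i\<rfloor> \<le> Y u i \<and> Y u i \<le> \<lceil>m' i\<rceil>" using Y(4,5)[of u i] i elim by simp
    qed
  qed
  have dist: "expect (\<lambda>u. of_int \<bar>Y u i - X u i\<bar>) = \<bar>m' i - m i\<bar>" if i: "i < l" for i
  proof -
    have "expect (\<lambda>u. of_int \<bar>Y u i - X u i\<bar>) = expect (\<lambda>u. \<bar>v (X u) i - of_int (X u i)\<bar>)"
      using Y i by (intro expect_abs_rounding X) auto
    also have "\<dots> = \<bar>m' i - m i\<bar>"
    proof -
      have diff: "expect (\<lambda>u. v (X u) i - of_int (X u i)) = m' i - m i"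
        "expect (\<lambda>u. of_int (X u i) - v (X u) i) = m i - m' i"
        using Ev[OF i] mean[OF i] iX[of "\<lambda>a. v a i"] iX[of "\<lambda>a. of_int (a i)"] by simp_all
      from ab(3)[of i] show ?thesis
      proof
        assume up: "\<forall>a::int. \<lfloor>m i\<rfloor> \<le> a \<and> a \<le> \<lceil>m i\<rceil> \<longrightarrow> a \<le> \<alpha> i + \<beta> i * a"
        have eq: "expect (\<lambda>u. \<bar>v (X u) i - of_int (X u i)\<bar>) = expect (\<lambda>u. v (X u) i - of_int (X u i))"
          using up box[OF _ i] by (intro Bochner_Integration.integral_cong refl) (simp add: v_def)
        have "0 \<le> expect (\<lambda>u. \<bar>v (X u) i - of_int (X u i)\<bar>)" by (intro Bochner_Integration.integral_nonneg) simp
        then show ?thesis using eq diff by simp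
      next
        assume up: "\<forall>a::int. \<lfloor>m i\<rfloor> \<le> a \<and> a \<le> \<lceil>m i\<rceil> \<longrightarrow> \<alpha> i + \<beta> i * a \<le> a"
        have eq: "expect (\<lambda>u. \<bar>v (X u) i - of_int (X u i)\<bar>) = expect (\<lambda>u. of_int (X u i) - v (X u) i)"
          using up box[OF _ i] by (intro Bochner_Integration.integral_cong refl) (simp add: v_def)
        have "0 \<le> expect (\<lambda>u. \<bar>v (X u) i - of_int (X u i)\<bar>)" by (intro Bochner_Integration.integral_nonneg) simp
        then show ?thesis using eq diff by simp
      qed
    qed
    finally show ?thesis .
  qed
  define \<Delta> where "\<Delta> i = \<bar>m' i - m i\<bar>" for i
  \<comment> \<open>The factor 2 has two sources: the target interval moves by at most the sum of
    the changes, and so, in expectation, does the prefix total of the allocation.\<close>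
  have viol_le: "expect (\<lambda>u. viol m' h (Y u)) \<le> 2 * (\<Sum>i<cut (Suc h). \<Delta> i)" if h: "h < r" for h
  proof -
    let ?q = "cut (Suc h)"
    have ql: "?q \<le> l" by (rule cut_le)
    have "expect (\<lambda>u. viol m' h (X u)) \<le> \<bar>(\<Sum>i<?q. m' i) - (\<Sum>i<?q. m i)\<bar>"
    proof (rule expect_violation_le)
      show "simple_rv (\<lambda>u. \<Sum>i<?q. X u i)" by (rule simple_function_compose1[OF X])
      show "\<lfloor>\<Sum>i<?q. m i\<rfloor> \<le> (\<Sum>i<?q. X u i) \<and> (\<Sum>i<?q. X u i) \<le> \<lceil>\<Sum>i<?q. m i\<rceil>" if "u \<in> {0..1}" for u
        using bal[OF that] h by (auto simp: balanced_def)
      have "expect (\<lambda>u. of_int (\<Sum>i<?q. X u i)) = (\<Sum>i<?q. expect (\<lambda>u. of_int (X u i)))"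
        by (simp add: iX[of "\<lambda>y. of_int (y _)"])
      then show "expect (\<lambda>u. of_int (\<Sum>i<?q. X u i)) = (\<Sum>i<?q. m i)" using mean ql by simp
    qed
    also have "\<dots> \<le> (\<Sum>i<?q. \<Delta> i)" unfolding sum_subtractf[symmetric] \<Delta>_def by (rule sum_abs)
    finally have "expect (\<lambda>u. viol m' h (X u)) \<le> (\<Sum>i<?q. \<Delta> i)" .
    moreover have "(\<Sum>i<?q. expect (\<lambda>u. of_int \<bar>Y u i - X u i\<bar>)) = (\<Sum>i<?q. \<Delta> i)"
      using dist ql by (intro sum.cong) (auto simp: \<Delta>_def)
    ultimately show ?thesis using expect_viol_lipschitz[OF X Y(1), of m' h] by linarith
  qed
  define W where "W = (\<Sum>i<l. lw (lev i) * \<Delta> i)"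
  have potential: "(\<Sum>h<r. lw h * expect (\<lambda>u. viol m' h (Y u))) \<le> 5 / 2 * W"
  proof -
    have "(\<Sum>h<r. lw h * expect (\<lambda>u. viol m' h (Y u))) \<le> (\<Sum>h<r. lw h * (2 * (\<Sum>i<cut (Suc h). \<Delta> i)))"
      using viol_le lw_pos[THEN less_imp_le] by (intro sum_mono mult_left_mono) auto
    also have "\<dots> = (\<Sum>h<r. 2 * (\<Sum>i<l. if lev i \<le> h then lw h * \<Delta> i else 0))"
    proof (rule sum.cong[OF refl])
      fix h
      have "(\<Sum>i<cut (Suc h). \<Delta> i) = (\<Sum>i<l. if lev i \<le> h then \<Delta> i else 0)"
      proof (rule sum.mono_neutral_cong_left)
        show "\<forall>i\<in>{..<l} - {..<cut (Suc h)}. (if lev i \<le> h then \<Delta> i else 0) = 0"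
        proof
          fix i assume "i \<in> {..<l} - {..<cut (Suc h)}"
          then have "\<not> lev i \<le> h" using less_cut_iff[of i "Suc h"] by (simp add: less_Suc_eq_le)
          then show "(if lev i \<le> h then \<Delta> i else 0) = 0" by simp
        qed
        show "\<Delta> i = (if lev i \<le> h then \<Delta> i else 0)" if "i \<in> {..<cut (Suc h)}" for i
          using that less_cut_iff[of i "Suc h"] by (simp add: less_Suc_eq_le)
        show "{..<cut (Suc h)} \<subseteq> {..<l}" using cut_le by simp
      qed simp
      moreover have "lw h * (\<Sum>i<l. if lev i \<le> h then \<Delta> i else 0) = (\<Sum>i<l. if lev i \<le> h then lw h * \<Delta> i else 0)"
        unfolding sum_distrib_left by (rule sum.cong) auto
      ultimately show "lw h * (2 * (\<Sum>i<cut (Suc h). \<Delta> i)) = 2 * (\<Sum>i<l. if lev i \<le> h then lw h * \<Delta> i else 0)"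
        by simp
    qed
    also have "\<dots> = 2 * (\<Sum>h<r. \<Sum>i<l. if lev i \<le> h then lw h * \<Delta> i else 0)"
      by (rule sum_distrib_left[symmetric])
    \<comment> \<open>Summed by class, the change in class \<open>i\<close> is charged to the tail
      of levels starting at \<open>lev i\<close>, of total weight at most
      \<open>5 / 4 * lw (lev i)\<close>.\<close>
    also have "(\<Sum>h<r. \<Sum>i<l. if lev i \<le> h then lw h * \<Delta> i else 0) = (\<Sum>i<l. \<Sum>h<r. if lev i \<le> h then lw h * \<Delta> i else 0)"
      by (rule sum.swap)
    also have "\<dots> = (\<Sum>i<l. (\<Sum>h\<in>{lev i..<r}. lw h) * \<Delta> i)"
    proof (intro sum.cong refl)
      fix i
      have "(\<Sum>h<r. if lev i \<le> h then lw h * \<Delta> i else 0) = (\<Sum>h\<in>{lev i..<r}. lw h * \<Delta> i)"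
        by (intro sum.mono_neutral_cong_right) auto
      then show "(\<Sum>h<r. if lev i \<le> h then lw h * \<Delta> i else 0) = (\<Sum>h\<in>{lev i..<r}. lw h) * \<Delta> i"
        by (simp add: sum_distrib_right)
    qed
    also have "\<dots> \<le> (\<Sum>i<l. (lw (lev i) * (5 / 4)) * \<Delta> i)"
      using lw_tail by (intro sum_mono mult_right_mono) (auto simp: \<Delta>_def)
    also have "\<dots> = 5 / 4 * W" by (simp add: W_def sum_distrib_left mult_ac)
    finally show ?thesis by simp
  qed
  obtain Z where Z: "simple_rv Z"
    "AE u in unit_space. \<forall>i<l. \<lfloor>m' i\<rfloor> \<le> Z u i \<and> Z u i \<le> \<lceil>m' i\<rceil>"
    "\<And>i. i < l \<Longrightarrow> expect (\<lambda>u. of_int (Z u i)) = m' i"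
    "AE u in unit_space. \<forall>h\<le>r. \<lfloor>\<Sum>i<cut h. m' i\<rfloor> \<le> (\<Sum>i<cut h. Z u i) \<and> (\<Sum>i<cut h. Z u i) \<le> \<lceil>\<Sum>i<cut h. m' i\<rceil>"
    "(\<Sum>i<l. lw (lev i) * expect (\<lambda>u. of_int \<bar>Z u i - Y u i\<bar>)) \<le> 4 * (\<Sum>h<r. lw h * expect (\<lambda>u. viol m' h (Y u)))"
    using restore_levels[OF Y(1) boxY EY order_refl] by auto
  have balZ: "AE u in unit_space. balanced m' (Z u)"
    using Z(2,4) by eventually_elim (simp add: balanced_def)
  have "\<exists>u\<in>{0..1}. balanced m' (Z u)"
  proof (rule ccontr)
    assume "\<not> ?thesis"
    then have "AE u in unit_space. \<not> balanced m' (Z u)" by (intro AE_I2) simp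
    with balZ have "AE u in unit_space. balanced m' (Z u) \<and> \<not> balanced m' (Z u)" by (rule AE_conjI)
    then have "emeasure unit_space (space unit_space) = 0"
      by (simp add: eventually_False ae_filter_eq_bot_iff)
    then show False by (simp add: emeasure_unit_space)
  qed
  then obtain u0 where u0: "balanced m' (Z u0)" by blast
  \<comment> \<open>Feasibility of the cache is demanded at every seed, so the null set of
    unbalanced outcomes is overwritten by one balanced outcome.\<close>
  define Z' where "Z' u = (if balanced m' (Z u) then Z u else Z u0)" for u
  have Z': "simple_rv Z'"
    unfolding Z'_def using simple_function_compose1[OF Z(1), of "\<lambda>z. if balanced m' z then z else Z u0"] .
  have eq: "AE u in unit_space. Z' u = Z u" using balZ by eventually_elim (simp add: Z'_def)
  have meas: "(\<lambda>u. g (S u) (T u)) \<in> borel_measurable unit_space"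
    if "simple_rv S" "simple_rv T" for g :: "(nat \<Rightarrow> int) \<Rightarrow> (nat \<Rightarrow> int) \<Rightarrow> real" and S T
    using integrable_compose2[OF that] by (rule borel_measurable_integrable)
  show ?thesis
  proof (rule that[OF Z'])
    show "balanced m' (Z' u)" for u using u0 by (simp add: Z'_def)
    show "expect (\<lambda>u. of_int (Z' u i)) = m' i" if "i < l" for i
    proof -
      have "expect (\<lambda>u. of_int (Z' u i)) = expect (\<lambda>u. of_int (Z u i))"
        using eq by (intro integral_cong_AE meas[OF Z' Z', of "\<lambda>x _. of_int (x i)"] meas[OF Z(1) Z(1), of "\<lambda>x _. of_int (x i)"])
          (auto elim!: eventually_mono)
      then show ?thesis using Z(3)[OF that] by simp
    qed
    have tri: "expect (\<lambda>u. of_int \<bar>Z' u i - X u i\<bar>) \<le> expect (\<lambda>u. of_int \<bar>Z u i - Y u i\<bar>) + \<Delta> i" if "i < l" for i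
    proof -
      have i1: "integrable unit_space (\<lambda>u. real_of_int \<bar>Z u i - Y u i\<bar>)"
        "integrable unit_space (\<lambda>u. real_of_int \<bar>Y u i - X u i\<bar>)"
        "integrable unit_space (\<lambda>u. real_of_int \<bar>Z' u i - X u i\<bar>)"
        using integrable_compose2[OF Z(1) Y(1), of "\<lambda>x y. real_of_int \<bar>x i - y i\<bar>"]
          integrable_compose2[OF Y(1) X, of "\<lambda>x y. real_of_int \<bar>x i - y i\<bar>"]
          integrable_compose2[OF Z' X, of "\<lambda>x y. real_of_int \<bar>x i - y i\<bar>"] by auto
      have "expect (\<lambda>u. of_int \<bar>Z' u i - X u i\<bar>) \<le> expect (\<lambda>u. of_int \<bar>Z u i - Y u i\<bar> + of_int \<bar>Y u i - X u i\<bar>)"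
        using eq by (intro integral_mono_AE i1 Bochner_Integration.integrable_add) (auto elim!: eventually_mono)
      also have "\<dots> = expect (\<lambda>u. of_int \<bar>Z u i - Y u i\<bar>) + expect (\<lambda>u. of_int \<bar>Y u i - X u i\<bar>)"
        by (rule Bochner_Integration.integral_add[OF i1(1,2)])
      finally show ?thesis using dist[OF that] by (simp only: \<Delta>_def)
    qed
    have "(\<Sum>i<l. lw (lev i) * expect (\<lambda>u. of_int \<bar>Z' u i - X u i\<bar>)) \<le>
        (\<Sum>i<l. lw (lev i) * (expect (\<lambda>u. of_int \<bar>Z u i - Y u i\<bar>) + \<Delta> i))"
      using tri lw_pos[THEN less_imp_le] by (intro sum_mono mult_left_mono) auto
    also have "\<dots> = (\<Sum>i<l. lw (lev i) * expect (\<lambda>u. of_int \<bar>Z u i - Y u i\<bar>)) + W"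
      by (simp only: distrib_left sum.distrib W_def)
    also have "\<dots> \<le> 4 * (\<Sum>h<r. lw h * expect (\<lambda>u. viol m' h (Y u))) + W"
      using Z(5) by (rule add_right_mono)
    also have "\<dots> \<le> 4 * (5 / 2 * W) + W" using potential by (intro add_right_mono mult_left_mono) auto
    also have "\<dots> = 11 * W" by simp
    finally show "(\<Sum>i<l. lw (lev i) * expect (\<lambda>u. of_int \<bar>Z' u i - X u i\<bar>)) \<le> 11 * (\<Sum>i<l. lw (lev i) * \<bar>m' i - m i\<bar>)"
      by (simp only: W_def \<Delta>_def)
  qed
qed

lemma rounding_start:
  obtains X :: "real \<Rightarrow> nat \<Rightarrow> int" where "simple_rv X"
    "\<And>u. u \<in> {0..1} \<Longrightarrow> balanced m (X u)"
    "\<And>i. i < l \<Longrightarrow> expect (\<lambda>u. of_int (X u i)) = m i"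
proof (rule rounding_step[of "\<lambda>_ _. 0" "\<lambda>_. 0" m])
  show "simple_rv (\<lambda>_ _. 0 :: int)" by simp
  show "balanced (\<lambda>_. 0) (\<lambda>_. 0)" by (simp add: balanced_def)
  show "expect (\<lambda>_. of_int 0) = 0" by simp
qed (use that in blast)

end

section \<open>Belady stacks\<close>

lemma next_req_gt: "enat t < next_req \<sigma> t p"
proof (cases "\<exists>s. t < s \<and> s \<le> length \<sigma> \<and> \<sigma>!(s-1) = p")
  case True
  from LeastI_ex[OF this] have "t < (LEAST s. t < s \<and> s \<le> length \<sigma> \<and> \<sigma>!(s-1) = p)" by blast
  then show ?thesis using True by (simp add: next_req_def)
next
  case False
  then show ?thesis unfolding next_req_def by (simp only: if_False) simp
qed

lemma next_req_step:
  assumes "t < length \<sigma>"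
  shows "next_req \<sigma> t p = (if \<sigma>!t = p then enat (Suc t) else next_req \<sigma> (Suc t) p)"
proof (cases "\<sigma>!t = p")
  case True
  have "(LEAST s. t < s \<and> s \<le> length \<sigma> \<and> \<sigma>!(s-1) = p) = Suc t"
    using True assms by (intro Least_equality) auto
  moreover have "\<exists>s. t < s \<and> s \<le> length \<sigma> \<and> \<sigma>!(s-1) = p"
    using True assms by (intro exI[of _ "Suc t"]) simp
  ultimately show ?thesis using True unfolding next_req_def by presburger
next
  case False
  have "(t < s \<and> s \<le> length \<sigma> \<and> \<sigma>!(s-1) = p) \<longleftrightarrow> (Suc t < s \<and> s \<le> length \<sigma> \<and> \<sigma>!(s-1) = p)" for s
    using False by (cases "s = Suc t") auto
  then have "next_req \<sigma> t p = next_req \<sigma> (Suc t) p" by (simp only: next_req_def)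
  then show ?thesis using False by simp
qed

text \<open>\<open>y\<close> is the page displaced from above. It takes a place unless the occupant
  is needed strictly sooner, and whichever page loses is carried on; the hole left by
  \<open>p\<close>, or the end of the stack, absorbs the last one.\<close>

fun percolate :: "(nat \<Rightarrow> nat \<Rightarrow> bool) \<Rightarrow> nat \<Rightarrow> nat \<Rightarrow> nat list \<Rightarrow> nat list" where
  "percolate R p y [] = [y]"
| "percolate R p y (x # xs) = (if x = p then y # xs
     else if R x y then x # percolate R p y xs else y # percolate R p x xs)"

text \<open>Mattson's priority stack for Belady's rule: the first \<open>n\<close> entries are the cache of size \<open>n\<close>,
  and \<open>R x y\<close> means that \<open>x\<close> is requested before \<open>y\<close>.\<close>

fun stack_update :: "(nat \<Rightarrow> nat \<Rightarrow> bool) \<Rightarrow> nat \<Rightarrow> nat list \<Rightarrow> nat list" where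
  "stack_update R p [] = [p]"
| "stack_update R p (x # xs) = (if x = p then x # xs else p # percolate R p x xs)"

lemma set_percolate: "set (percolate R p y xs) \<subseteq> insert y (set xs)"
  by (induction xs arbitrary: y) auto

lemma distinct_percolate:
  "distinct xs \<Longrightarrow> y \<notin> set xs \<Longrightarrow> y \<noteq> p \<Longrightarrow> distinct (percolate R p y xs) \<and> p \<notin> set (percolate R p y xs)"
proof (induction xs arbitrary: y)
  case (Cons x xs)
  show ?case
    using Cons.prems Cons.IH[of x] Cons.IH[of y] set_percolate[of R p x xs] set_percolate[of R p y xs]
    by auto
qed simp

lemma distinct_stack_update: "distinct xs \<Longrightarrow> distinct (stack_update R p xs)"
  by (cases xs) (auto simp: distinct_percolate)

lemma set_stack_update: "set (stack_update R p xs) \<subseteq> insert p (set xs)"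
proof (cases xs)
  case (Cons x xs')
  then show ?thesis using set_percolate[of R p x xs'] by auto
qed simp

lemma hd_stack_update: "1 \<le> n \<Longrightarrow> p \<in> set (take n (stack_update R p xs))"
  by (cases xs; cases n) auto

text \<open>If \<open>p\<close> is among the first \<open>n\<close> entries, its hole absorbs the
  displaced page before position \<open>n\<close> is passed.\<close>

lemma percolate_hit:
  "distinct xs \<Longrightarrow> y \<notin> set xs \<Longrightarrow> y \<noteq> p \<Longrightarrow> p \<in> set (take n xs) \<Longrightarrow>
    set (take n (percolate R p y xs)) = insert y (set (take n xs)) - {p}"
proof (induction xs arbitrary: y n)
  case (Cons x xs)
  then obtain n' where n: "n = Suc n'" by (cases n) auto
  have px: "p \<notin> set xs" if "x = p" using Cons.prems that by auto
  show ?case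
    using Cons.prems Cons.IH[of x n'] Cons.IH[of y n'] px set_take_subset[of n' xs]
    by (auto simp: n)
qed simp

lemma percolate_miss_short:
  "p \<notin> set xs \<Longrightarrow> length xs < n \<Longrightarrow> set (take n (percolate R p y xs)) = insert y (set xs)"
proof (induction xs arbitrary: y n)
  case Nil
  then show ?case by (cases n) auto
next
  case (Cons x xs)
  then obtain n' where n: "n = Suc n'" by (cases n) auto
  show ?case using Cons.prems Cons.IH[of n' x] Cons.IH[of n' y] by (auto simp: n)
qed

text \<open>A bubble pass with respect to next requests: the page carried past position
  \<open>n\<close> has a latest next request among all pages met so far. Ties are harmless because
  only \<open>\<nu> x \<le> \<nu> e\<close> is claimed.\<close>

lemma percolate_miss:
  fixes \<nu> :: "nat \<Rightarrow> enat"
  assumes "distinct xs" "y \<notin> set xs" "p \<notin> set (take n xs)" "n \<le> length xs"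
    and "\<And>a b. a \<in> insert y (set xs) \<Longrightarrow> b \<in> insert y (set xs) \<Longrightarrow> R a b \<longleftrightarrow> \<nu> a < \<nu> b"
  shows "\<exists>e\<in>insert y (set (take n xs)). set (take n (percolate R p y xs)) = insert y (set (take n xs)) - {e} \<and>
    (\<forall>x\<in>insert y (set (take n xs)). \<nu> x \<le> \<nu> e)"
  using assms
proof (induction n arbitrary: y xs)
  case (Suc n)
  then obtain x xs' where xs: "xs = x # xs'" by (cases xs) auto
  have sub: "set (take n xs') \<subseteq> set xs'" by (rule set_take_subset)
  have xp: "x \<noteq> p" using Suc.prems(3) by (auto simp: xs)
  have Rxy: "R x y \<longleftrightarrow> \<nu> x < \<nu> y" using Suc.prems(5)[of x y] by (simp add: xs)
  show ?case
  proof (cases "R x y")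
    case True
    have "\<exists>e\<in>insert y (set (take n xs')). set (take n (percolate R p y xs')) = insert y (set (take n xs')) - {e} \<and>
      (\<forall>z\<in>insert y (set (take n xs')). \<nu> z \<le> \<nu> e)"
    proof (rule Suc.IH)
      show "R a b \<longleftrightarrow> \<nu> a < \<nu> b" if "a \<in> insert y (set xs')" "b \<in> insert y (set xs')" for a b
        using that by (intro Suc.prems(5)) (auto simp: xs)
    qed (use Suc.prems in \<open>auto simp: xs\<close>)
    then obtain e where e: "e \<in> insert y (set (take n xs'))"
      "set (take n (percolate R p y xs')) = insert y (set (take n xs')) - {e}"
      "\<forall>z\<in>insert y (set (take n xs')). \<nu> z \<le> \<nu> e"
      by blast
    have "e \<noteq> x" using e(1) sub Suc.prems by (auto simp: xs)
    moreover have "\<nu> x \<le> \<nu> e" using True Rxy e(3) by (meson insertI1 order.strict_implies_order order_trans)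
    ultimately show ?thesis using e True xp by (intro bexI[of _ e]) (auto simp: xs)
  next
    case False
    have "\<exists>e\<in>insert x (set (take n xs')). set (take n (percolate R p x xs')) = insert x (set (take n xs')) - {e} \<and>
      (\<forall>z\<in>insert x (set (take n xs')). \<nu> z \<le> \<nu> e)"
    proof (rule Suc.IH)
      show "R a b \<longleftrightarrow> \<nu> a < \<nu> b" if "a \<in> insert x (set xs')" "b \<in> insert x (set xs')" for a b
        using that by (intro Suc.prems(5)) (auto simp: xs)
    qed (use Suc.prems in \<open>auto simp: xs\<close>)
    then obtain e where e: "e \<in> insert x (set (take n xs'))"
      "set (take n (percolate R p x xs')) = insert x (set (take n xs')) - {e}"
      "\<forall>z\<in>insert x (set (take n xs')). \<nu> z \<le> \<nu> e"
      by blast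
    have "e \<noteq> y" using e(1) sub Suc.prems by (auto simp: xs)
    moreover have "\<nu> y \<le> \<nu> e" using False Rxy e(3) by (meson insertI1 not_less order_trans)
    ultimately show ?thesis using e False xp by (intro bexI[of _ e]) (auto simp: xs)
  qed
qed simp

lemma stack_update_hit:
  assumes "distinct xs" "p \<in> set (take n xs)"
  shows "set (take n (stack_update R p xs)) = set (take n xs)"
proof (cases xs)
  case (Cons x xs')
  obtain n' where n: "n = Suc n'" using assms by (cases n) auto
  show ?thesis
  proof (cases "x = p")
    case False
    then have "set (take n' (percolate R p x xs')) = insert x (set (take n' xs')) - {p}"
      using assms by (intro percolate_hit) (auto simp: Cons n)
    then show ?thesis using False assms by (auto simp: Cons n)
  qed (simp add: Cons)
qed (use assms in simp)

text \<open>Belady's rule at every cache size at once, the inclusion property of stack algorithms.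
  In the second case \<open>n \<le> length xs\<close> records that the prefix was full, so that its
  cardinality is \<open>n\<close>; the potential argument relies on this.\<close>

lemma stack_update_miss:
  fixes \<nu> :: "nat \<Rightarrow> enat"
  assumes "distinct xs" "1 \<le> n" "p \<notin> set (take n xs)"
    and R: "\<And>a b. a \<in> set xs \<Longrightarrow> b \<in> set xs \<Longrightarrow> R a b \<longleftrightarrow> \<nu> a < \<nu> b"
  shows "set (take n (stack_update R p xs)) = insert p (set (take n xs)) \<or>
    (n \<le> length xs \<and> (\<exists>e\<in>set (take n xs). set (take n (stack_update R p xs)) = insert p (set (take n xs) - {e}) \<and>
      (\<forall>x\<in>set (take n xs). \<nu> x \<le> \<nu> e)))"
proof (cases xs)
  case Nil
  then show ?thesis using assms by simp
next
  case (Cons x xs')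
  obtain n' where n: "n = Suc n'" using assms by (cases n) auto
  have xp: "x \<noteq> p" "p \<notin> set (take n' xs')" using assms by (auto simp: Cons n)
  show ?thesis
  proof (cases "n' \<le> length xs'")
    case False
    then have "set (take n' (percolate R p x xs')) = insert x (set xs')"
      using xp by (intro percolate_miss_short) auto
    then show ?thesis using xp False by (auto simp: Cons n)
  next
    case True
    have "\<exists>e\<in>insert x (set (take n' xs')). set (take n' (percolate R p x xs')) = insert x (set (take n' xs')) - {e} \<and>
      (\<forall>z\<in>insert x (set (take n' xs')). \<nu> z \<le> \<nu> e)"
    proof (rule percolate_miss)
      show "R a b \<longleftrightarrow> \<nu> a < \<nu> b" if "a \<in> insert x (set xs')" "b \<in> insert x (set xs')" for a b
        using that by (intro R) (auto simp: Cons)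
    qed (use assms(1) xp True in \<open>auto simp: Cons\<close>)
    then obtain e where e: "e \<in> insert x (set (take n' xs'))"
      "set (take n' (percolate R p x xs')) = insert x (set (take n' xs')) - {e}"
      "\<forall>z\<in>insert x (set (take n' xs')). \<nu> z \<le> \<nu> e"
      by blast
    show ?thesis
      by (rule disjI2, rule conjI, use True in \<open>simp add: Cons n\<close>, rule bexI[of _ e])
        (use e xp in \<open>auto simp: Cons n\<close>)
  qed
qed

text \<open>The page \<open>\<sigma>!t\<close> is requested at time \<open>Suc t\<close>, and the
  update compares the requests after that time, which is what the view at \<open>Suc t\<close>
  reveals. The stack evolves independently of any allocation of slots.\<close>

primrec class_stack :: "(nat \<Rightarrow> real) \<Rightarrow> nat list \<Rightarrow> real \<Rightarrow> nat \<Rightarrow> nat list" where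
  "class_stack wt \<sigma> c 0 = []"
| "class_stack wt \<sigma> c (Suc t) = (if wt (\<sigma>!t) = c
     then stack_update (snd (wimp_view wt \<sigma> (Suc t))) (\<sigma>!t) (class_stack wt \<sigma> c t)
     else class_stack wt \<sigma> c t)"

lemma distinct_class_stack: "distinct (class_stack wt \<sigma> c t)"
  by (induction t) (auto simp: distinct_stack_update)

lemma set_class_stack: "set (class_stack wt \<sigma> c t) \<subseteq> {p. wt p = c}"
proof (induction t)
  case (Suc t)
  then show ?case
    using set_stack_update[of "snd (wimp_view wt \<sigma> (Suc t))" "\<sigma>!t" "class_stack wt \<sigma> c t"] by auto
qed simp

text \<open>A potential with a deadline: for every \<open>\<theta>\<close> at once, the lag of the
  stack behind another cache in pages due by then is bounded by loads and lost slots minus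
  faults.\<close>

definition requested_by :: "nat list \<Rightarrow> nat \<Rightarrow> nat \<Rightarrow> nat set \<Rightarrow> nat" where
  "requested_by \<sigma> t \<theta> S = card {x \<in> S. next_req \<sigma> t x \<le> enat \<theta>}"

lemma requested_by_mono: "finite T \<Longrightarrow> S \<subseteq> T \<Longrightarrow> requested_by \<sigma> t \<theta> S \<le> requested_by \<sigma> t \<theta> T"
  unfolding requested_by_def by (intro card_mono) auto

lemma requested_by_le_card: "finite S \<Longrightarrow> requested_by \<sigma> t \<theta> S \<le> card S"
  unfolding requested_by_def by (intro card_mono) auto

lemma requested_by_Un: "finite S \<Longrightarrow> finite T \<Longrightarrow> requested_by \<sigma> t \<theta> (S \<union> T) \<le> requested_by \<sigma> t \<theta> S + card T"
proof -
  assume fin: "finite S" "finite T"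
  have "{x \<in> S \<union> T. next_req \<sigma> t x \<le> enat \<theta>} \<subseteq> {x \<in> S. next_req \<sigma> t x \<le> enat \<theta>} \<union> T" by auto
  then have "requested_by \<sigma> t \<theta> (S \<union> T) \<le> card ({x \<in> S. next_req \<sigma> t x \<le> enat \<theta>} \<union> T)"
    unfolding requested_by_def using fin by (intro card_mono) auto
  also have "\<dots> \<le> requested_by \<sigma> t \<theta> S + card T" unfolding requested_by_def by (rule card_Un_le)
  finally show ?thesis .
qed

lemma requested_by_insert:
  "finite S \<Longrightarrow> p \<notin> S \<Longrightarrow> requested_by \<sigma> t \<theta> (insert p S) = requested_by \<sigma> t \<theta> S + (if next_req \<sigma> t p \<le> enat \<theta> then 1 else 0)"
proof -
  assume "finite S" "p \<notin> S"
  moreover have "{x \<in> insert p S. next_req \<sigma> t x \<le> enat \<theta>} =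
    (if next_req \<sigma> t p \<le> enat \<theta> then insert p {x \<in> S. next_req \<sigma> t x \<le> enat \<theta>} else {x \<in> S. next_req \<sigma> t x \<le> enat \<theta>})"
    by auto
  ultimately show ?thesis by (simp add: requested_by_def)
qed

lemma requested_by_step:
  assumes "t < length \<sigma>" "\<sigma>!t \<notin> S"
  shows "requested_by \<sigma> (Suc t) \<theta> S = requested_by \<sigma> t \<theta> S"
proof -
  have "{x \<in> S. next_req \<sigma> (Suc t) x \<le> enat \<theta>} = {x \<in> S. next_req \<sigma> t x \<le> enat \<theta>}"
    using assms by (auto simp: next_req_step)
  then show ?thesis by (simp add: requested_by_def)
qed

lemma requested_by_now: "requested_by \<sigma> t t S = 0"
  using next_req_gt[of t \<sigma>] by (simp add: requested_by_def not_le[symmetric])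

lemma requested_by_split:
  assumes "t < length \<sigma>" "Suc t \<le> \<theta>" "finite S"
  shows "requested_by \<sigma> t \<theta> S = requested_by \<sigma> (Suc t) \<theta> (S - {\<sigma>!t}) + (if \<sigma>!t \<in> S then 1 else 0)"
proof (cases "\<sigma>!t \<in> S")
  case True
  have "next_req \<sigma> t (\<sigma>!t) \<le> enat \<theta>" using assms by (simp add: next_req_step)
  then show ?thesis
    using requested_by_insert[of "S - {\<sigma>!t}" "\<sigma>!t" \<sigma> t \<theta>] requested_by_step[of t \<sigma> "S - {\<sigma>!t}" \<theta>] assms True
    by (simp add: insert_absorb)
next
  case False
  then show ?thesis using requested_by_step[OF assms(1) False] by simp
qed

lemma feasible_request: "feasible_caches k \<sigma> C \<Longrightarrow> t < length \<sigma> \<Longrightarrow> \<sigma>!t \<in> C (Suc t)"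
  unfolding feasible_caches_def by (drule conjunct2, drule spec[of _ "Suc t"]) simp

lemma feasible_finite: "feasible_caches k \<sigma> C \<Longrightarrow> t \<le> length \<sigma> \<Longrightarrow> finite (C t)"
  unfolding feasible_caches_def by (cases "t = 0") simp_all

text \<open>The classical potential argument for Belady's rule, made robust against a cache size \<open>n\<close> that varies
  over time: a change of size may leave the stack cache without its farthest page, which costs one unit of
  potential per lost slot.\<close>

lemma class_faults_potential:
  assumes feas: "feasible_caches k \<sigma> C"
    and n: "\<And>t. t \<le> length \<sigma> \<Longrightarrow> card (C t \<inter> {p. wt p = c}) \<le> n t"
    and "t \<le> length \<sigma>" "t \<le> \<theta>"
  shows "(\<Sum>s<t. if wt (\<sigma>!s) = c \<and> \<sigma>!s \<notin> set (take (n (Suc s)) (class_stack wt \<sigma> c s)) then 1 else 0) +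
      requested_by \<sigma> t \<theta> (C t \<inter> {p. wt p = c})
    \<le> (\<Sum>s<t. card ((C (Suc s) - C s) \<inter> {p. wt p = c}) + (n s - n (Suc s))) +
      requested_by \<sigma> t \<theta> (set (take (n t) (class_stack wt \<sigma> c t)))"
  using assms(3,4)
\<comment> \<open>The deadline must vary: the critical case applies the induction hypothesis to
  \<open>Suc t\<close> in place of \<open>\<theta>\<close>.\<close>
proof (induction t arbitrary: \<theta>)
  case 0
  then show ?case using feas by (simp add: feasible_caches_def requested_by_def)
next
  case (Suc t)
  let ?K = "{p. wt p = c}"
  let ?L = "class_stack wt \<sigma> c t"
  let ?p = "\<sigma>!t"
  define F where "F = (\<Sum>s<t. if wt (\<sigma>!s) = c \<and> \<sigma>!s \<notin> set (take (n (Suc s)) (class_stack wt \<sigma> c s)) then 1 else 0 :: nat)"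
  define G where "G = (\<Sum>s<t. card ((C (Suc s) - C s) \<inter> ?K) + (n s - n (Suc s)))"
  define sh where "sh = n t - n (Suc t)"
  define A where "A = C t \<inter> ?K"
  define A' where "A' = C (Suc t) \<inter> ?K"
  define New where "New = (C (Suc t) - C t) \<inter> ?K"
  define B where "B = set (take (n (Suc t)) ?L)"
  define B' where "B' = set (take (n (Suc t)) (class_stack wt \<sigma> c (Suc t)))"
  have t: "t < length \<sigma>" using Suc.prems by simp
  have fin: "finite (C t)" "finite (C (Suc t))" using feasible_finite[OF feas] t by simp_all
  have finA: "finite A" "finite A'" "finite New" "finite B" "finite B'"
    using fin by (auto simp: A_def A'_def New_def B_def B'_def)
  \<comment> \<open>A shrinking cache loses the tail of its prefix, at most \<open>sh\<close> pages;
    when it grows, the truncated difference \<open>sh\<close> is 0.\<close>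
  have IH: "F + requested_by \<sigma> t \<theta> A \<le> G + sh + requested_by \<sigma> t \<theta> B" if "t \<le> \<theta>" for \<theta>
  proof -
    have "set (take (n t) ?L) = set (take (n (Suc t)) (take (n t) ?L)) \<union> set (drop (n (Suc t)) (take (n t) ?L))"
      unfolding set_append[symmetric] append_take_drop_id ..
    moreover have "set (take (n (Suc t)) (take (n t) ?L)) \<subseteq> B"
      unfolding B_def take_take by (rule set_take_subset_set_take) simp
    ultimately have "set (take (n t) ?L) \<subseteq> B \<union> set (drop (n (Suc t)) (take (n t) ?L))" by blast
    moreover have "card (set (drop (n (Suc t)) (take (n t) ?L))) \<le> sh"
      using card_length[of "drop (n (Suc t)) (take (n t) ?L)"] by (simp add: sh_def)
    moreover have "requested_by \<sigma> t \<theta> (B \<union> set (drop (n (Suc t)) (take (n t) ?L))) \<le>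
        requested_by \<sigma> t \<theta> B + card (set (drop (n (Suc t)) (take (n t) ?L)))"
      using finA by (intro requested_by_Un) auto
    ultimately have "requested_by \<sigma> t \<theta> (set (take (n t) ?L)) \<le> requested_by \<sigma> t \<theta> B + sh"
      using requested_by_mono[of "B \<union> set (drop (n (Suc t)) (take (n t) ?L))" "set (take (n t) ?L)" \<sigma> t \<theta>] finA
      by simp
    then show ?thesis
      using Suc.IH[OF _ that] t by (simp add: F_def G_def A_def)
  qed
  have A'_sub: "A' \<subseteq> A \<union> New" by (auto simp: A_def A'_def New_def)
  have goal: "F + (if wt ?p = c \<and> ?p \<notin> B then 1 else 0) + requested_by \<sigma> (Suc t) \<theta> A' \<le>
      G + card New + sh + requested_by \<sigma> (Suc t) \<theta> B'"
  proof (cases "wt ?p = c")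
    case False
    have notin: "?p \<notin> A" "?p \<notin> A'" "?p \<notin> B"
      using False set_class_stack[of wt \<sigma> c t] set_take_subset[of "n (Suc t)" ?L] by (auto simp: A_def A'_def B_def)
    have "B' = B" using False by (simp add: B_def B'_def)
    moreover have "requested_by \<sigma> t \<theta> A' \<le> requested_by \<sigma> t \<theta> A + card New"
      using requested_by_mono[OF _ A'_sub, of \<sigma> t \<theta>] requested_by_Un[of A New \<sigma> t \<theta>] finA by simp
    ultimately show ?thesis
      using IH[of \<theta>] Suc.prems requested_by_step[OF t notin(2), of \<theta>] requested_by_step[OF t notin(3), of \<theta>] False
      by simp
  next
    case True
    \<comment> \<open>The requested page is taken out of both counts: it is in both caches after the
      step, so its contribution \<open>z\<close> cancels.\<close>
    define \<rho> where "\<rho> S = requested_by \<sigma> (Suc t) \<theta> (S - {?p})" for S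
    define z where "z = (if next_req \<sigma> (Suc t) ?p \<le> enat \<theta> then 1 else 0 :: nat)"
    have pA': "?p \<in> A'" using feasible_request[OF feas t] True by (simp add: A'_def)
    have \<rho>: "requested_by \<sigma> (Suc t) \<theta> S = \<rho> S + z" if "?p \<in> S" "finite S" for S
      using requested_by_insert[of "S - {?p}" ?p \<sigma> "Suc t" \<theta>] that by (simp add: \<rho>_def z_def insert_absorb)
    have cardA': "card A' \<le> n (Suc t)" using n[of "Suc t"] t by (simp add: A'_def)
    then have n1: "1 \<le> n (Suc t)" using pA' finA by (metis card_gt_0_iff empty_iff less_one not_less order_trans)
    have old: "F + \<rho> A + (if ?p \<in> A then 1 else 0) \<le> G + sh + \<rho> B + (if ?p \<in> B then 1 else 0)"
      using IH[of \<theta>] Suc.prems requested_by_split[OF t, of \<theta> A] requested_by_split[OF t, of \<theta> B] finA by (simp add: \<rho>_def)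
    \<comment> \<open>The requested page is worth one unit, either to \<open>A\<close> in
      \<open>old\<close> or as a load here; adding \<open>old\<close> and \<open>new\<close>
      therefore pays for a fault of the stack.\<close>
    have new: "\<rho> A' + (if ?p \<in> A then 0 else 1) \<le> \<rho> A + card New"
    proof (cases "?p \<in> A")
      case True
      have "\<rho> A' \<le> requested_by \<sigma> (Suc t) \<theta> ((A - {?p}) \<union> New)"
        unfolding \<rho>_def using A'_sub finA by (intro requested_by_mono) auto
      then show ?thesis using requested_by_Un[of "A - {?p}" New \<sigma> "Suc t" \<theta>] finA True by (simp add: \<rho>_def)
    next
      case False
      then have "?p \<in> New" using pA' by (auto simp: A_def A'_def New_def)
      then have "card (New - {?p}) + 1 = card New" using card_Suc_Diff1[OF finA(3), of ?p] by simp
      moreover have "\<rho> A' \<le> requested_by \<sigma> (Suc t) \<theta> ((A - {?p}) \<union> (New - {?p}))"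
        unfolding \<rho>_def using A'_sub finA by (intro requested_by_mono) auto
      ultimately show ?thesis
        using requested_by_Un[of "A - {?p}" "New - {?p}" \<sigma> "Suc t" \<theta>] finA False by (simp add: \<rho>_def)
    qed
    have B'_eq: "B' = set (take (n (Suc t)) (stack_update (snd (wimp_view wt \<sigma> (Suc t))) ?p ?L))"
      using True by (simp add: B'_def)
    have pB': "?p \<in> B'" unfolding B'_eq by (rule hd_stack_update[OF n1])
    show ?thesis
    proof (cases "?p \<in> B")
      case hit: True
      have "B' = B" unfolding B'_eq B_def using hit by (intro stack_update_hit distinct_class_stack) (simp add: B_def)
      then show ?thesis using old new \<rho>[OF pA'] \<rho>[OF hit] finA hit by (auto split: if_splits)
    next
      case miss: False
      have R: "snd (wimp_view wt \<sigma> (Suc t)) a b \<longleftrightarrow> next_req \<sigma> (Suc t) a < next_req \<sigma> (Suc t) b"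
        if "a \<in> set ?L" "b \<in> set ?L" for a b
        using that set_class_stack[of wt \<sigma> c t] by (auto simp: wimp_view_def)
      consider "B' = insert ?p B" | e where "n (Suc t) \<le> length ?L" "e \<in> B" "B' = insert ?p (B - {e})"
          "\<And>x. x \<in> B \<Longrightarrow> next_req \<sigma> (Suc t) x \<le> next_req \<sigma> (Suc t) e"
        using stack_update_miss[of ?L "n (Suc t)" ?p "snd (wimp_view wt \<sigma> (Suc t))" "next_req \<sigma> (Suc t)"]
          distinct_class_stack n1 miss R unfolding B'_eq B_def by blast
      then show ?thesis
      proof cases
        case 1
        then have "\<rho> B' = \<rho> B" using miss by (simp add: \<rho>_def)
        then show ?thesis using old new \<rho>[OF pA'] \<rho>[OF pB'] finA miss by (auto split: if_splits)
      next
        case 2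
        show ?thesis
        proof (cases "next_req \<sigma> (Suc t) e \<le> enat \<theta>")
          case False
          have "\<rho> B' = \<rho> B"
          proof -
            have "{x \<in> B - {e} - {?p}. next_req \<sigma> (Suc t) x \<le> enat \<theta>} = {x \<in> B - {?p}. next_req \<sigma> (Suc t) x \<le> enat \<theta>}"
              using False by auto
            moreover have "B' - {?p} = B - {e} - {?p}" using 2(3) by auto
            ultimately show ?thesis by (simp add: \<rho>_def requested_by_def)
          qed
          then show ?thesis using old new \<rho>[OF pA'] \<rho>[OF pB'] finA miss by (auto split: if_splits)
        next
          case le: True
          \<comment> \<open>The evicted page is due by \<open>\<theta>\<close>, hence so is all of
            the full cache \<open>B\<close>. The count for the stack then has its maximum
            \<open>n (Suc t) - 1\<close>, which no competitor exceeds. Only the faults remain to be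
            paid, by the hypothesis at deadline \<open>Suc t\<close>, where nothing but the
            requested page counts.\<close>
          have "card B = n (Suc t)"
            unfolding B_def using 2(1) distinct_class_stack[of wt \<sigma> c t] by (simp add: distinct_card)
          moreover have "\<rho> B' = card (B - {e})"
          proof -
            have "B' - {?p} = B - {e}" using 2(3) miss by auto
            moreover have "{x \<in> B - {e}. next_req \<sigma> (Suc t) x \<le> enat \<theta>} = B - {e}" using 2(4) le order_trans by blast
            ultimately show ?thesis by (simp add: \<rho>_def requested_by_def)
          qed
          ultimately have B'card: "\<rho> B' = n (Suc t) - 1" using 2(2) finA by simp
          have A'card: "\<rho> A' \<le> n (Suc t) - 1"
            using requested_by_le_card[of "A' - {?p}" \<sigma> "Suc t" \<theta>] cardA' pA' finA by (simp add: \<rho>_def)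
          have "F + (if ?p \<in> A then 1 else 0) \<le> G + sh"
            using IH[of "Suc t"] requested_by_split[OF t order_refl, of A] requested_by_split[OF t order_refl, of B] finA miss
            by (simp add: requested_by_now)
          moreover have "(if ?p \<in> A then 0 else 1) \<le> card New"
          proof (cases "?p \<in> A")
            case False
            then have "?p \<in> New" using pA' by (auto simp: A_def A'_def New_def)
            then have "0 < card New" using finA card_gt_0_iff by blast
            then show ?thesis by simp
          qed simp
          ultimately show ?thesis
            using \<rho>[OF pA'] \<rho>[OF pB'] finA B'card A'card miss by (auto split: if_splits)
        qed
      qed
    qed
  qed
  show ?case using goal by (simp add: F_def G_def sh_def A'_def B_def B'_def New_def del: class_stack.simps)
qed

text \<open>At time and deadline \<open>length \<sigma>\<close> no page is due, so both potentials
  vanish.\<close>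

lemma class_faults:
  assumes feas: "feasible_caches k \<sigma> C"
    and n: "\<And>t. t \<le> length \<sigma> \<Longrightarrow> card (C t \<inter> {p. wt p = c}) \<le> n t"
  shows "(\<Sum>s<length \<sigma>. if wt (\<sigma>!s) = c \<and> \<sigma>!s \<notin> set (take (n (Suc s)) (class_stack wt \<sigma> c s)) then 1 else 0)
    \<le> (\<Sum>s<length \<sigma>. card ((C (Suc s) - C s) \<inter> {p. wt p = c}) + (n s - n (Suc s)))"
  using class_faults_potential[OF feas, of wt c n "length \<sigma>" "length \<sigma>"] n by (simp add: requested_by_now)

section \<open>The reduction\<close>

text \<open>After time \<open>s\<close> the page \<open>\<sigma>!s\<close> comes next and all others
  are ordered as after time \<open>Suc s\<close>, so the present view contains all past views. A
  WIMP algorithm, whose argument is the current view only, can therefore replay its own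
  history.\<close>

lemma wimp_view_pred:
  assumes "Suc s \<le> length \<sigma>" "Suc s \<le> length \<sigma>'" "wimp_view wt \<sigma> (Suc s) = wimp_view wt \<sigma>' (Suc s)"
  shows "wimp_view wt \<sigma> s = wimp_view wt \<sigma>' s" "\<sigma>!s = \<sigma>'!s"
proof -
  have tk: "take (Suc s) \<sigma> = take (Suc s) \<sigma>'" using assms(3) by (simp add: wimp_view_def)
  then have "take s (take (Suc s) \<sigma>) = take s (take (Suc s) \<sigma>')" by (simp only:)
  then have tk': "take s \<sigma> = take s \<sigma>'" by (simp add: min_def)
  have "take (Suc s) \<sigma> ! s = take (Suc s) \<sigma>' ! s" using tk by (simp only:)
  then show hd: "\<sigma>!s = \<sigma>'!s" by simp
  have ord: "(wt p = wt q \<and> next_req \<sigma> (Suc s) p < next_req \<sigma> (Suc s) q) \<longleftrightarrow>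
    (wt p = wt q \<and> next_req \<sigma>' (Suc s) p < next_req \<sigma>' (Suc s) q)" for p q
    using assms(3) unfolding wimp_view_def prod.inject by meson
  have "(wt p = wt q \<and> next_req \<sigma> s p < next_req \<sigma> s q) \<longleftrightarrow>
    (wt p = wt q \<and> next_req \<sigma>' s p < next_req \<sigma>' s q)" for p q
  proof -
    have s: "s < length \<sigma>" "s < length \<sigma>'" using assms by auto
    have gt: "enat (Suc s) < next_req \<tau> (Suc s) x" for \<tau> x by (rule next_req_gt)
    have ngt: "\<not> next_req \<tau> (Suc s) x < enat (Suc s)" for \<tau> x using gt[of \<tau> x] order_less_trans[of "next_req \<tau> (Suc s) x"] by blast
    have hd': "(\<sigma>!s = x) = (\<sigma>'!s = x)" for x using hd by simp
    show ?thesis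
    proof (cases "\<sigma>!s = p"; cases "\<sigma>!s = q")
      assume "\<sigma>!s \<noteq> p" "\<sigma>!s \<noteq> q"
      then show ?thesis
        unfolding next_req_step[OF s(1)] next_req_step[OF s(2)] hd'[symmetric] by (simp only: if_False ord)
    qed (simp_all add: next_req_step[OF s(1)] next_req_step[OF s(2)] hd'[symmetric] gt ngt)
  qed
  then show "wimp_view wt \<sigma> s = wimp_view wt \<sigma>' s"
    unfolding wimp_view_def prod.inject using tk' by (intro conjI ext)
qed

lemma wimp_view_prefix:
  assumes "t \<le> length \<sigma>" "t \<le> length \<sigma>'" "wimp_view wt \<sigma> t = wimp_view wt \<sigma>' t" "s \<le> t"
  shows "wimp_view wt \<sigma> s = wimp_view wt \<sigma>' s"
  using assms(4)
proof (induction s rule: inc_induct)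
  case (step s)
  show ?case by (rule wimp_view_pred(1)) (use step assms(1,2) in auto)
qed (rule assms(3))

lemma wimp_view_nth:
  assumes "t \<le> length \<sigma>" "t \<le> length \<sigma>'" "wimp_view wt \<sigma> t = wimp_view wt \<sigma>' t" "s < t"
  shows "\<sigma>!s = \<sigma>'!s"
  by (rule wimp_view_pred(2)[where wt = wt]) (use wimp_view_prefix[OF assms(1-3), of "Suc s"] assms in auto)

lemma class_stack_cong:
  assumes "t \<le> length \<sigma>" "t \<le> length \<sigma>'" "wimp_view wt \<sigma> t = wimp_view wt \<sigma>' t" "s \<le> t"
  shows "class_stack wt \<sigma> c s = class_stack wt \<sigma>' c s"
  using assms(4)
proof (induction s)
  case (Suc s)
  then show ?case
    using wimp_view_prefix[OF assms(1-3), of "Suc s"] wimp_view_nth[OF assms(1-3), of s] by simp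
qed simp

text \<open>The rounded weights never undercut the true ones, so the online cost can be bounded in
  rounded weights; they exceed the true ones at most fivefold, which is charged to the offline
  side.\<close>

locale wimp_reduction = level_weights l r lev s0 for l r lev s0 +
  fixes wt :: "nat \<Rightarrow> real" and k :: nat and v :: "nat \<Rightarrow> real" and cls :: "nat \<Rightarrow> nat" and A :: sa_alg
  assumes k: "1 \<le> k" and l: "1 \<le> l"
    and v_pos: "i < l \<Longrightarrow> 0 < v i"
    and cls_less: "cls p < l"
    and cls_iff: "i < l \<Longrightarrow> wt p = v i \<longleftrightarrow> cls p = i"
    and lw_ge: "i < l \<Longrightarrow> v i \<le> lw (lev i)"
    and lw_le: "i < l \<Longrightarrow> lw (lev i) \<le> 5 * v i"
begin

abbreviation W :: "nat \<Rightarrow> real" where "W i \<equiv> lw (lev i)"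

lemma wt_eq: "wt p = v (cls p)" using cls_iff[OF cls_less] by blast

text \<open>Coordinate \<open>y\<close> of the simplex stands for \<open>k * y\<close> cache slots. The value infinity below one slot
  keeps a slot of the requested class available, as feasibility of the cache demands.\<close>

definition request :: "nat list \<Rightarrow> nat \<Rightarrow> sa_request" where
  "request \<sigma> t = (cls (\<sigma>!t), \<lambda>y. if real k * y < 1 then \<infinity>
     else if \<sigma>!t \<in> set (take (nat \<lfloor>real k * y\<rfloor>) (class_stack wt \<sigma> (wt (\<sigma>!t)) t)) then 0
     else ereal (W (cls (\<sigma>!t))))"

definition requests :: "nat list \<Rightarrow> nat \<Rightarrow> sa_request list" where
  "requests \<sigma> t = map (request \<sigma>) [0..<t]"

definition alloc :: "nat list \<Rightarrow> nat \<Rightarrow> nat \<Rightarrow> real" where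
  "alloc \<sigma> t i = real k * A (requests \<sigma> t) i"

definition good_start :: "(nat \<Rightarrow> real) \<Rightarrow> (real \<Rightarrow> nat \<Rightarrow> int) \<Rightarrow> bool" where
  "good_start m X \<longleftrightarrow> simple_rv X \<and> (\<forall>u\<in>{0..1}. balanced m (X u)) \<and>
     (\<forall>i<l. expect (\<lambda>u. of_int (X u i)) = m i)"

text \<open>The movement is measured under the coupling by the seed: both allocations are functions
  of the same \<open>u\<close>.\<close>

definition good_step :: "(nat \<Rightarrow> real) \<Rightarrow> (nat \<Rightarrow> real) \<Rightarrow> (real \<Rightarrow> nat \<Rightarrow> int) \<Rightarrow> (real \<Rightarrow> nat \<Rightarrow> int) \<Rightarrow> bool" where
  "good_step m m' X Y \<longleftrightarrow> good_start m' Y \<and>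
     (\<Sum>i<l. W i * expect (\<lambda>u. of_int \<bar>Y u i - X u i\<bar>)) \<le> 11 * (\<Sum>i<l. W i * \<bar>m' i - m i\<bar>)"

text \<open>The choice at time \<open>Suc t\<close> involves \<open>m\<close> only up to
  \<open>Suc t\<close>, which makes the rounding online.\<close>

primrec rounded :: "(nat \<Rightarrow> nat \<Rightarrow> real) \<Rightarrow> nat \<Rightarrow> real \<Rightarrow> nat \<Rightarrow> int" where
  "rounded m 0 = (SOME X. good_start (m 0) X)"
| "rounded m (Suc t) = (SOME Y. good_step (m t) (m (Suc t)) (rounded m t) Y)"

definition cache :: "real \<Rightarrow> nat list \<Rightarrow> nat \<Rightarrow> nat set" where
  "cache u \<sigma> t = (\<Union>i<l. set (take (nat (rounded (alloc \<sigma>) t u i)) (class_stack wt \<sigma> (v i) t)))"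

text \<open>Any representative of the view may be chosen, since the cache depends on the view only.\<close>

definition alg :: "real \<Rightarrow> wimp_alg" where
  "alg u info = (let x = (SOME x. snd x \<le> length (fst x) \<and> wimp_view wt (fst x) (snd x) = info)
     in cache u (fst x) (snd x))"

lemma rounded_good: "good_start (m t) (rounded m t)" "good_step (m t) (m (Suc t)) (rounded m t) (rounded m (Suc t))"
proof -
  have start: "\<exists>X. good_start m X" for m
    using rounding_start[of m] unfolding good_start_def by metis
  have step: "\<exists>Y. good_step m m' X Y" if "good_start m X" for m m' X
  proof -
    from that have *: "simple_rv X" "\<And>u. u \<in> {0..1} \<Longrightarrow> balanced m (X u)"
      "\<And>i. i < l \<Longrightarrow> expect (\<lambda>u. of_int (X u i)) = m i" by (auto simp: good_start_def)
    obtain Y :: "real \<Rightarrow> nat \<Rightarrow> int" where "simple_rv Y"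
      "\<And>u. u \<in> {0..1} \<Longrightarrow> balanced m' (Y u)"
      "\<And>i. i < l \<Longrightarrow> expect (\<lambda>u. of_int (Y u i)) = m' i"
      "(\<Sum>i<l. W i * expect (\<lambda>u. of_int \<bar>Y u i - X u i\<bar>)) \<le> 11 * (\<Sum>i<l. W i * \<bar>m' i - m i\<bar>)"
      using rounding_step[of X m m', OF *] by blast
    then have "good_step m m' X Y" by (auto simp: good_step_def good_start_def)
    then show ?thesis by blast
  qed
  show st: "good_start (m t) (rounded m t)" for t
  proof (induction t)
    case 0
    show ?case using someI_ex[OF start[of "m 0"]] by simp
  next
    case (Suc t)
    have "good_step (m t) (m (Suc t)) (rounded m t) (rounded m (Suc t))"
      using someI_ex[OF step[OF Suc]] by simp
    then show ?case by (simp only: good_step_def)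
  qed
  show "good_step (m t) (m (Suc t)) (rounded m t) (rounded m (Suc t))"
    using someI_ex[OF step[OF st]] by simp
qed

lemma rounded_cong: "(\<And>s. s \<le> t \<Longrightarrow> m s = m' s) \<Longrightarrow> rounded m t = rounded m' t"
  by (induction t) simp_all

declare rounded.simps(2) [simp del]

text \<open>Stacks and requests, hence the allocation and its rounding, are computed from the
  history that the view determines; this is the online property.\<close>

lemma cache_cong:
  assumes "t \<le> length \<sigma>" "t \<le> length \<sigma>'" "wimp_view wt \<sigma> t = wimp_view wt \<sigma>' t"
  shows "cache u \<sigma> t = cache u \<sigma>' t"
proof -
  have "request \<sigma> s = request \<sigma>' s" if "s < t" for s
    unfolding request_def wimp_view_nth[OF assms that] class_stack_cong[OF assms less_imp_le[OF that]] ..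
  then have "requests \<sigma> s = requests \<sigma>' s" if "s \<le> t" for s
    using that by (simp add: requests_def)
  then have "alloc \<sigma> s = alloc \<sigma>' s" if "s \<le> t" for s using that by (simp add: alloc_def fun_eq_iff)
  then have "rounded (alloc \<sigma>) t = rounded (alloc \<sigma>') t" by (rule rounded_cong)
  then show ?thesis
    using class_stack_cong[OF assms order_refl] by (simp add: cache_def)
qed

lemma alg_view:
  assumes t: "t \<le> length \<sigma>"
  shows "alg u (wimp_view wt \<sigma> t) = cache u \<sigma> t"
proof -
  define x where "x = (SOME x. snd x \<le> length (fst x) \<and> wimp_view wt (fst x) (snd x) = wimp_view wt \<sigma> t)"
  have x: "snd x \<le> length (fst x)" "wimp_view wt (fst x) (snd x) = wimp_view wt \<sigma> t"
    unfolding x_def using someI[of "\<lambda>x. snd x \<le> length (fst x) \<and> wimp_view wt (fst x) (snd x) = wimp_view wt \<sigma> t" "(\<sigma>, t)"] t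
    by auto
  \<comment> \<open>The length of the revealed prefix identifies the time, so the representative is
    compared with \<open>\<sigma>\<close> at the same \<open>t\<close>.\<close>
  have "length (take (snd x) (fst x)) = length (take t \<sigma>)" using x(2) by (simp add: wimp_view_def)
  then have "snd x = t" using x(1) t by simp
  then show ?thesis
    using cache_cong[of t "fst x" \<sigma>] x t by (simp add: alg_def x_def[symmetric] Let_def)
qed

lemma wimp_caches_alg: "t \<le> length \<sigma> \<Longrightarrow> wimp_caches (alg u) wt \<sigma> t = cache u \<sigma> t"
  by (auto simp: wimp_caches_def alg_view) (simp add: cache_def)

text \<open>More slots mean a longer prefix of the same stack, so the cost can only drop.\<close>

lemma valid_request: "valid_sa_request l (request \<sigma> t)"
proof -
  have "snd (request \<sigma> t) z \<le> snd (request \<sigma> t) y" if "0 \<le> y" "y \<le> z" for y z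
  proof -
    have "real k * y \<le> real k * z" using that by (intro mult_left_mono) auto
    then have "nat \<lfloor>real k * y\<rfloor> \<le> nat \<lfloor>real k * z\<rfloor>" by (intro nat_mono floor_mono)
    then have "set (take (nat \<lfloor>real k * y\<rfloor>) (class_stack wt \<sigma> (wt (\<sigma>!t)) t)) \<subseteq>
      set (take (nat \<lfloor>real k * z\<rfloor>) (class_stack wt \<sigma> (wt (\<sigma>!t)) t))" by (rule set_take_subset_set_take)
    then show ?thesis
      using \<open>real k * y \<le> real k * z\<close> lw_pos[of "lev (cls (\<sigma>!t))"] by (auto simp: request_def)
  qed
  moreover have "0 \<le> snd (request \<sigma> t) y" for y
    using lw_pos[of "lev (cls (\<sigma>!t))"] by (simp add: request_def)
  moreover have "fst (request \<sigma> t) < l" using cls_less by (simp add: request_def)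
  ultimately show ?thesis unfolding valid_sa_request_def by blast
qed

lemma valid_requests: "list_all (valid_sa_request l) (requests \<sigma> t)"
  using valid_request by (simp add: requests_def list_all_iff)

lemma take_requests: "t \<le> T \<Longrightarrow> take t (requests \<sigma> T) = requests \<sigma> t"
  by (simp add: requests_def take_map)

lemma requests_nth: "t < T \<Longrightarrow> requests \<sigma> T ! t = request \<sigma> t" "length (requests \<sigma> T) = T"
  by (simp_all add: requests_def)

section \<open>From offline caches to allocations\<close>

lemma sum_classes:
  fixes h :: "nat \<Rightarrow> real"
  assumes "finite S"
  shows "(\<Sum>i<l. \<Sum>p\<in>S \<inter> {p. wt p = v i}. h p) = (\<Sum>p\<in>S. h p)"
proof -
  have "(\<Sum>i<l. \<Sum>p\<in>S \<inter> {p. wt p = v i}. h p) = (\<Sum>i<l. \<Sum>p | p \<in> S \<and> cls p = i. h p)"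
    by (intro sum.cong) (auto simp: cls_iff)
  also have "\<dots> = (\<Sum>p\<in>S. h p)" using assms cls_less by (intro sum.group) auto
  finally show ?thesis .
qed

lemma sum_weights_classes:
  assumes "finite S"
  shows "(\<Sum>p\<in>S. wt p) = (\<Sum>i<l. v i * real (card (S \<inter> {p. wt p = v i})))"
  unfolding sum_classes[OF assms, symmetric] by (intro sum.cong) auto

lemma W_last_le: "i < l \<Longrightarrow> W (l - 1) \<le> W i"
  using lev_mono[of i "l - 1"] l s0_pos by (simp add: lw_def divide_left_mono)

lemma sa_opt_le:
  assumes feas: "feasible_caches k \<sigma> C" and A0: "A [] \<in> sa_simplex l"
  shows "sa_opt l (\<lambda>i. real k * W i) (requests \<sigma> (length \<sigma>)) (A []) \<le>
    ereal ((\<Sum>i<l. real k * W i) + 45 * (\<Sum>t<length \<sigma>. \<Sum>p\<in>C (Suc t) - C t. wt p))"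
proof -
  define T where "T = length \<sigma>"
  define K where "K i = {p. wt p = v i}" for i
  define ld where "ld t i = real (card ((C (Suc t) - C t) \<inter> K i))" for t i
  define ev where "ev t i = real (card ((C t - C (Suc t)) \<inter> K i))" for t i
  \<comment> \<open>The free slots keep the sum at \<open>k\<close>, as the simplex requires; the
    truncated subtraction is exact since the cache holds at most \<open>k\<close> pages.\<close>
  define n where "n t i = card (C t \<inter> K i) + (if i = l - 1 then k - card (C t) else 0)" for t i
  define d where "d t i = \<bar>real (n (Suc t) i) - real (n t i)\<bar>" for t i
  define y where "y t = (if t = 0 then A [] else (\<lambda>i. if i < l then real (n t i) / real k else 0))" for t
  define Ld where "Ld = (\<Sum>t<T. \<Sum>i<l. W i * ld t i)"
  define b0 where "b0 = (\<Sum>i<l. real k * W i)"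
  have W0: "0 \<le> W i" for i by (rule less_imp_le[OF lw_pos])
  have k0: "0 < real k" using k by simp
  have fin: "finite (C t)" if "t \<le> T" for t using feasible_finite[OF feas] that by (simp add: T_def)
  have cardC: "card (C t) \<le> k" if "t \<le> T" for t
    using feas that by (cases "t = 0") (simp_all add: feasible_caches_def T_def)
  have sumC: "(\<Sum>i<l. real (card (C t \<inter> K i))) = real (card (C t))" if "t \<le> T" for t
    using sum_classes[OF fin[OF that], of "\<lambda>_. 1"] by (simp add: K_def)
  have n_sum: "(\<Sum>i<l. real (n t i)) = real k" if "t \<le> T" for t
  proof -
    have "(\<Sum>i<l. real (n t i)) = real (card (C t)) + (\<Sum>i<l. if i = l - 1 then real (k - card (C t)) else 0)"
      unfolding sumC[OF that, symmetric] sum.distrib[symmetric] n_def by (intro sum.cong) auto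
    then show ?thesis using l cardC[OF that] by (simp add: of_nat_diff)
  qed
  have n_le: "real (n t i) \<le> real k" if "t \<le> T" "i < l" for t i
    using member_le_sum[of i "{..<l}" "\<lambda>i. real (n t i)"] n_sum[OF that(1)] that(2) by simp
  have y_simplex: "y t \<in> sa_simplex l" if "t \<le> T" for t
  proof (cases "t = 0")
    case False
    have "(\<Sum>i<l. real (n t i) / real k) = 1"
      using n_sum[OF that] k0 by (simp add: sum_divide_distrib[symmetric])
    then show ?thesis
      using False n_le[OF that] k0 by (simp add: y_def sa_simplex_def)
  qed (simp add: y_def A0)
  have delta: "real (card (C (Suc t) \<inter> K i)) - real (card (C t \<inter> K i)) = ld t i - ev t i" if "t < T" for t i
  proof -
    have f: "finite (C t)" "finite (C (Suc t))" using fin that by auto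
    have "card (C (Suc t) \<inter> K i) = card ((C (Suc t) - C t) \<inter> K i) + card (C (Suc t) \<inter> C t \<inter> K i)"
      using f by (subst card_Un_disjoint[symmetric]) (auto intro: arg_cong[of _ _ card])
    moreover have "card (C t \<inter> K i) = card ((C t - C (Suc t)) \<inter> K i) + card (C (Suc t) \<inter> C t \<inter> K i)"
      using f by (subst card_Un_disjoint[symmetric]) (auto intro: arg_cong[of _ _ card])
    ultimately show ?thesis by (simp add: ld_def ev_def)
  qed
  have nonneg: "0 \<le> ld t i" "0 \<le> ev t i" for t i by (simp_all add: ld_def ev_def)
  have d_other: "d t i \<le> ld t i + ev t i" if "t < T" "i \<noteq> l - 1" for t i
    using delta[OF that(1), of i] that(2) nonneg[of t i] by (simp add: d_def n_def)
  \<comment> \<open>The sum of all \<open>n t i\<close> is constant, so the lightest class changes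
    by no more than all others together.\<close>
  have d_last: "d t (l - 1) \<le> (\<Sum>i<l. ld t i + ev t i)" if t: "t < T" for t
  proof -
    have split: "(\<Sum>i<l. g i) = (\<Sum>i\<in>{..<l} - {l - 1}. g i) + g (l - 1)" for g :: "nat \<Rightarrow> real"
      using l by (subst sum.remove[of _ "l - 1"]) auto
    have "real (n (Suc t) (l - 1)) - real (n t (l - 1)) = (\<Sum>i\<in>{..<l} - {l - 1}. real (n t i) - real (n (Suc t) i))"
      using n_sum[of t] n_sum[of "Suc t"] t split[of "\<lambda>i. real (n t i)"] split[of "\<lambda>i. real (n (Suc t) i)"]
      by (simp add: sum_subtractf)
    then have "d t (l - 1) = \<bar>\<Sum>i\<in>{..<l} - {l - 1}. real (n t i) - real (n (Suc t) i)\<bar>" by (simp add: d_def)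
    also have "\<dots> \<le> (\<Sum>i\<in>{..<l} - {l - 1}. \<bar>real (n t i) - real (n (Suc t) i)\<bar>)" by (rule sum_abs)
    also have "\<dots> = (\<Sum>i\<in>{..<l} - {l - 1}. d t i)" by (simp add: d_def abs_minus_commute)
    also have "\<dots> \<le> (\<Sum>i\<in>{..<l} - {l - 1}. ld t i + ev t i)" using d_other[OF t] by (intro sum_mono) auto
    also have "\<dots> \<le> (\<Sum>i<l. ld t i + ev t i)" using nonneg by (intro sum_mono2) (auto intro: add_nonneg_nonneg)
    finally show ?thesis .
  qed
  have move: "(\<Sum>i<l. W i * d t i) \<le> 2 * (\<Sum>i<l. W i * (ld t i + ev t i))" if t: "t < T" for t
  proof -
    have "(\<Sum>i<l. W i * d t i) = (\<Sum>i\<in>{..<l} - {l - 1}. W i * d t i) + W (l - 1) * d t (l - 1)"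
      using l by (subst sum.remove[of _ "l - 1"]) auto
    also have "(\<Sum>i\<in>{..<l} - {l - 1}. W i * d t i) \<le> (\<Sum>i\<in>{..<l} - {l - 1}. W i * (ld t i + ev t i))"
      using d_other[OF t] W0 by (intro sum_mono mult_left_mono) auto
    also have "\<dots> \<le> (\<Sum>i<l. W i * (ld t i + ev t i))"
      using nonneg W0 by (intro sum_mono2) (auto intro!: mult_nonneg_nonneg add_nonneg_nonneg)
    also have "W (l - 1) * d t (l - 1) \<le> W (l - 1) * (\<Sum>i<l. ld t i + ev t i)"
      using d_last[OF t] W0 by (intro mult_left_mono)
    also have "\<dots> \<le> (\<Sum>i<l. W i * (ld t i + ev t i))"
      unfolding sum_distrib_left using W_last_le nonneg by (intro sum_mono mult_right_mono) (auto intro: add_nonneg_nonneg)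
    finally show ?thesis by simp
  qed
  \<comment> \<open>Every evicted page was loaded before, as the cache starts empty.\<close>
  have evict: "(\<Sum>t<T. ev t i) \<le> (\<Sum>t<T. ld t i)" for i
  proof -
    have "(\<Sum>t<T. ld t i - ev t i) = (\<Sum>t<T. real (card (C (Suc t) \<inter> K i)) - real (card (C t \<inter> K i)))"
      using delta by (intro sum.cong) auto
    also have "\<dots> = real (card (C T \<inter> K i)) - real (card (C 0 \<inter> K i))"
      using sum_lessThan_telescope[of "\<lambda>t. real (card (C t \<inter> K i))" T] by simp
    also have "\<dots> \<ge> 0" using feas by (simp add: feasible_caches_def)
    finally show ?thesis by (simp add: sum_subtractf)
  qed
  \<comment> \<open>A factor 2 for the compensating change in the lightest class and a factor 2 for
    evictions.\<close>
  have moves: "(\<Sum>t<T. \<Sum>i<l. W i * d t i) \<le> 4 * Ld"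
  proof -
    have "(\<Sum>t<T. \<Sum>i<l. W i * ev t i) = (\<Sum>i<l. W i * (\<Sum>t<T. ev t i))"
      by (subst sum.swap) (simp add: sum_distrib_left)
    also have "\<dots> \<le> (\<Sum>i<l. W i * (\<Sum>t<T. ld t i))" by (intro sum_mono mult_left_mono evict W0)
    also have "\<dots> = Ld" unfolding Ld_def by (subst sum.swap) (simp add: sum_distrib_left)
    finally have ev_Ld: "(\<Sum>t<T. \<Sum>i<l. W i * ev t i) \<le> Ld" .
    have "(\<Sum>t<T. \<Sum>i<l. W i * d t i) \<le> (\<Sum>t<T. 2 * (\<Sum>i<l. W i * (ld t i + ev t i)))"
      using move by (intro sum_mono) auto
    also have "\<dots> = 2 * (Ld + (\<Sum>t<T. \<Sum>i<l. W i * ev t i))"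
      by (simp only: distrib_left sum.distrib Ld_def sum_distrib_left[symmetric])
    also have "\<dots> \<le> 4 * Ld" using ev_Ld by simp
    finally show ?thesis .
  qed
  define miss where "miss t i = (if wt (\<sigma>!t) = v i \<and> \<sigma>!t \<notin> set (take (n (Suc t) i) (class_stack wt \<sigma> (v i) t)) then 1 else 0 :: real)" for t i
  \<comment> \<open>Belady's rule with the varying size \<open>n t i\<close>: the lost slots are
    part of \<open>d t i\<close>.\<close>
  have faults: "(\<Sum>t<T. miss t i) \<le> (\<Sum>t<T. ld t i + d t i)" for i
  proof -
    have "(\<Sum>s<length \<sigma>. if wt (\<sigma>!s) = v i \<and> \<sigma>!s \<notin> set (take (n (Suc s) i) (class_stack wt \<sigma> (v i) s)) then 1 else 0)
      \<le> (\<Sum>s<length \<sigma>. card ((C (Suc s) - C s) \<inter> {p. wt p = v i}) + (n s i - n (Suc s) i))"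
      by (rule class_faults[OF feas]) (simp add: n_def K_def)
    then have "real (\<Sum>s<T. if wt (\<sigma>!s) = v i \<and> \<sigma>!s \<notin> set (take (n (Suc s) i) (class_stack wt \<sigma> (v i) s)) then 1 else 0)
      \<le> real (\<Sum>s<T. card ((C (Suc s) - C s) \<inter> K i) + (n s i - n (Suc s) i))"
      unfolding T_def K_def of_nat_le_iff .
    also have "\<dots> \<le> (\<Sum>t<T. ld t i + d t i)"
      unfolding of_nat_sum by (intro sum_mono) (simp add: ld_def d_def)
    finally show ?thesis unfolding miss_def of_nat_sum by (simp add: if_distrib cong: if_cong)
  qed
  have missed: "(\<Sum>t<T. \<Sum>i<l. W i * miss t i) \<le> Ld + 4 * Ld"
  proof -
    have "(\<Sum>t<T. \<Sum>i<l. W i * miss t i) = (\<Sum>i<l. W i * (\<Sum>t<T. miss t i))"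
      by (subst sum.swap) (simp add: sum_distrib_left)
    also have "\<dots> \<le> (\<Sum>i<l. W i * (\<Sum>t<T. ld t i + d t i))" by (intro sum_mono mult_left_mono faults W0)
    also have "\<dots> = (\<Sum>t<T. \<Sum>i<l. W i * (ld t i + d t i))" unfolding sum_distrib_left by (rule sum.swap)
    also have "\<dots> = Ld + (\<Sum>t<T. \<Sum>i<l. W i * d t i)" by (simp only: distrib_left sum.distrib Ld_def)
    finally show ?thesis using moves by simp
  qed
  have step: "ereal (\<Sum>i<l. real k * W i * \<bar>y (Suc t) i - y t i\<bar>) + snd (request \<sigma> t) (y (Suc t) (fst (request \<sigma> t))) \<le>
      ereal ((\<Sum>i<l. W i * d t i) + (if t = 0 then b0 else 0) + (\<Sum>i<l. W i * miss t i))" if t: "t < T" for t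
  proof -
    have mv: "(\<Sum>i<l. real k * W i * \<bar>y (Suc t) i - y t i\<bar>) \<le> (\<Sum>i<l. W i * d t i) + (if t = 0 then b0 else 0)"
    proof -
      have "real k * W i * \<bar>y (Suc t) i - y t i\<bar> \<le> W i * d t i + (if t = 0 then real k * W i else 0)" if i: "i < l" for i
      proof -
        have yS: "real k * y (Suc t) i = real (n (Suc t) i)" using i k0 by (simp add: y_def)
        have "real k * \<bar>y (Suc t) i - y t i\<bar> = \<bar>real k * y (Suc t) i - real k * y t i\<bar>"
          using k0 by (simp add: right_diff_distrib[symmetric] abs_mult)
        also have "\<dots> \<le> d t i + (if t = 0 then real k else 0)"
        \<comment> \<open>The first move starts at \<open>A []\<close>, at most \<open>k\<close>
          slots away from \<open>n 0\<close> in each class; this is the source of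
          \<open>b0\<close>.\<close>
        proof (cases "t = 0")
          case True
          have "0 \<le> A [] i" "A [] i \<le> 1" using A0 i by (auto simp: sa_simplex_def)
          then have "0 \<le> real k * A [] i" "real k * A [] i \<le> real k * 1" using k0 by (simp_all del: mult_1_right)
          moreover have "real (n 0 i) \<le> real k" using n_le[of 0 i] i by simp
          ultimately have "\<bar>real (n 0 i) - real k * A [] i\<bar> \<le> real k" by simp
          then show ?thesis using yS True by (simp add: d_def y_def)
        next
          case False
          then have "real k * y t i = real (n t i)" using i k0 by (simp add: y_def)
          then show ?thesis using yS False by (simp add: d_def)
        qed
        finally have "W i * (real k * \<bar>y (Suc t) i - y t i\<bar>) \<le> W i * (d t i + (if t = 0 then real k else 0))"
          using W0 by (intro mult_left_mono)
        then show ?thesis by (simp add: distrib_left mult_ac split: if_splits)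
      qed
      then have "(\<Sum>i<l. real k * W i * \<bar>y (Suc t) i - y t i\<bar>) \<le> (\<Sum>i<l. W i * d t i + (if t = 0 then real k * W i else 0))"
        by (intro sum_mono) auto
      also have "\<dots> = (\<Sum>i<l. W i * d t i) + (if t = 0 then b0 else 0)"
        by (simp add: sum.distrib b0_def)
      finally show ?thesis .
    qed
    define r where "r = cls (\<sigma>!t)"
    have r: "r < l" "wt (\<sigma>!t) = v r" using cls_less wt_eq by (simp_all add: r_def)
    have yr: "real k * y (Suc t) r = real (n (Suc t) r)" using r k0 by (simp add: y_def)
    \<comment> \<open>A feasible cache holds the requested page, so its class has a slot and the
      request is never charged infinity.\<close>
    have "\<sigma>!t \<in> C (Suc t) \<inter> K r" using feasible_request[OF feas] t r by (simp add: K_def T_def)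
    then have "0 < card (C (Suc t) \<inter> K r)" using fin[of "Suc t"] t card_gt_0_iff by fastforce
    then have n1: "1 \<le> n (Suc t) r" by (simp add: n_def)
    have "(\<Sum>i<l. W i * miss t i) = (\<Sum>i\<in>{r}. W i * miss t i)"
      using r by (intro sum.mono_neutral_right) (auto simp: miss_def cls_iff r_def)
    then have "snd (request \<sigma> t) (y (Suc t) (fst (request \<sigma> t))) = ereal (\<Sum>i<l. W i * miss t i)"
      using yr n1 r by (simp add: request_def r_def[symmetric] miss_def)
    then show ?thesis using mv by simp
  qed
  have "sa_opt l (\<lambda>i. real k * W i) (requests \<sigma> T) (A []) \<le> sa_cost l (\<lambda>i. real k * W i) (requests \<sigma> T) y"
    unfolding sa_opt_def
  proof (rule Inf_lower, rule CollectI, intro exI[of _ y] conjI allI impI refl)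
    show "y 0 = A []" by (simp add: y_def)
    show "y t \<in> sa_simplex l" if "t \<le> length (requests \<sigma> T)" for t
      using y_simplex that by (simp add: requests_def)
  qed
  also have "\<dots> \<le> (\<Sum>t<T. ereal ((\<Sum>i<l. W i * d t i) + (if t = 0 then b0 else 0) + (\<Sum>i<l. W i * miss t i)))"
    unfolding sa_cost_def requests_nth(2) using step by (intro sum_mono) (simp add: requests_nth)
  also have "\<dots> = ereal ((\<Sum>t<T. \<Sum>i<l. W i * d t i) + (\<Sum>t<T. if t = 0 then b0 else 0) + (\<Sum>t<T. \<Sum>i<l. W i * miss t i))"
    by (simp only: sum_ereal sum.distrib)
  also have "\<dots> \<le> ereal (b0 + 45 * (\<Sum>t<T. \<Sum>p\<in>C (Suc t) - C t. wt p))"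
  proof -
    have b0: "0 \<le> b0" using W0 by (auto simp: b0_def intro!: sum_nonneg)
    have "(\<Sum>t<T. if t = 0 then b0 else 0) \<le> b0" using b0 by (simp add: sum.delta)
    moreover have "Ld \<le> 5 * (\<Sum>t<T. \<Sum>p\<in>C (Suc t) - C t. wt p)"
    proof -
      have "Ld \<le> (\<Sum>t<T. \<Sum>i<l. 5 * v i * ld t i)"
        unfolding Ld_def using lw_le nonneg by (intro sum_mono mult_right_mono) auto
      also have "\<dots> = (\<Sum>t<T. 5 * (\<Sum>p\<in>C (Suc t) - C t. wt p))"
        using fin by (intro sum.cong refl) (simp add: sum_weights_classes sum_distrib_left ld_def K_def mult_ac)
      finally show ?thesis by (simp add: sum_distrib_left)
    qed
    ultimately show ?thesis using moves missed by simp
  qed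
  finally show ?thesis by (simp only: T_def b0_def)
qed

end

text \<open>The infimum over cache sequences is approached within \<open>e'\<close>; the denominator
  \<open>a + 1\<close> covers \<open>a = 0\<close>.\<close>

lemma ennreal_affine_le_Inf:
  fixes S :: "ennreal set"
  assumes "S \<noteq> {}" "\<And>x. x \<in> S \<Longrightarrow> x < top" "0 \<le> a"
    and le: "\<And>x. x \<in> S \<Longrightarrow> I \<le> ennreal a * x + b"
  shows "I \<le> ennreal a * Inf S + b"
proof (rule ennreal_le_epsilon)
  fix e :: real assume e: "0 < e"
  define e' where "e' = e / (a + 1)"
  have e': "0 < e'" using e assms(3) by (simp add: e'_def)
  have "Inf S < top" using assms(1,2) Inf_lower le_less_trans by blast
  then obtain s where s: "0 \<le> s" "Inf S = ennreal s" by (cases "Inf S") auto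
  have "Inf S < Inf S + ennreal e'"
    using s e' by (simp add: ennreal_plus[symmetric] ennreal_less_iff del: ennreal_plus)
  then obtain x where x: "x \<in> S" "x < Inf S + ennreal e'" using Inf_less_iff by blast
  have "a * e' \<le> e" using e assms(3) by (simp add: e'_def field_simps)
  have "I \<le> ennreal a * x + b" by (rule le[OF x(1)])
  also have "\<dots> \<le> ennreal a * (Inf S + ennreal e') + b"
    using x(2) by (intro add_right_mono mult_left_mono) auto
  also have "\<dots> = ennreal a * Inf S + b + ennreal (a * e')"
    using assms(3) e' by (simp add: distrib_left ennreal_mult add_ac)
  also have "\<dots> \<le> ennreal a * Inf S + b + ennreal e"
    using \<open>a * e' \<le> e\<close> by (intro add_left_mono ennreal_leI)
  finally show "I \<le> ennreal a * Inf S + b + ennreal e" .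
qed

lemma card_take_diff: "card (set (take a xs) - set (take b xs)) \<le> a - b"
proof -
  have "set (take a xs) - set (take b xs) \<subseteq> set (drop b (take a xs))"
  proof
    fix x assume x: "x \<in> set (take a xs) - set (take b xs)"
    have "set (take a xs) = set (take b (take a xs)) \<union> set (drop b (take a xs))"
      unfolding set_append[symmetric] append_take_drop_id ..
    moreover have "set (take b (take a xs)) \<subseteq> set (take b xs)"
      unfolding take_take by (rule set_take_subset_set_take) simp
    ultimately show "x \<in> set (drop b (take a xs))" using x by blast
  qed
  then have "card (set (take a xs) - set (take b xs)) \<le> card (set (drop b (take a xs)))" by (intro card_mono) auto
  also have "\<dots> \<le> length (drop b (take a xs))" by (rule card_length)
  also have "\<dots> \<le> a - b" by simp
  finally show ?thesis .
qed

section \<open>From the online allocation to the randomized cache\<close>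

context wimp_reduction
begin

text \<open>The finite branches of the revealed cost function at the fractional allocation; it is
  the cost actually paid once a full slot is known to be present.\<close>

definition fault :: "nat list \<Rightarrow> nat \<Rightarrow> real" where
  "fault \<sigma> t = (if \<sigma>!t \<in> set (take (nat \<lfloor>alloc \<sigma> (Suc t) (cls (\<sigma>!t))\<rfloor>) (class_stack wt \<sigma> (wt (\<sigma>!t)) t)) then 0
     else W (cls (\<sigma>!t)))"

lemma W_nonneg: "0 \<le> W i" by (rule less_imp_le[OF lw_pos])

lemma fault_nonneg: "0 \<le> fault \<sigma> t" by (simp add: fault_def W_nonneg)

lemma finite_cache: "finite (cache u \<sigma> t)" by (simp add: cache_def)

text \<open>Rounding never goes below the floor, so a hit for the fractional cost function is a hit
  in the integral outcome. Integral faults are thus paid for by the allocation algorithm, and apart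
  from the requested page new pages enter only through additional slots.\<close>

lemma cache_step_weight:
  assumes slot: "1 \<le> alloc \<sigma> (Suc t) (cls (\<sigma>!t))"
    and X: "\<lfloor>alloc \<sigma> (Suc t) (cls (\<sigma>!t))\<rfloor> \<le> rounded (alloc \<sigma>) (Suc t) u (cls (\<sigma>!t))"
  shows "(\<Sum>p\<in>cache u \<sigma> (Suc t) - cache u \<sigma> t. wt p) \<le>
    (\<Sum>i<l. W i * of_int \<bar>rounded (alloc \<sigma>) (Suc t) u i - rounded (alloc \<sigma>) t u i\<bar>) + fault \<sigma> t"
proof -
  define x where "x i = nat (rounded (alloc \<sigma>) t u i)" for i
  define x' where "x' i = nat (rounded (alloc \<sigma>) (Suc t) u i)" for i
  define L where "L i = class_stack wt \<sigma> (v i) t" for i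
  define L' where "L' i = class_stack wt \<sigma> (v i) (Suc t)" for i
  define N where "N i = set (take (x' i) (L' i)) - set (take (x i) (L i))" for i
  define S where "S = cache u \<sigma> (Suc t) - cache u \<sigma> t"
  let ?p = "\<sigma>!t"
  define r where "r = cls ?p"
  have r: "r < l" "wt ?p = v r" using cls_less wt_eq by (simp_all add: r_def)
  have finS: "finite S" by (simp add: S_def finite_cache)
  have sub: "S \<inter> {p. wt p = v i} \<subseteq> N i" if i: "i < l" for i
  proof
    fix p assume p: "p \<in> S \<inter> {p. wt p = v i}"
    then obtain j where j: "j < l" "p \<in> set (take (x' j) (L' j))"
      by (auto simp: S_def cache_def x'_def L'_def)
    have "wt p = v j"
      using j(2) set_take_subset[of "x' j" "L' j"] set_class_stack[of wt \<sigma> "v j" "Suc t"] unfolding L'_def by blast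
    then have "j = i" using p cls_iff[OF j(1), of p] cls_iff[OF i, of p] by simp
    moreover have "p \<notin> set (take (x i) (L i))" using p i by (auto simp: S_def cache_def x_def L_def)
    ultimately show "p \<in> N i" using j(2) by (simp add: N_def)
  qed
  have cardN: "W i * real (card (N i)) \<le>
      W i * of_int \<bar>rounded (alloc \<sigma>) (Suc t) u i - rounded (alloc \<sigma>) t u i\<bar> + (if i = r then fault \<sigma> t else 0)"
    if i: "i < l" for i
  proof -
    have diff: "real (card (set (take (x' i) (L i)) - set (take (x i) (L i)))) \<le>
        of_int \<bar>rounded (alloc \<sigma>) (Suc t) u i - rounded (alloc \<sigma>) t u i\<bar>"
      using card_take_diff[of "x' i" "L i" "x i"] by (simp add: x_def x'_def)
    show ?thesis
    proof (cases "i = r")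
      case False
      then have "wt ?p \<noteq> v i" using cls_iff[OF i, of ?p] by (simp add: r_def)
      then have "L' i = L i" by (simp add: L_def L'_def)
      then show ?thesis using diff False by (simp add: N_def mult_left_mono[OF _ W_nonneg])
    next
      case True
      have upd: "L' i = stack_update (snd (wimp_view wt \<sigma> (Suc t))) ?p (L i)"
        using r True by (simp add: L_def L'_def)
      have dist: "distinct (L i)" by (simp add: L_def distinct_class_stack)
      show ?thesis
      proof (cases "?p \<in> set (take (x' i) (L i))")
        case hit: True
        then have "set (take (x' i) (L' i)) = set (take (x' i) (L i))"
          unfolding upd by (intro stack_update_hit dist)
        then have "W i * real (card (N i)) \<le> W i * of_int \<bar>rounded (alloc \<sigma>) (Suc t) u i - rounded (alloc \<sigma>) t u i\<bar>"
          using diff by (simp add: N_def mult_left_mono[OF _ W_nonneg])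
        then show ?thesis using fault_nonneg[of \<sigma> t] True by simp
      next
        case miss: False
        have "nat \<lfloor>alloc \<sigma> (Suc t) r\<rfloor> \<le> x' r" using X by (simp add: x'_def r_def)
        then have "set (take (nat \<lfloor>alloc \<sigma> (Suc t) r\<rfloor>) (L r)) \<subseteq> set (take (x' r) (L r))"
          by (rule set_take_subset_set_take)
        then have fault: "fault \<sigma> t = W i" using miss True r by (auto simp: fault_def r_def[symmetric] L_def)
        have "1 \<le> \<lfloor>alloc \<sigma> (Suc t) r\<rfloor>" using slot by (simp add: r_def)
        then have "1 \<le> rounded (alloc \<sigma>) (Suc t) u i" using X unfolding r_def True by linarith
        then have "1 \<le> x' i" unfolding x'_def by linarith
        moreover have "snd (wimp_view wt \<sigma> (Suc t)) a b \<longleftrightarrow> next_req \<sigma> (Suc t) a < next_req \<sigma> (Suc t) b"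
          if "a \<in> set (L i)" "b \<in> set (L i)" for a b
        proof -
          have "wt a = v i" "wt b = v i" using that set_class_stack[of wt \<sigma> "v i" t] unfolding L_def by blast+
          then show ?thesis by (simp add: wimp_view_def)
        qed
        ultimately have "set (take (x' i) (L' i)) \<subseteq> insert ?p (set (take (x' i) (L i)))"
          using stack_update_miss[of "L i" "x' i" ?p "snd (wimp_view wt \<sigma> (Suc t))" "next_req \<sigma> (Suc t)"]
            dist miss unfolding upd by blast
        then have "N i \<subseteq> insert ?p (set (take (x' i) (L i)) - set (take (x i) (L i)))" by (auto simp: N_def)
        then have "card (N i) \<le> card (insert ?p (set (take (x' i) (L i)) - set (take (x i) (L i))))" by (intro card_mono) auto
        also have "\<dots> \<le> Suc (card (set (take (x' i) (L i)) - set (take (x i) (L i))))" by (rule card_insert_le_m1) auto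
        finally have "real (card (N i)) \<le> of_int \<bar>rounded (alloc \<sigma>) (Suc t) u i - rounded (alloc \<sigma>) t u i\<bar> + 1"
          using diff by linarith
        then have "W i * real (card (N i)) \<le> W i * (of_int \<bar>rounded (alloc \<sigma>) (Suc t) u i - rounded (alloc \<sigma>) t u i\<bar> + 1)"
          by (intro mult_left_mono W_nonneg)
        then show ?thesis using fault True by (simp add: distrib_left)
      qed
    qed
  qed
  have "(\<Sum>p\<in>S. wt p) = (\<Sum>i<l. v i * real (card (S \<inter> {p. wt p = v i})))" by (rule sum_weights_classes[OF finS])
  also have "\<dots> \<le> (\<Sum>i<l. W i * real (card (N i)))"
  proof (rule sum_mono)
    fix i assume "i \<in> {..<l}"
    then have i: "i < l" by simp
    have "card (S \<inter> {p. wt p = v i}) \<le> card (N i)" using sub[OF i] by (intro card_mono) (auto simp: N_def)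
    then show "v i * real (card (S \<inter> {p. wt p = v i})) \<le> W i * real (card (N i))"
      using lw_ge[OF i] v_pos[OF i] by (intro mult_mono) auto
  qed
  also have "\<dots> \<le> (\<Sum>i<l. W i * of_int \<bar>rounded (alloc \<sigma>) (Suc t) u i - rounded (alloc \<sigma>) t u i\<bar> + (if i = r then fault \<sigma> t else 0))"
    using cardN by (intro sum_mono) auto
  also have "\<dots> = (\<Sum>i<l. W i * of_int \<bar>rounded (alloc \<sigma>) (Suc t) u i - rounded (alloc \<sigma>) t u i\<bar>) + fault \<sigma> t"
    using r by (simp add: sum.distrib)
  finally show ?thesis by (simp only: S_def)
qed

lemma sa_opt_nonneg: "0 \<le> sa_opt l (\<lambda>i. real k * W i) (requests \<sigma> T) x"
proof -
  have "0 \<le> snd (request \<sigma> t) z" for t z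
    by (simp add: request_def W_nonneg)
  then show ?thesis
    unfolding sa_opt_def sa_cost_def requests_nth(2)
    by (intro Inf_greatest) (auto intro!: sum_nonneg add_nonneg_nonneg mult_nonneg_nonneg W_nonneg simp: requests_nth)
qed

lemma singleton_feasible: "feasible_caches k \<sigma> (\<lambda>t. if t = 0 then {} else {\<sigma>!(t - 1)})"
  using k by (simp add: feasible_caches_def)

text \<open>The offline value is finite, so a competitive algorithm never pays infinity; this yields
  the slot for the requested class and makes all cost terms real. With \<open>max 0 \<phi>\<close>
  the upper bound on the optimum can be multiplied by the ratio whatever its sign.\<close>

lemma alloc_bound:
  assumes A: "\<And>rs. list_all (valid_sa_request l) rs \<Longrightarrow> A rs \<in> sa_simplex l"
    and comp: "sa_cost l (\<lambda>i. real k * W i) (requests \<sigma> (length \<sigma>)) (\<lambda>t. A (take t (requests \<sigma> (length \<sigma>))))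
      \<le> ereal \<phi> * sa_opt l (\<lambda>i. real k * W i) (requests \<sigma> (length \<sigma>)) (A []) + ereal b"
    and feas: "feasible_caches k \<sigma> C"
  shows "\<And>t. t < length \<sigma> \<Longrightarrow> 1 \<le> alloc \<sigma> (Suc t) (cls (\<sigma>!t))"
    and "(\<Sum>t<length \<sigma>. \<Sum>i<l. W i * \<bar>alloc \<sigma> (Suc t) i - alloc \<sigma> t i\<bar>) + (\<Sum>t<length \<sigma>. fault \<sigma> t) \<le>
      max 0 \<phi> * ((\<Sum>i<l. real k * W i) + 45 * (\<Sum>t<length \<sigma>. \<Sum>p\<in>C (Suc t) - C t. wt p)) + b"
proof -
  define T where "T = length \<sigma>"
  define mv where "mv t = (\<Sum>i<l. W i * \<bar>alloc \<sigma> (Suc t) i - alloc \<sigma> t i\<bar>)" for t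
  define f where "f t = snd (request \<sigma> t) (A (requests \<sigma> (Suc t)) (cls (\<sigma>!t)))" for t
  define D where "D = max 0 \<phi> * ((\<Sum>i<l. real k * W i) + 45 * (\<Sum>t<length \<sigma>. \<Sum>p\<in>C (Suc t) - C t. wt p)) + b"
  have A0: "A [] \<in> sa_simplex l" using A[of "[]"] by simp
  have f0: "0 \<le> f t" for t by (simp add: f_def request_def W_nonneg)
  have mv0: "0 \<le> mv t" for t unfolding mv_def by (intro sum_nonneg mult_nonneg_nonneg W_nonneg) auto
  have mv_eq: "(\<Sum>i<l. real k * W i * \<bar>A (requests \<sigma> (Suc t)) i - A (requests \<sigma> t) i\<bar>) = mv t" for t
    unfolding mv_def
  proof (intro sum.cong refl)
    fix i
    have "\<bar>alloc \<sigma> (Suc t) i - alloc \<sigma> t i\<bar> = real k * \<bar>A (requests \<sigma> (Suc t)) i - A (requests \<sigma> t) i\<bar>"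
      unfolding alloc_def right_diff_distrib[symmetric] by (simp add: abs_mult)
    then show "real k * W i * \<bar>A (requests \<sigma> (Suc t)) i - A (requests \<sigma> t) i\<bar> = W i * \<bar>alloc \<sigma> (Suc t) i - alloc \<sigma> t i\<bar>" by simp
  qed
  have cost: "sa_cost l (\<lambda>i. real k * W i) (requests \<sigma> T) (\<lambda>t. A (take t (requests \<sigma> T))) = (\<Sum>t<T. ereal (mv t) + f t)"
    unfolding sa_cost_def requests_nth(2)
  proof (intro sum.cong refl)
    fix t assume "t \<in> {..<T}"
    then have t: "t < T" "Suc t \<le> T" "t \<le> T" by auto
    have "fst (request \<sigma> t) = cls (\<sigma>!t)" by (simp add: request_def)
    then show "ereal (\<Sum>i<l. real k * W i * \<bar>A (take (Suc t) (requests \<sigma> T)) i - A (take t (requests \<sigma> T)) i\<bar>) +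
        snd (requests \<sigma> T ! t) (A (take (Suc t) (requests \<sigma> T)) (fst (requests \<sigma> T ! t))) = ereal (mv t) + f t"
      using mv_eq[of t] by (simp only: take_requests[OF t(2)] take_requests[OF t(3)] requests_nth(1)[OF t(1)] f_def)
  qed
  define R where "R = (\<Sum>i<l. real k * W i) + 45 * (\<Sum>t<length \<sigma>. \<Sum>p\<in>C (Suc t) - C t. wt p)"
  define opt where "opt = sa_opt l (\<lambda>i. real k * W i) (requests \<sigma> T) (A [])"
  have opt: "0 \<le> opt" "opt \<le> ereal R"
    using sa_opt_nonneg sa_opt_le[OF feas A0] by (simp_all add: opt_def R_def T_def)
  define c where "c = max 0 \<phi>"
  have "0 \<le> c" "\<phi> \<le> c" by (simp_all add: c_def)
  then have c: "0 \<le> ereal c" "ereal \<phi> \<le> ereal c" by simp_all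
  have "ereal \<phi> * opt \<le> ereal c * opt" using opt(1) c by (intro ereal_mult_right_mono)
  also have "\<dots> \<le> ereal c * ereal R" using opt(2) c by (intro ereal_mult_left_mono)
  finally have "ereal \<phi> * opt + ereal b \<le> ereal (c * R) + ereal b" by (intro add_right_mono) simp
  moreover have "D = c * R + b" by (simp only: D_def c_def R_def)
  ultimately have total: "(\<Sum>t<T. ereal (mv t) + f t) \<le> ereal D"
    using comp unfolding T_def[symmetric] opt_def[symmetric] cost by simp
  have slot: "1 \<le> alloc \<sigma> (Suc t) (cls (\<sigma>!t))" if t: "t < T" for t
  proof (rule ccontr)
    assume "\<not> ?thesis"
    then have "f t = \<infinity>" by (simp add: f_def request_def alloc_def)
    moreover have "f t \<le> ereal (mv t) + f t" using mv0[of t] by (simp add: add_increasing)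
    moreover have "ereal (mv t) + f t \<le> (\<Sum>t<T. ereal (mv t) + f t)"
    proof -
      have "(\<Sum>t<T. ereal (mv t) + f t) = (ereal (mv t) + f t) + (\<Sum>t\<in>{..<T} - {t}. ereal (mv t) + f t)"
        using t by (intro sum.remove) auto
      moreover have "0 \<le> (\<Sum>t\<in>{..<T} - {t}. ereal (mv t) + f t)"
        using mv0 f0 by (intro sum_nonneg add_nonneg_nonneg) auto
      ultimately show ?thesis by (metis add_increasing2 order_refl)
    qed
    ultimately show False using total by auto
  qed
  then show "\<And>t. t < length \<sigma> \<Longrightarrow> 1 \<le> alloc \<sigma> (Suc t) (cls (\<sigma>!t))" by (simp add: T_def)
  have "f t = ereal (fault \<sigma> t)" if t: "t < T" for t
  proof -
    have "\<not> real k * A (requests \<sigma> (Suc t)) (cls (\<sigma>!t)) < 1" using slot[OF t] by (simp add: alloc_def)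
    then show ?thesis by (simp add: f_def request_def fault_def alloc_def)
  qed
  then have "(\<Sum>t<T. ereal (mv t) + f t) = (\<Sum>t<T. ereal (mv t + fault \<sigma> t))" by (intro sum.cong) auto
  also have "\<dots> = ereal ((\<Sum>t<T. mv t) + (\<Sum>t<T. fault \<sigma> t))" by (simp only: sum_ereal sum.distrib)
  finally have "(\<Sum>t<T. mv t) + (\<Sum>t<T. fault \<sigma> t) \<le> D" using total by simp
  then show "(\<Sum>t<length \<sigma>. \<Sum>i<l. W i * \<bar>alloc \<sigma> (Suc t) i - alloc \<sigma> t i\<bar>) + (\<Sum>t<length \<sigma>. fault \<sigma> t) \<le>
      max 0 \<phi> * ((\<Sum>i<l. real k * W i) + 45 * (\<Sum>t<length \<sigma>. \<Sum>p\<in>C (Suc t) - C t. wt p)) + b"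
    by (simp only: T_def mv_def D_def)
qed

text \<open>Faults carry over at face value and movement with a factor 11, so the expected cost is
  at most 11 times that of the fractional allocation. The latter is compared with every feasible
  \<open>C\<close> at a factor 45, and 11 * 45 = 495.\<close>

lemma alg_competitive:
  assumes comp: "sa_competitive l (\<lambda>i. real k * W i) A \<phi>"
  shows "rand_wimp_competitive wt k alg (495 * \<phi>)"
proof -
  let ?sw = "\<lambda>i. real k * W i"
  have A: "\<And>rs. list_all (valid_sa_request l) rs \<Longrightarrow> A rs \<in> sa_simplex l"
    using comp by (simp add: sa_competitive_def)
  obtain b where b: "\<And>rs. list_all (valid_sa_request l) rs \<Longrightarrow>
    sa_cost l ?sw rs (\<lambda>t. A (take t rs)) \<le> ereal \<phi> * sa_opt l ?sw rs (A []) + ereal b"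
    using comp by (auto simp: sa_competitive_def)
  \<comment> \<open>Any feasible sequence shows that the offline value is finite; caching only the
    current page is one.\<close>
  have slot: "1 \<le> alloc \<sigma> (Suc t) (cls (\<sigma>!t))" if "t < length \<sigma>" for \<sigma> t
    by (rule alloc_bound(1)[OF A b[OF valid_requests] singleton_feasible that])
  note bound = alloc_bound(2)[OF A b[OF valid_requests]]
  define b0 where "b0 = (\<Sum>i<l. real k * W i)"
  define c where "c = max 0 \<phi>"
  define b' where "b' = 11 * (c * b0 + \<bar>b\<bar>)"
  have c0: "0 \<le> c" by (simp add: c_def)
  have b0: "0 \<le> b0" unfolding b0_def by (intro sum_nonneg mult_nonneg_nonneg W_nonneg) simp
  have b'0: "0 \<le> b'" using c0 b0 by (simp add: b'_def)
  \<comment> \<open>\<open>ennreal\<close> truncates negative numbers to 0, so replacing a negative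
    ratio by 0 preserves the bound.\<close>
  have ennreal_c: "ennreal (495 * \<phi>) = ennreal (495 * c)"
    by (cases "0 \<le> \<phi>") (simp_all add: c_def max_def ennreal_neg)
  have alloc_simplex: "(\<Sum>i<l. alloc \<sigma> t i) = real k" "\<And>i. i < l \<Longrightarrow> 0 \<le> alloc \<sigma> t i" for \<sigma> t
    using A[OF valid_requests[of \<sigma> t]] by (simp_all add: alloc_def sum_distrib_left[symmetric] sa_simplex_def)
  have bal: "balanced (alloc \<sigma> t) (rounded (alloc \<sigma>) t u)" if "u \<in> {0..1}" for \<sigma> t u
    using rounded_good(1)[of "alloc \<sigma>" t] that by (simp add: good_start_def)
  have simple: "simple_rv (rounded (alloc \<sigma>) t)" for \<sigma> t
    using rounded_good(1)[of "alloc \<sigma>" t] by (simp add: good_start_def)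
  have X_floor: "\<lfloor>alloc \<sigma> t i\<rfloor> \<le> rounded (alloc \<sigma>) t u i" if "u \<in> {0..1}" "i < l" for \<sigma> t u i
    using bal[OF that(1), of \<sigma> t] that(2) by (simp add: balanced_def)
  have X_nonneg: "0 \<le> rounded (alloc \<sigma>) t u i" if "u \<in> {0..1}" "i < l" for \<sigma> t u i
    using X_floor[OF that, of \<sigma> t] alloc_simplex(2)[OF that(2), of \<sigma> t] by linarith
  \<comment> \<open>The prefix constraint at \<open>h = r\<close> covers all classes, and floor and
    ceiling of the integer \<open>k\<close> coincide.\<close>
  have X_sum: "(\<Sum>i<l. rounded (alloc \<sigma>) t u i) = int k" if "u \<in> {0..1}" for \<sigma> t u
    using bal[OF that, of \<sigma> t] alloc_simplex(1)[of \<sigma> t] unfolding balanced_def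
    by (metis ceiling_of_nat cut_r floor_of_nat order_antisym order_refl)
  have feasible: "feasible_caches k \<sigma> (wimp_caches (alg u) wt \<sigma>)" if u: "u \<in> {0..1}" for u \<sigma>
    unfolding feasible_caches_def
  proof (intro conjI allI impI)
    show "wimp_caches (alg u) wt \<sigma> 0 = {}" by (simp add: wimp_caches_def)
    fix t assume t: "1 \<le> t \<and> t \<le> length \<sigma>"
    then have eq: "wimp_caches (alg u) wt \<sigma> t = cache u \<sigma> t" by (simp add: wimp_caches_alg)
    show "finite (wimp_caches (alg u) wt \<sigma> t)" unfolding eq by (rule finite_cache)
    have "card (cache u \<sigma> t) \<le> (\<Sum>i<l. card (set (take (nat (rounded (alloc \<sigma>) t u i)) (class_stack wt \<sigma> (v i) t))))"
      unfolding cache_def by (rule card_UN_le) simp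
    also have "\<dots> \<le> (\<Sum>i<l. nat (rounded (alloc \<sigma>) t u i))"
      by (intro sum_mono order_trans[OF card_length]) simp
    also have "\<dots> = nat (\<Sum>i<l. rounded (alloc \<sigma>) t u i)"
    proof -
      have "int (\<Sum>i<l. nat (rounded (alloc \<sigma>) t u i)) = (\<Sum>i<l. rounded (alloc \<sigma>) t u i)"
        unfolding of_nat_sum using X_nonneg[OF u] by (intro sum.cong) auto
      then show ?thesis by (metis nat_int)
    qed
    also have "\<dots> = k" using X_sum[OF u] by simp
    finally show "card (wimp_caches (alg u) wt \<sigma> t) \<le> k" unfolding eq .
    obtain s where s: "t = Suc s" "s < length \<sigma>" using t by (cases t) auto
    define r where "r = cls (\<sigma>!s)"
    have r: "r < l" "wt (\<sigma>!s) = v r" using cls_less wt_eq by (simp_all add: r_def)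
    have "1 \<le> alloc \<sigma> t r" using slot[OF s(2)] by (simp add: r_def s(1))
    then have "1 \<le> \<lfloor>alloc \<sigma> t r\<rfloor>" by simp
    then have "1 \<le> rounded (alloc \<sigma>) t u r" using X_floor[OF u r(1), of \<sigma> t] by linarith
    then have "1 \<le> nat (rounded (alloc \<sigma>) t u r)" by linarith
    then have "\<sigma>!s \<in> set (take (nat (rounded (alloc \<sigma>) (Suc s) u r)) (class_stack wt \<sigma> (v r) (Suc s)))"
      using r(2) by (simp add: s(1) hd_stack_update)
    then show "\<sigma>!(t - 1) \<in> wimp_caches (alg u) wt \<sigma> t"
      unfolding s(1) diff_Suc_1 eq[unfolded s(1)] cache_def using r(1) by blast
  qed
  have cost_eq: "paging_cost wt \<sigma> (wimp_caches (alg u) wt \<sigma>) =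
      ennreal (\<Sum>t<length \<sigma>. \<Sum>p\<in>cache u \<sigma> (Suc t) - cache u \<sigma> t. wt p)" for u \<sigma>
  proof -
    have wt0: "0 \<le> wt p" for p using v_pos[OF cls_less] wt_eq less_imp_le by metis
    have "paging_cost wt \<sigma> (wimp_caches (alg u) wt \<sigma>) =
        (\<Sum>t<length \<sigma>. \<Sum>p\<in>cache u \<sigma> (Suc t) - cache u \<sigma> t. ennreal (wt p))"
      unfolding paging_cost_def by (intro sum.cong refl) (simp add: wimp_caches_alg)
    then show ?thesis using wt0 by (simp add: sum_ennreal sum_nonneg)
  qed
  have cost_simple: "simple_rv (\<lambda>u. \<Sum>p\<in>cache u \<sigma> (Suc t) - cache u \<sigma> t. wt p)" for \<sigma> t
    unfolding cache_def
    by (rule simple_function_compose2[OF simple[of \<sigma> "Suc t"] simple[of \<sigma> t],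
        of "\<lambda>x y. \<Sum>p\<in>(\<Union>i<l. set (take (nat (x i)) (class_stack wt \<sigma> (v i) (Suc t)))) -
          (\<Union>i<l. set (take (nat (y i)) (class_stack wt \<sigma> (v i) t))). wt p"])
  have cost_meas: "(\<lambda>u. paging_cost wt \<sigma> (wimp_caches (alg u) wt \<sigma>)) \<in> borel_measurable unit_space" for \<sigma>
    unfolding cost_eq using borel_measurable_integrable[OF simple_integrable[OF cost_simple]] by measurable
  have indicator_eq: "(\<lambda>u. indicator {0..1} u * g u) = (\<lambda>u. g u * indicator {0..1} u)" for g :: "real \<Rightarrow> ennreal"
    by (simp add: mult.commute)
  have meas: "(\<lambda>u. indicator {0..1} u * paging_cost wt \<sigma> (wimp_caches (alg u) wt \<sigma>)) \<in> borel_measurable lborel" for \<sigma>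
    using cost_meas[of \<sigma>] unfolding indicator_eq unit_space_def
    by (subst (asm) borel_measurable_restrict_space_iff_ennreal) auto
  have expected: "(\<integral>\<^sup>+u. indicator {0..1} u * paging_cost wt \<sigma> (wimp_caches (alg u) wt \<sigma>) \<partial>lborel)
      \<le> ennreal (495 * c) * paging_cost wt \<sigma> C + ennreal b'" if feas: "feasible_caches k \<sigma> C" for \<sigma> C
  proof -
    define T where "T = length \<sigma>"
    define X where "X = rounded (alloc \<sigma>)"
    define pc where "pc = (\<Sum>t<T. \<Sum>p\<in>C (Suc t) - C t. wt p)"
    have wt0: "0 \<le> wt p" for p using v_pos[OF cls_less] wt_eq less_imp_le by metis
    have pc: "paging_cost wt \<sigma> C = ennreal pc" "0 \<le> pc"
      using wt0 by (simp_all add: paging_cost_def pc_def T_def sum_ennreal sum_nonneg)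
    have simpleX: "simple_rv (X t)" for t unfolding X_def by (rule simple)
    have iX: "integrable unit_space (\<lambda>u. real_of_int \<bar>X (Suc t) u i - X t u i\<bar>)" for t i
      by (rule integrable_compose2[OF simpleX[of "Suc t"] simpleX[of t], of "\<lambda>x y. real_of_int \<bar>x i - y i\<bar>"])
    define h where "h u = (\<Sum>t<T. (\<Sum>i<l. W i * of_int \<bar>X (Suc t) u i - X t u i\<bar>) + fault \<sigma> t)" for u
    have h_nonneg: "0 \<le> h u" for u
      unfolding h_def by (intro sum_nonneg add_nonneg_nonneg mult_nonneg_nonneg W_nonneg fault_nonneg) simp
    have h_int: "integrable unit_space h"
      unfolding h_def using iX
      by (intro Bochner_Integration.integrable_sum Bochner_Integration.integrable_add integrable_mult_right) auto
    have step: "expect (\<lambda>u. (\<Sum>i<l. W i * of_int \<bar>X (Suc t) u i - X t u i\<bar>) + fault \<sigma> t) \<le>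
        11 * (\<Sum>i<l. W i * \<bar>alloc \<sigma> (Suc t) i - alloc \<sigma> t i\<bar>) + fault \<sigma> t" for t
    proof -
      have int_sum: "integrable unit_space (\<lambda>u. \<Sum>i<l. W i * of_int \<bar>X (Suc t) u i - X t u i\<bar>)"
        by (intro Bochner_Integration.integrable_sum integrable_mult_right iX)
      have "expect (\<lambda>u. (\<Sum>i<l. W i * of_int \<bar>X (Suc t) u i - X t u i\<bar>) + fault \<sigma> t) =
          expect (\<lambda>u. \<Sum>i<l. W i * of_int \<bar>X (Suc t) u i - X t u i\<bar>) + expect (\<lambda>u. fault \<sigma> t)"
        using int_sum by (rule Bochner_Integration.integral_add) simp
      moreover have "expect (\<lambda>u. fault \<sigma> t) = fault \<sigma> t" by simp
      moreover have "expect (\<lambda>u. \<Sum>i<l. W i * of_int \<bar>X (Suc t) u i - X t u i\<bar>) =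
          (\<Sum>i<l. expect (\<lambda>u. W i * of_int \<bar>X (Suc t) u i - X t u i\<bar>))"
        by (intro Bochner_Integration.integral_sum integrable_mult_right iX)
      moreover have "expect (\<lambda>u. W i * of_int \<bar>X (Suc t) u i - X t u i\<bar>) =
          W i * expect (\<lambda>u. of_int \<bar>X (Suc t) u i - X t u i\<bar>)" for i
        by (rule integral_mult_right_zero)
      moreover have "(\<Sum>i<l. W i * expect (\<lambda>u. of_int \<bar>X (Suc t) u i - X t u i\<bar>)) \<le>
          11 * (\<Sum>i<l. W i * \<bar>alloc \<sigma> (Suc t) i - alloc \<sigma> t i\<bar>)"
        using rounded_good(2)[where m = "alloc \<sigma>" and t = t] unfolding good_step_def X_def by blast
      ultimately show ?thesis by (simp only: add_le_cancel_right)
    qed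
    have "(\<integral>\<^sup>+u. indicator {0..1} u * paging_cost wt \<sigma> (wimp_caches (alg u) wt \<sigma>) \<partial>lborel) =
        (\<integral>\<^sup>+u. paging_cost wt \<sigma> (wimp_caches (alg u) wt \<sigma>) \<partial>unit_space)"
      unfolding unit_space_def indicator_eq by (subst nn_integral_restrict_space) auto
    also have "\<dots> \<le> (\<integral>\<^sup>+u. ennreal (h u) \<partial>unit_space)"
    proof (rule nn_integral_mono)
      fix u assume "u \<in> space unit_space"
      then have u: "u \<in> {0..1}" by simp
      show "paging_cost wt \<sigma> (wimp_caches (alg u) wt \<sigma>) \<le> ennreal (h u)"
        unfolding cost_eq h_def T_def X_def
      proof (intro ennreal_leI sum_mono cache_step_weight)
        fix t assume "t \<in> {..<length \<sigma>}"
        then show "1 \<le> alloc \<sigma> (Suc t) (cls (\<sigma>!t))" by (intro slot) simp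
        show "\<lfloor>alloc \<sigma> (Suc t) (cls (\<sigma>!t))\<rfloor> \<le> rounded (alloc \<sigma>) (Suc t) u (cls (\<sigma>!t))"
          by (rule X_floor[OF u cls_less])
      qed
    qed
    also have "\<dots> = ennreal (expect h)"
      using h_int h_nonneg by (intro nn_integral_eq_integral) auto
    also have "\<dots> \<le> ennreal (495 * c * pc + b')"
    proof (rule ennreal_leI)
      have "expect h = (\<Sum>t<T. expect (\<lambda>u. (\<Sum>i<l. W i * of_int \<bar>X (Suc t) u i - X t u i\<bar>) + fault \<sigma> t))"
        unfolding h_def using iX
        by (intro Bochner_Integration.integral_sum Bochner_Integration.integrable_add Bochner_Integration.integrable_sum integrable_mult_right) auto
      also have "\<dots> \<le> (\<Sum>t<T. 11 * (\<Sum>i<l. W i * \<bar>alloc \<sigma> (Suc t) i - alloc \<sigma> t i\<bar>) + fault \<sigma> t)"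
        by (rule sum_mono[OF step])
      \<comment> \<open>Faults are also counted 11 times, so that movement and faults share one
        factor and \<open>bound\<close> applies to their sum.\<close>
      also have "\<dots> \<le> (\<Sum>t<T. 11 * (\<Sum>i<l. W i * \<bar>alloc \<sigma> (Suc t) i - alloc \<sigma> t i\<bar>) + 11 * fault \<sigma> t)"
      proof (rule sum_mono)
        fix t
        show "11 * (\<Sum>i<l. W i * \<bar>alloc \<sigma> (Suc t) i - alloc \<sigma> t i\<bar>) + fault \<sigma> t \<le>
          11 * (\<Sum>i<l. W i * \<bar>alloc \<sigma> (Suc t) i - alloc \<sigma> t i\<bar>) + 11 * fault \<sigma> t"
          using fault_nonneg[of \<sigma> t] by simp
      qed
      also have "\<dots> = 11 * ((\<Sum>t<T. \<Sum>i<l. W i * \<bar>alloc \<sigma> (Suc t) i - alloc \<sigma> t i\<bar>) + (\<Sum>t<T. fault \<sigma> t))"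
        by (simp only: sum.distrib sum_distrib_left[symmetric] distrib_left)
      also have "\<dots> \<le> 11 * (c * (b0 + 45 * pc) + b)"
        using bound[OF _ feas] unfolding T_def c_def b0_def pc_def by (intro mult_left_mono) auto
      also have "\<dots> \<le> 495 * c * pc + b'" by (simp add: b'_def algebra_simps)
      finally show "expect h \<le> 495 * c * pc + b'" .
    qed
    also have "\<dots> = ennreal (495 * c) * paging_cost wt \<sigma> C + ennreal b'"
      using c0 pc b'0 by (simp add: ennreal_mult ennreal_plus)
    finally show ?thesis .
  qed
  have "(\<integral>\<^sup>+u. indicator {0..1} u * paging_cost wt \<sigma> (wimp_caches (alg u) wt \<sigma>) \<partial>lborel)
      \<le> ennreal (495 * \<phi>) * paging_opt wt k \<sigma> + ennreal b'" for \<sigma>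
    unfolding paging_opt_def ennreal_c
  proof (rule ennreal_affine_le_Inf)
    show "{paging_cost wt \<sigma> C |C. feasible_caches k \<sigma> C} \<noteq> {}" using singleton_feasible by blast
    show "x < top" if "x \<in> {paging_cost wt \<sigma> C |C. feasible_caches k \<sigma> C}" for x
    proof -
      have "0 \<le> wt p" for p using v_pos[OF cls_less] wt_eq less_imp_le by metis
      then show ?thesis using that by (auto simp: paging_cost_def sum_ennreal sum_nonneg)
    qed
    show "(\<integral>\<^sup>+u. indicator {0..1} u * paging_cost wt \<sigma> (wimp_caches (alg u) wt \<sigma>) \<partial>lborel) \<le>
        ennreal (495 * c) * x + ennreal b'" if "x \<in> {paging_cost wt \<sigma> C |C. feasible_caches k \<sigma> C}" for x
      using that expected by blast
  qed (use c0 in simp)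
  then show ?thesis
    unfolding rand_wimp_competitive_def using feasible meas by blast
qed

end

section \<open>Sorting the weight classes and rounding their weights\<close>

theorem theorem3:
  shows "\<exists>C::real. C > 0 \<and> (\<forall>(l::nat) (\<phi>::nat \<Rightarrow> real).
     (\<forall>w::nat \<Rightarrow> real. (\<forall>i<l. 0 < w i) \<longrightarrow> (\<exists>A::sa_alg. sa_competitive l w A (\<phi> l))) \<longrightarrow>
     (\<forall>(wt::nat \<Rightarrow> real) (k::nat). (\<forall>p. 0 < wt p) \<and> finite (range wt) \<and> card (range wt) = l \<and> 1 \<le> k \<longrightarrow>
        (\<exists>A::real \<Rightarrow> wimp_alg. rand_wimp_competitive wt k A (C * \<phi> l))))"
proof (intro exI[of _ "495::real"] conjI allI impI)
  fix l :: nat and \<phi> :: "nat \<Rightarrow> real" and wt :: "nat \<Rightarrow> real" and k :: nat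
  assume SA: "\<forall>w::nat \<Rightarrow> real. (\<forall>i<l. 0 < w i) \<longrightarrow> (\<exists>A::sa_alg. sa_competitive l w A (\<phi> l))"
    and wt: "(\<forall>p. 0 < wt p) \<and> finite (range wt) \<and> card (range wt) = l \<and> 1 \<le> k"
  define vs where "vs = sorted_list_of_set (range wt)"
  \<comment> \<open>Reversing the sorted list puts the heaviest class first, as the levels
    require.\<close>
  define v where "v i = vs ! (l - 1 - i)" for i
  have len: "length vs = l" and set_vs: "set vs = range wt" and strict: "sorted_wrt (<) vs"
    using wt by (simp_all add: vs_def)
  have l: "1 \<le> l" using wt card_gt_0_iff[of "range wt"] by (simp add: Suc_le_eq)
  have v_less: "v j < v i" if "i < j" "j < l" for i j
    using strict that len by (simp add: v_def sorted_wrt_iff_nth_less)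
  have v_inj: "i = j" if "v i = v j" "i < l" "j < l" for i j
    using v_less[of i j] v_less[of j i] that by (metis less_irrefl linorder_less_linear)
  have v_range: "v i \<in> range wt" if "i < l" for i
    using that len nth_mem[of "l - 1 - i" vs] by (simp add: v_def set_vs)
  have v_pos: "0 < v i" if "i < l" for i using v_range[OF that] wt by auto
  have "\<exists>i<l. v i = wt p" for p
  proof -
    obtain j where "j < l" "vs ! j = wt p" using set_vs len by (metis in_set_conv_nth rangeI)
    then show ?thesis by (intro exI[of _ "l - 1 - j"]) (simp add: v_def)
  qed
  then obtain cls where cls: "\<And>p. cls p < l" "\<And>p. v (cls p) = wt p" by metis
  \<comment> \<open>Taking the floor of the logarithm rounds the weight up, by a factor of at most
    5.\<close>
  define lev where "lev i = nat \<lfloor>log 5 (v 0 / v i)\<rfloor>" for i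
  have v_le: "v j \<le> v i" if "i \<le> j" "j < l" for i j
    using v_less[of i j] that by (cases "i = j") auto
  have lev_mono: "lev i \<le> lev j" if "i \<le> j" "j < l" for i j
    unfolding lev_def
  proof (intro nat_mono floor_mono)
    have "v 0 / v i \<le> v 0 / v j"
      using v_le[OF that] v_pos[of 0] v_pos[of i] v_pos[of j] that by (intro divide_left_mono) auto
    then show "log 5 (v 0 / v i) \<le> log 5 (v 0 / v j)"
      using v_pos[of 0] v_pos[of i] v_pos[of j] that by (subst log_le_cancel_iff) auto
  qed
  have lev_bounds: "v i \<le> v 0 / 5 ^ lev i \<and> v 0 / 5 ^ lev i \<le> 5 * v i" if i: "i < l" for i
  proof -
    define x where "x = v 0 / v i"
    have x: "1 \<le> x" using v_le[of 0 i] v_pos[OF i] i by (simp add: x_def)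
    have "0 \<le> log 5 x" using x by simp
    then have lev: "real (lev i) \<le> log 5 x" "log 5 x < real (lev i) + 1"
      by (simp_all add: lev_def x_def[symmetric])
    have "5 powr real (lev i) \<le> x" using lev(1) x by (subst (asm) le_log_iff) auto
    moreover have "x < 5 powr (real (lev i) + 1)" using lev(2) x by (subst (asm) log_less_iff) auto
    ultimately have "5 ^ lev i \<le> x" "x \<le> 5 * 5 ^ lev i" by (simp_all add: powr_add powr_realpow)
    then show ?thesis using v_pos[OF i] by (simp add: x_def field_simps)
  qed
  \<comment> \<open>The factor \<open>k\<close> converts movement in the simplex into movement of
    slots; the assumed algorithm is taken for these rounded weights, not for the original
    ones.\<close>
  let ?sw = "\<lambda>i. real k * (v 0 / 5 ^ lev i)"
  have "\<forall>i<l. 0 < ?sw i" using wt v_pos[of 0] l by simp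
  then have "\<exists>A. sa_competitive l ?sw A (\<phi> l)" using spec[OF SA, of ?sw] by simp
  then obtain A where A: "sa_competitive l ?sw A (\<phi> l)" by blast
  have levels: "level_weights l (Suc (lev (l - 1))) lev (v 0)"
  proof
    show "lev i < Suc (lev (l - 1))" if "i < l" for i
    proof -
      have "i \<le> l - 1" using that by linarith
      then show ?thesis using lev_mono[of i "l - 1"] l by simp
    qed
  qed (use lev_mono v_pos l in auto)
  then interpret level_weights l "Suc (lev (l - 1))" lev "v 0" .
  interpret wimp_reduction l "Suc (lev (l - 1))" lev "v 0" wt k v cls A
  proof
    show "wt p = v i \<longleftrightarrow> cls p = i" if "i < l" for p i using cls v_inj that by metis
  qed (use wt l v_pos cls lev_bounds in \<open>auto simp: lw_def\<close>)
  have "rand_wimp_competitive wt k alg (495 * \<phi> l)"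
    using A by (intro alg_competitive) (simp add: lw_def)
  then show "\<exists>A::real \<Rightarrow> wimp_alg. rand_wimp_competitive wt k A (495 * \<phi> l)" by blast
qed simp

end
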